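(* Let $V_*\otimes V\to\mathbb{C}$ be a non-degenerate pairing between countably infinite-dimensional complex vector spaces, and let $\mathfrak{g}^M\subseteq\mathrm{End}(V)$ be the associated Mackey Lie algebra. Then every object of $\mathbb{T}_{\mathrm{End}(V)}$ has finite length when regarded as a $\mathfrak{g}^M$-module by restriction.
   Context: The pairing realizes $V_*$ as a subspace of the full algebraic dual $V^*$. The Mackey Lie algebra $\mathfrak{g}^M$ of the pair $(V,V_* )$ is the Lie algebra (under commutator) of all linear endomorphisms of $V$ whose dual endomorphism of $V^*$ maps $V_*$ into $V_*$. $\mathrm{End}(V)$ is the Lie algebra of all linear endomorphisms of $V$; it acts on $V$ and, dually, on $V^*$ (by $(af)(v)=-f(av)$). $\mathbb{T}_{\mathrm{End}(V)}$ is the full subcategory of $\mathrm{End}(V)$-modules consisting of finite length modules isomorphic to subquotients of finite direct sums of copies of the tensor algebra $T(V^*\oplus V)$. *)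

theory Defs
  imports
    Complex_Main
    "HOL-Library.Countable_Set"
    "HOL-Library.Function_Algebras"
    "HOL-Library.Product_Plus"
    "HOL-Library.Set_Algebras"
    "HOL-Library.Poly_Mapping"
begin

section \<open>Complex vector spaces\<close>

class complex_vector = ab_group_add +
  fixes scaleC :: "complex \<Rightarrow> 'a \<Rightarrow> 'a" (infixr "*\<^sub>C" 75)
  assumes scaleC_add_right: "c *\<^sub>C (x + y) = c *\<^sub>C x + c *\<^sub>C y"
    and scaleC_add_left: "(c + d) *\<^sub>C x = c *\<^sub>C x + d *\<^sub>C x"
    and scaleC_scaleC: "c *\<^sub>C d *\<^sub>C x = (c * d) *\<^sub>C x"
    and scaleC_one: "1 *\<^sub>C x = x"

global_interpretation cvs: vector_space "scaleC :: complex \<Rightarrow> 'a \<Rightarrow> 'a::complex_vector"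
  by unfold_locales (fact scaleC_add_right scaleC_add_left scaleC_scaleC scaleC_one)+

abbreviation clinear :: "('a::complex_vector \<Rightarrow> 'b::complex_vector) \<Rightarrow> bool" where
  "clinear \<equiv> Vector_Spaces.linear scaleC scaleC"

lemma clinear_iff:
  "clinear f \<longleftrightarrow> (\<forall>x y. f (x + y) = f x + f y) \<and> (\<forall>c x. f (c *\<^sub>C x) = c *\<^sub>C f x)"
  by (auto simp: Vector_Spaces.linear_iff cvs.vector_space_axioms)

instantiation complex :: complex_vector
begin
definition scaleC_complex :: "complex \<Rightarrow> complex \<Rightarrow> complex" where
  "scaleC_complex = (*)"
instance by standard (auto simp: scaleC_complex_def algebra_simps)
end

instantiation prod :: (complex_vector, complex_vector) complex_vector
begin
definition scaleC_prod :: "complex \<Rightarrow> 'a \<times> 'b \<Rightarrow> 'a \<times> 'b" where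
  "scaleC_prod c p = (c *\<^sub>C fst p, c *\<^sub>C snd p)"
instance by standard
  (auto simp: scaleC_prod_def cvs.scale_right_distrib cvs.scale_left_distrib)
end

instantiation "fun" :: (type, complex_vector) complex_vector
begin
definition scaleC_fun :: "complex \<Rightarrow> ('a \<Rightarrow> 'b) \<Rightarrow> 'a \<Rightarrow> 'b" where
  "scaleC_fun c f = (\<lambda>x. c *\<^sub>C f x)"
instance by standard
  (auto simp: scaleC_fun_def fun_eq_iff cvs.scale_right_distrib cvs.scale_left_distrib)
end

instantiation poly_mapping :: (type, complex_vector) complex_vector
begin
definition scaleC_poly_mapping :: "complex \<Rightarrow> ('a \<Rightarrow>\<^sub>0 'b) \<Rightarrow> 'a \<Rightarrow>\<^sub>0 'b" where
  "scaleC_poly_mapping c p = Poly_Mapping.map (scaleC c) p"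

lemma lookup_scaleC [simp]:
  "Poly_Mapping.lookup (c *\<^sub>C p) k = c *\<^sub>C Poly_Mapping.lookup p k"
  for p :: "'a \<Rightarrow>\<^sub>0 'b"
  unfolding scaleC_poly_mapping_def by transfer (auto simp: when_def)

instance by standard
  (auto intro!: poly_mapping_eqI simp: lookup_add cvs.scale_right_distrib cvs.scale_left_distrib)
end

definition countably_infinite_dimensional :: "'a::complex_vector itself \<Rightarrow> bool" where
  "countably_infinite_dimensional _ \<longleftrightarrow>
     (\<exists>B::'a set. cvs.independent B \<and> cvs.span B = UNIV \<and> countable B \<and> infinite B)"


section \<open>Endomorphisms and dual spaces\<close>

typedef (overloaded) 'a endo = "{f :: 'a::complex_vector \<Rightarrow> 'a. clinear f}"
  morphisms endo_apply Endo
  by (rule exI[of _ "\<lambda>x. x"]) (simp add: clinear_iff)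

setup_lifting type_definition_endo

lemma endo_add: "endo_apply a (x + y) = endo_apply a x + endo_apply a y"
  and endo_scaleC: "endo_apply a (c *\<^sub>C x) = c *\<^sub>C endo_apply a x"
  using endo_apply[of a] by (auto simp: clinear_iff)

instantiation endo :: (complex_vector) complex_vector
begin
lift_definition zero_endo :: "'a endo" is "\<lambda>x. 0" by (simp add: clinear_iff)
lift_definition plus_endo :: "'a endo \<Rightarrow> 'a endo \<Rightarrow> 'a endo" is "\<lambda>f g x. f x + g x"
  by (simp add: clinear_iff cvs.scale_right_distrib algebra_simps)
lift_definition minus_endo :: "'a endo \<Rightarrow> 'a endo \<Rightarrow> 'a endo" is "\<lambda>f g x. f x - g x"
  by (simp add: clinear_iff cvs.scale_right_diff_distrib algebra_simps)
lift_definition uminus_endo :: "'a endo \<Rightarrow> 'a endo" is "\<lambda>f x. - f x"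
  by (simp add: clinear_iff)
lift_definition scaleC_endo :: "complex \<Rightarrow> 'a endo \<Rightarrow> 'a endo" is "\<lambda>c f x. c *\<^sub>C f x"
  by (simp add: clinear_iff cvs.scale_right_distrib cvs.scale_left_commute)
instance
  by standard (transfer; simp add: fun_eq_iff cvs.scale_right_distrib cvs.scale_left_distrib)+
end

lift_definition commutator :: "'a::complex_vector endo \<Rightarrow> 'a endo \<Rightarrow> 'a endo"
  is "\<lambda>f g x. f (g x) - g (f x)"
  by (simp add: clinear_iff cvs.scale_right_diff_distrib)

typedef (overloaded) 'a dual = "{f :: 'a::complex_vector \<Rightarrow> complex. clinear f}"
  morphisms dual_apply Dual
  by (rule exI[of _ "\<lambda>x. 0"]) (simp add: clinear_iff)

setup_lifting type_definition_dual

instantiation dual :: (complex_vector) complex_vector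
begin
lift_definition zero_dual :: "'a dual" is "\<lambda>x. 0" by (simp add: clinear_iff)
lift_definition plus_dual :: "'a dual \<Rightarrow> 'a dual \<Rightarrow> 'a dual" is "\<lambda>f g x. f x + g x"
  by (simp add: clinear_iff cvs.scale_right_distrib algebra_simps)
lift_definition minus_dual :: "'a dual \<Rightarrow> 'a dual \<Rightarrow> 'a dual" is "\<lambda>f g x. f x - g x"
  by (simp add: clinear_iff cvs.scale_right_diff_distrib algebra_simps)
lift_definition uminus_dual :: "'a dual \<Rightarrow> 'a dual" is "\<lambda>f x. - f x"
  by (simp add: clinear_iff)
lift_definition scaleC_dual :: "complex \<Rightarrow> 'a dual \<Rightarrow> 'a dual" is "\<lambda>c f x. c *\<^sub>C f x"
  by (simp add: clinear_iff cvs.scale_right_distrib cvs.scale_left_commute)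
instance
  by standard (transfer; simp add: fun_eq_iff cvs.scale_right_distrib cvs.scale_left_distrib)+
end

lift_definition dual_endo :: "'a::complex_vector endo \<Rightarrow> 'a dual \<Rightarrow> 'a dual"
  is "\<lambda>a f x. f (a x)"
  by (simp add: clinear_iff)


section \<open>Pairings and the Mackey Lie algebra\<close>

text \<open>A linear map out of the tensor product of the two spaces is given as a bilinear map.\<close>

definition nondegenerate_pairing ::
    "('w::complex_vector \<Rightarrow> 'v::complex_vector \<Rightarrow> complex) \<Rightarrow> bool" where
  "nondegenerate_pairing P \<longleftrightarrow>
     (\<forall>v. clinear (\<lambda>w. P w v)) \<and> (\<forall>w. clinear (P w)) \<and>
     (\<forall>w. (\<forall>v. P w v = 0) \<longrightarrow> w = 0) \<and> (\<forall>v. (\<forall>w. P w v = 0) \<longrightarrow> v = 0)"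

definition pairing_image :: "('w \<Rightarrow> 'v::complex_vector \<Rightarrow> complex) \<Rightarrow> 'v dual set" where
  "pairing_image P = {f. \<exists>w. dual_apply f = P w}"

definition mackey_algebra :: "('w \<Rightarrow> 'v::complex_vector \<Rightarrow> complex) \<Rightarrow> 'v endo set" where
  "mackey_algebra P = {a. dual_endo a ` pairing_image P \<subseteq> pairing_image P}"

lemma mackey_algebra_lie_subalgebra:
  assumes "nondegenerate_pairing P"
  shows "cvs.subspace (mackey_algebra P)"
    and "a \<in> mackey_algebra P \<Longrightarrow> b \<in> mackey_algebra P \<Longrightarrow> commutator a b \<in> mackey_algebra P"
proof -
  have add: "P (w + w') v = P w v + P w' v" and scale: "P (c *\<^sub>C w) v = c *\<^sub>C P w v"
    and add': "P w (v + v') = P w v + P w v'" and scale': "P w (c *\<^sub>C v) = c *\<^sub>C P w v"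
    for w w' v v' c
    using assms by (auto simp: nondegenerate_pairing_def clinear_iff)
  have zero: "P 0 v = 0" and zero': "P w 0 = 0" for w v
    using scale[of 0 0 v] scale'[of w 0 0] by simp_all
  have diff: "P (w - w') v = P w v - P w' v" for w w' v
    using add[of "w - w'" w' v] by simp
  have diff': "P w (v - v') = P w v - P w v'" for w v v'
    using add'[of w "v - v'" v'] by simp
  have lin: "clinear (P w)" for w
    using assms by (simp add: nondegenerate_pairing_def)
  have mem: "a \<in> mackey_algebra P \<longleftrightarrow> (\<forall>w. \<exists>w'. \<forall>v. P w (endo_apply a v) = P w' v)" for a
  proof
    assume a: "a \<in> mackey_algebra P"
    show "\<forall>w. \<exists>w'. \<forall>v. P w (endo_apply a v) = P w' v"
    proof
      fix w
      have "Dual (P w) \<in> pairing_image P"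
        using lin by (auto simp: pairing_image_def Dual_inverse)
      then have "dual_endo a (Dual (P w)) \<in> pairing_image P"
        using a by (auto simp: mackey_algebra_def)
      then show "\<exists>w'. \<forall>v. P w (endo_apply a v) = P w' v"
        using lin by (auto simp: pairing_image_def dual_endo.rep_eq Dual_inverse fun_eq_iff)
    qed
  next
    assume "\<forall>w. \<exists>w'. \<forall>v. P w (endo_apply a v) = P w' v"
    then show "a \<in> mackey_algebra P"
      by (auto simp: mackey_algebra_def pairing_image_def dual_endo.rep_eq fun_eq_iff)
  qed
  show "cvs.subspace (mackey_algebra P)"
  proof (rule cvs.subspaceI)
    show "0 \<in> mackey_algebra P"
      unfolding mem zero_endo.rep_eq zero' by (intro allI exI[of _ 0]) (simp add: zero)
  next
    fix a b assume a: "a \<in> mackey_algebra P" and b: "b \<in> mackey_algebra P"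
    show "a + b \<in> mackey_algebra P"
      unfolding mem
    proof
      fix w
      obtain w1 where w1: "\<And>v. P w (endo_apply a v) = P w1 v"
        using a unfolding mem by blast
      obtain w2 where w2: "\<And>v. P w (endo_apply b v) = P w2 v"
        using b unfolding mem by blast
      have "\<forall>v. P w (endo_apply (a + b) v) = P (w1 + w2) v"
        by (simp add: plus_endo.rep_eq add add' w1 w2)
      then show "\<exists>w'. \<forall>v. P w (endo_apply (a + b) v) = P w' v" ..
    qed
  next
    fix c a assume a: "a \<in> mackey_algebra P"
    show "c *\<^sub>C a \<in> mackey_algebra P"
      unfolding mem
    proof
      fix w
      obtain w1 where w1: "\<And>v. P w (endo_apply a v) = P w1 v"
        using a unfolding mem by blast
      have "\<forall>v. P w (endo_apply (c *\<^sub>C a) v) = P (c *\<^sub>C w1) v"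
        by (simp add: scaleC_endo.rep_eq scale scale' w1)
      then show "\<exists>w'. \<forall>v. P w (endo_apply (c *\<^sub>C a) v) = P w' v" ..
    qed
  qed
  show "commutator a b \<in> mackey_algebra P"
    if a: "a \<in> mackey_algebra P" and b: "b \<in> mackey_algebra P"
    unfolding mem
  proof
    fix w
    obtain w1 where w1: "\<And>v. P w (endo_apply a v) = P w1 v"
      using a unfolding mem by blast
    obtain w2 where w2: "\<And>v. P w1 (endo_apply b v) = P w2 v"
      using b unfolding mem by blast
    obtain w3 where w3: "\<And>v. P w (endo_apply b v) = P w3 v"
      using b unfolding mem by blast
    obtain w4 where w4: "\<And>v. P w3 (endo_apply a v) = P w4 v"
      using a unfolding mem by blast
    have "\<forall>v. P w (endo_apply (commutator a b) v) = P (w2 - w4) v"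
      by (simp add: commutator.rep_eq diff diff' w1 w2 w3 w4)
    then show "\<exists>w'. \<forall>v. P w (endo_apply (commutator a b) v) = P w' v" ..
  qed
qed


section \<open>Representations and finite length\<close>

text \<open>
  A module over the Lie algebra \<open>End(V)\<close> is a homomorphism of Lie algebras from \<open>End(V)\<close> to the
  endomorphisms of a vector space. For a Lie subalgebra \<open>g\<close> of \<open>End(V)\<close>, the notions with an
  argument \<open>g\<close> refer to the restriction of the module to \<open>g\<close>; \<open>g = UNIV\<close> is \<open>End(V)\<close> itself.
\<close>

definition lie_rep :: "('v::complex_vector endo \<Rightarrow> 'm::complex_vector endo) \<Rightarrow> bool" where
  "lie_rep \<rho> \<longleftrightarrow> clinear \<rho> \<and> (\<forall>a b. \<rho> (commutator a b) = commutator (\<rho> a) (\<rho> b))"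

definition submodule ::
    "'v::complex_vector endo set \<Rightarrow> ('v endo \<Rightarrow> 'm::complex_vector endo) \<Rightarrow> 'm set \<Rightarrow> bool" where
  "submodule g \<rho> N \<longleftrightarrow> cvs.subspace N \<and> (\<forall>a\<in>g. \<forall>x\<in>N. endo_apply (\<rho> a) x \<in> N)"

text \<open>
  Existence of a composition series: by the correspondence theorem, the last condition says that
  the quotient of \<open>N (Suc i)\<close> by \<open>N i\<close> is simple.
\<close>

definition finite_length ::
    "'v::complex_vector endo set \<Rightarrow> ('v endo \<Rightarrow> 'm::complex_vector endo) \<Rightarrow> bool" where
  "finite_length g \<rho> \<longleftrightarrow>
     (\<exists>(n::nat) N. N 0 = {0} \<and> N n = UNIV \<and> (\<forall>i\<le>n. submodule g \<rho> (N i)) \<and>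
       (\<forall>i<n. N i \<subset> N (Suc i) \<and>
         \<not> (\<exists>L. submodule g \<rho> L \<and> N i \<subset> L \<and> L \<subset> N (Suc i))))"

text \<open>
  The quotient of \<open>W\<close> by \<open>U\<close> is the set of cosets \<open>w +o U\<close> for \<open>w\<close> in \<open>W\<close>, with operations and
  action induced by those on representatives; \<open>\<phi>\<close> is an isomorphism from this quotient onto the
  module \<open>\<sigma>\<close>.
\<close>

definition iso_to_quotient ::
    "('v::complex_vector endo \<Rightarrow> 'm::complex_vector endo) \<Rightarrow>
     ('v endo \<Rightarrow> 'n::complex_vector endo) \<Rightarrow> 'n set \<Rightarrow> 'n set \<Rightarrow> bool" where
  "iso_to_quotient \<sigma> \<rho> W U \<longleftrightarrow>
     (\<exists>\<phi>. bij_betw \<phi> ((\<lambda>w. w +o U) ` W) UNIV \<and>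
       (\<forall>x\<in>W. \<forall>y\<in>W. \<phi> ((x + y) +o U) = \<phi> (x +o U) + \<phi> (y +o U)) \<and>
       (\<forall>c. \<forall>x\<in>W. \<phi> ((c *\<^sub>C x) +o U) = c *\<^sub>C \<phi> (x +o U)) \<and>
       (\<forall>a. \<forall>x\<in>W. \<phi> (endo_apply (\<rho> a) x +o U) = endo_apply (\<sigma> a) (\<phi> (x +o U))))"


section \<open>The tensor algebra\<close>

text \<open>
  The tensor algebra of \<open>X\<close> as the free vector space on words in \<open>X\<close> modulo multilinearity in each
  letter; the class of the word \<open>[x\<^sub>1, \<dots>, x\<^sub>k]\<close> is the pure tensor of \<open>x\<^sub>1, \<dots>, x\<^sub>k\<close>, and the empty
  word is the unit. Only the module structure is needed, so the product (concatenation of words)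
  is not introduced.
\<close>

abbreviation word :: "'x list \<Rightarrow> ('x list \<Rightarrow>\<^sub>0 complex)" where
  "word w \<equiv> Poly_Mapping.single w 1"

definition tensor_relations :: "('x::complex_vector list \<Rightarrow>\<^sub>0 complex) set" where
  "tensor_relations = cvs.span
     ({word (us @ [x + y] @ vs) - word (us @ [x] @ vs) - word (us @ [y] @ vs) | us vs x y. True} \<union>
      {word (us @ [c *\<^sub>C x] @ vs) - c *\<^sub>C word (us @ [x] @ vs) | us vs c x. True})"

lemma subspace_tensor_relations: "cvs.subspace tensor_relations"
  by (simp add: tensor_relations_def)

definition tensor_equiv ::
    "('x::complex_vector list \<Rightarrow>\<^sub>0 complex) \<Rightarrow> ('x list \<Rightarrow>\<^sub>0 complex) \<Rightarrow> bool" where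
  "tensor_equiv p q \<longleftrightarrow> p - q \<in> tensor_relations"

quotient_type (overloaded) 'x tensor_algebra =
  "'x::complex_vector list \<Rightarrow>\<^sub>0 complex" / tensor_equiv
proof (rule equivpI)
  note sub = subspace_tensor_relations
  show "reflp tensor_equiv"
    by (auto simp: reflp_def tensor_equiv_def cvs.subspace_0[OF sub])
  show "symp tensor_equiv"
    unfolding symp_def tensor_equiv_def
    using cvs.subspace_neg[OF sub] by (metis minus_diff_eq)
  show "transp tensor_equiv"
  proof (rule transpI)
    show "tensor_equiv p r" if "tensor_equiv p q" "tensor_equiv q r" for p q r
      using that cvs.subspace_add[OF sub, of "p - q" "q - r"] by (simp add: tensor_equiv_def)
  qed
qed

instantiation tensor_algebra :: (complex_vector) complex_vector
begin
lift_definition zero_tensor_algebra :: "'a tensor_algebra" is 0 .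
lift_definition plus_tensor_algebra ::
    "'a tensor_algebra \<Rightarrow> 'a tensor_algebra \<Rightarrow> 'a tensor_algebra" is "(+)"
  unfolding tensor_equiv_def add_diff_add
  by (rule cvs.subspace_add[OF subspace_tensor_relations])
lift_definition uminus_tensor_algebra :: "'a tensor_algebra \<Rightarrow> 'a tensor_algebra" is uminus
  unfolding tensor_equiv_def minus_diff_minus
  by (rule cvs.subspace_neg[OF subspace_tensor_relations])
lift_definition minus_tensor_algebra ::
    "'a tensor_algebra \<Rightarrow> 'a tensor_algebra \<Rightarrow> 'a tensor_algebra" is "(-)"
proof -
  fix p p' q q' :: "'a list \<Rightarrow>\<^sub>0 complex"
  assume "tensor_equiv p p'" "tensor_equiv q q'"
  moreover have "(p - q) - (p' - q') = (p - p') - (q - q')"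
    by simp
  ultimately show "tensor_equiv (p - q) (p' - q')"
    unfolding tensor_equiv_def by (metis cvs.subspace_diff[OF subspace_tensor_relations])
qed
lift_definition scaleC_tensor_algebra ::
    "complex \<Rightarrow> 'a tensor_algebra \<Rightarrow> 'a tensor_algebra" is "scaleC"
  unfolding tensor_equiv_def cvs.scale_right_diff_distrib[symmetric]
  by (rule cvs.subspace_scale[OF subspace_tensor_relations])
instance
proof
  fix a b c :: "'a tensor_algebra" and r s :: complex
  note refl = equivp_reflp[OF tensor_algebra_equivp]
  show "a + b + c = a + (b + c)" by transfer (simp add: refl add.assoc)
  show "a + b = b + a" by transfer (simp add: refl add.commute)
  show "0 + a = a" by transfer (simp add: refl)
  show "- a + a = 0" by transfer (simp add: refl)
  show "a - b = a + - b" by transfer (simp add: refl)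
  show "r *\<^sub>C (a + b) = r *\<^sub>C a + r *\<^sub>C b"
    by transfer (simp add: refl cvs.scale_right_distrib)
  show "(r + s) *\<^sub>C a = r *\<^sub>C a + s *\<^sub>C a"
    by transfer (simp add: refl cvs.scale_left_distrib)
  show "r *\<^sub>C s *\<^sub>C a = (r * s) *\<^sub>C a" by transfer (simp add: refl)
  show "1 *\<^sub>C a = a" by transfer (simp add: refl)
qed
end

text \<open>
  An endomorphism \<open>D\<close> of \<open>X\<close> acts on the tensor algebra as the derivation extending \<open>D\<close>, that is,
  by the sum over all letters of applying \<open>D\<close> to that letter.
\<close>

definition word_derivation :: "'x::complex_vector endo \<Rightarrow> 'x list \<Rightarrow> ('x list \<Rightarrow>\<^sub>0 complex)" where
  "word_derivation D w = (\<Sum>i<length w. word (w[i := endo_apply D (w ! i)]))"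

definition free_derivation ::
    "'x::complex_vector endo \<Rightarrow> ('x list \<Rightarrow>\<^sub>0 complex) \<Rightarrow> ('x list \<Rightarrow>\<^sub>0 complex)" where
  "free_derivation D p =
     (\<Sum>w\<in>Poly_Mapping.keys p. Poly_Mapping.lookup p w *\<^sub>C word_derivation D w)"

lemma free_derivation_superset:
  assumes "finite A" "Poly_Mapping.keys p \<subseteq> A"
  shows "free_derivation D p = (\<Sum>w\<in>A. Poly_Mapping.lookup p w *\<^sub>C word_derivation D w)"
  unfolding free_derivation_def using assms
  by (intro sum.mono_neutral_left) (auto simp: in_keys_iff)

lemma free_derivation_add:
  "free_derivation D (p + q) = free_derivation D p + free_derivation D q"
proof -
  let ?A = "Poly_Mapping.keys p \<union> Poly_Mapping.keys q"
  have "Poly_Mapping.keys (p + q) \<subseteq> ?A"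
    by (rule Poly_Mapping.keys_add)
  then show ?thesis
    by (simp add: free_derivation_superset[of ?A] lookup_add cvs.scale_left_distrib sum.distrib)
qed

lemma free_derivation_scaleC: "free_derivation D (c *\<^sub>C p) = c *\<^sub>C free_derivation D p"
proof -
  have "Poly_Mapping.keys (c *\<^sub>C p) \<subseteq> Poly_Mapping.keys p"
    by (auto simp: in_keys_iff)
  then show ?thesis
    by (simp add: free_derivation_superset[of "Poly_Mapping.keys p"] cvs.scale_sum_right
        scaleC_complex_def)
qed

lemma clinear_free_derivation: "clinear (free_derivation D)"
  by (simp add: clinear_iff free_derivation_add free_derivation_scaleC)

lemma free_derivation_diff:
  "free_derivation D (p - q) = free_derivation D p - free_derivation D q"
  using free_derivation_add[of D "p - q" q] by simp

lemma free_derivation_word: "free_derivation D (word w) = word_derivation D w"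
  by (simp add: free_derivation_def)

lemma sum_lessThan_add:
  "sum f {..<m + n} = sum f {..<m} + (\<Sum>i<n. f (m + i))" for f :: "nat \<Rightarrow> 'a::comm_monoid_add"
  by (induction n) (simp_all add: add.assoc)

lemma word_derivation_split:
  "word_derivation D (us @ [x] @ vs) =
     (\<Sum>i<length us. word (us[i := endo_apply D (us ! i)] @ [x] @ vs)) +
     word (us @ [endo_apply D x] @ vs) +
     (\<Sum>i<length vs. word (us @ [x] @ vs[i := endo_apply D (vs ! i)]))"
proof -
  let ?m = "length us" and ?n = "length vs"
  let ?f = "\<lambda>i. word ((us @ [x] @ vs)[i := endo_apply D ((us @ [x] @ vs) ! i)])"
  have "word_derivation D (us @ [x] @ vs) = sum ?f {..<?m + Suc ?n}"
    by (simp add: word_derivation_def)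
  also have "\<dots> = sum ?f {..<?m} + (\<Sum>i<Suc ?n. ?f (?m + i))"
    by (rule sum_lessThan_add)
  also have "(\<Sum>i<Suc ?n. ?f (?m + i)) = ?f ?m + (\<Sum>i<?n. ?f (?m + Suc i))"
    by (subst sum.lessThan_Suc_shift) simp
  finally show ?thesis
    by (simp add: nth_append list_update_append add.assoc)
qed

lemma free_derivation_tensor_relations:
  fixes D :: "'x::complex_vector endo"
  assumes "p \<in> tensor_relations"
  shows "free_derivation D p \<in> tensor_relations"
proof -
  note sub = subspace_tensor_relations
  let ?add = "\<lambda>us vs (x::'x) y. word (us @ [x + y] @ vs) - word (us @ [x] @ vs) - word (us @ [y] @ vs)"
  let ?scale = "\<lambda>us vs c (x::'x). word (us @ [c *\<^sub>C x] @ vs) - c *\<^sub>C word (us @ [x] @ vs)"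
  have add: "?add us vs x y \<in> tensor_relations" for us vs and x y :: 'x
    unfolding tensor_relations_def by (rule cvs.span_base) blast
  have scale: "?scale us vs c x \<in> tensor_relations" for us vs c and x :: 'x
    unfolding tensor_relations_def by (rule cvs.span_base) blast
  let ?D = "endo_apply D"
  have "free_derivation D (?add us vs x y) =
      (\<Sum>i<length us. ?add (us[i := ?D (us ! i)]) vs x y) + ?add us vs (?D x) (?D y) +
      (\<Sum>i<length vs. ?add us (vs[i := ?D (vs ! i)]) x y)" for us vs x y
    unfolding free_derivation_diff free_derivation_word word_derivation_split endo_add
      sum_subtractf by (simp add: algebra_simps)
  then have D_add: "free_derivation D (?add us vs x y) \<in> tensor_relations" for us vs x y
    by (simp only:) (intro cvs.subspace_add[OF sub] cvs.subspace_sum[OF sub] add)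
  have "free_derivation D (?scale us vs c x) =
      (\<Sum>i<length us. ?scale (us[i := ?D (us ! i)]) vs c x) + ?scale us vs c (?D x) +
      (\<Sum>i<length vs. ?scale us (vs[i := ?D (vs ! i)]) c x)" for us vs c x
    unfolding free_derivation_diff free_derivation_scaleC free_derivation_word
      word_derivation_split endo_scaleC sum_subtractf cvs.scale_sum_right cvs.scale_right_distrib
    by (simp add: algebra_simps)
  then have D_scale: "free_derivation D (?scale us vs c x) \<in> tensor_relations" for us vs c x
    by (simp only:) (intro cvs.subspace_add[OF sub] cvs.subspace_sum[OF sub] scale)
  let ?S = "{p. free_derivation D p \<in> tensor_relations}"
  have zero: "free_derivation D 0 = 0"
    by (simp add: free_derivation_def)
  have "cvs.subspace ?S"
    unfolding cvs.subspace_def mem_Collect_eq zero free_derivation_add free_derivation_scaleC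
    using cvs.subspace_0[OF sub] cvs.subspace_add[OF sub] cvs.subspace_scale[OF sub] by blast
  moreover have "{?add us vs x y | us vs x y. True} \<union> {?scale us vs c x | us vs c x. True} \<subseteq> ?S"
    using D_add D_scale by blast
  ultimately have "tensor_relations \<subseteq> ?S"
    unfolding tensor_relations_def by (metis (no_types, lifting) cvs.span_minimal)
  then show ?thesis
    using assms by blast
qed

lift_definition tensor_derivation_fun ::
    "'x::complex_vector endo \<Rightarrow> 'x tensor_algebra \<Rightarrow> 'x tensor_algebra" is free_derivation
  unfolding tensor_equiv_def free_derivation_diff[symmetric]
  by (rule free_derivation_tensor_relations)

lift_definition tensor_derivation :: "'x::complex_vector endo \<Rightarrow> 'x tensor_algebra endo"
  is tensor_derivation_fun
proof -
  fix D :: "'x endo"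
  note refl = equivp_reflp[OF tensor_algebra_equivp]
  have "tensor_derivation_fun D (s + t) = tensor_derivation_fun D s + tensor_derivation_fun D t"
    for s t by transfer (simp add: refl free_derivation_add)
  moreover have "tensor_derivation_fun D (c *\<^sub>C t) = c *\<^sub>C tensor_derivation_fun D t"
    for c t by transfer (simp add: refl free_derivation_scaleC)
  ultimately show "clinear (tensor_derivation_fun D)"
    by (simp add: clinear_iff)
qed


section \<open>Tensor modules\<close>

lift_definition coadjoint :: "'v::complex_vector endo \<Rightarrow> 'v dual endo"
  is "\<lambda>a f. - dual_endo a f"
  unfolding clinear_iff
  by (auto simp: dual_endo.rep_eq plus_dual.rep_eq scaleC_dual.rep_eq minus_dual.rep_eq
      uminus_dual.rep_eq dual_apply_inject[symmetric] fun_eq_iff)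

lift_definition prod_endo ::
    "'a::complex_vector endo \<Rightarrow> 'b::complex_vector endo \<Rightarrow> ('a \<times> 'b) endo" is map_prod
  by (auto simp: clinear_iff scaleC_prod_def)

definition tensor_rep ::
    "'v::complex_vector endo \<Rightarrow> ('v dual \<times> 'v) tensor_algebra endo" where
  "tensor_rep a = tensor_derivation (prod_endo (coadjoint a) a)"

lift_definition seq_endo :: "'a::complex_vector endo \<Rightarrow> (nat \<Rightarrow> 'a) endo" is "\<lambda>f s i. f (s i)"
  by (auto simp: clinear_iff scaleC_fun_def fun_eq_iff)

text \<open>
  The direct sum of \<open>n\<close> copies of the tensor algebra consists of the sequences that vanish from
  index \<open>n\<close> on.
\<close>

definition tensor_module :: "('v::complex_vector endo \<Rightarrow> 'm::complex_vector endo) \<Rightarrow> bool" where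
  "tensor_module \<sigma> \<longleftrightarrow> lie_rep \<sigma> \<and> finite_length UNIV \<sigma> \<and>
     (\<exists>n W U. submodule UNIV (\<lambda>a. seq_endo (tensor_rep a)) W \<and>
        submodule UNIV (\<lambda>a. seq_endo (tensor_rep a)) U \<and>
        U \<subseteq> W \<and> W \<subseteq> {s. \<forall>i\<ge>n. s i = 0} \<and>
        iso_to_quotient \<sigma> (\<lambda>a. seq_endo (tensor_rep a)) W U)"

end

theory Submission
  imports
    Defs
    "HOL-Library.FuncSet"
    "HOL-Library.Multiset"
begin

text \<open>
  In dual bases of \<open>V\<close> and \<open>V\<^sub>*\<close>, the Mackey Lie algebra contains all operators whose matrices have finite
  rows and columns. Contractions reduce a mixed tensor power to its traceless part. There, operators
  that move one letter into an unused block of the basis and back act as a non-zero scalar (the cross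
  terms are contractions), so a submodule is determined by its elements whose letters lie in pairwise
  disjoint infinite blocks. On these the slots can be acted upon independently, and a density argument
  for \<open>V\<close>, \<open>V\<^sub>*\<close> and \<open>V\<^sup>*/V\<^sub>*\<close> bounds the length slot by slot. Finally, a module that has finite length
  over \<open>End(V)\<close> is finitely generated, hence a subquotient of tensors of bounded degree.
\<close>

section \<open>Families of subspaces of finite height\<close>

text \<open>Two features of functionals shape the proof. A functional may have infinite support in
  the basis, so a tensor with letters in the full dual is in general no finite combination of basis
  tensors; indices are therefore grouped into finitely many blocks, and block projections take the
  place of a Cartan subalgebra. Moreover \<open>V_*\<close> is invariant, so functionals can be
  moved independently only modulo \<open>V_*\<close>. A letter of \<open>V\<close>, in contrast, has
  finite support: for each tensor all such letters lie below one bound. This bound varies with the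
  tensor, hence a separate finite block, while the other labels come from residue classes fixed once
  and for all. Only finite rows have to be imposed on operators, since columns are finite because
  the basis spans \<open>V\<close>; and a larger Lie algebra has fewer submodules, so it suffices to
  treat the row-finite operators.\<close>

lemma clinear_addD: "clinear f \<Longrightarrow> f (x + y) = f x + f y"
  and clinear_scaleD: "clinear f \<Longrightarrow> f (c *\<^sub>C x) = c *\<^sub>C f x"
  by (simp_all add: clinear_iff)

lemma clinear_0D: "clinear f \<Longrightarrow> f 0 = 0"
  using clinear_scaleD[of f 0 0] by simp

lemma clinear_diffD: "clinear f \<Longrightarrow> f (x - y) = f x - f y"
  using clinear_addD[of f "x - y" y] by simp

lemma clinear_sumD: "clinear f \<Longrightarrow> f (sum g I) = (\<Sum>i\<in>I. f (g i))"
  by (induction I rule: infinite_finite_induct) (simp_all add: clinear_0D clinear_addD)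

lemma clinear_compose: "clinear f \<Longrightarrow> clinear g \<Longrightarrow> clinear (\<lambda>x. f (g x))"
  by (simp add: clinear_iff)

lemma clinear_sum: "(\<And>i. i \<in> I \<Longrightarrow> clinear (f i)) \<Longrightarrow> clinear (\<lambda>x. \<Sum>i\<in>I. f i x)"
  by (simp add: clinear_iff sum.distrib cvs.scale_sum_right)

lemma clinear_diff: "clinear f \<Longrightarrow> clinear g \<Longrightarrow> clinear (\<lambda>x. f x - g x)"
  by (simp add: clinear_iff cvs.scale_right_diff_distrib)

lemma clinear_scale: "clinear f \<Longrightarrow> clinear (\<lambda>x. c *\<^sub>C f x)"
  by (simp add: clinear_iff cvs.scale_right_distrib cvs.scale_left_commute)

lemma clinear_endo_apply: "clinear (endo_apply a)"
  by (simp add: clinear_iff endo_add endo_scaleC)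

lemma subspace_vimage: "clinear f \<Longrightarrow> cvs.subspace N \<Longrightarrow> cvs.subspace {x. f x \<in> N}"
  by (auto simp: cvs.subspace_def clinear_iff clinear_0D)

lemma subspace_image:
  assumes "clinear f" "cvs.subspace N"
  shows "cvs.subspace (f ` N)"
proof (rule cvs.subspaceI)
  show "0 \<in> f ` N" using clinear_0D[OF assms(1)] cvs.subspace_0[OF assms(2)] by (metis image_eqI)
  show "x + y \<in> f ` N" if "x \<in> f ` N" "y \<in> f ` N" for x y
    using that cvs.subspace_add[OF assms(2)] clinear_addD[OF assms(1), symmetric] by auto
  show "c *\<^sub>C x \<in> f ` N" if "x \<in> f ` N" for c x
    using that cvs.subspace_scale[OF assms(2)] clinear_scaleD[OF assms(1), symmetric] by auto
qed

lemma subspace_eq: "clinear f \<Longrightarrow> clinear g \<Longrightarrow> cvs.subspace {x. f x = g x}"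
  by (auto simp: cvs.subspace_def clinear_iff clinear_0D)

lemma subspace_collect_conj:
  "cvs.subspace {x. p x} \<Longrightarrow> cvs.subspace {x. q x} \<Longrightarrow> cvs.subspace {x. p x \<and> q x}"
  by (auto simp: cvs.subspace_def)

lemma span_map:
  assumes "clinear f" "x \<in> cvs.span S" "\<And>y. y \<in> S \<Longrightarrow> f y \<in> cvs.span R"
  shows "f x \<in> cvs.span R"
proof -
  have "cvs.span S \<subseteq> {x. f x \<in> cvs.span R}"
    using assms(3) by (intro cvs.span_minimal subspace_vimage assms(1)) auto
  then show ?thesis using assms(2) by blast
qed

lemma span_eq_on:
  assumes "clinear f" "clinear g" "x \<in> cvs.span S" "\<And>y. y \<in> S \<Longrightarrow> f y = g y"
  shows "f x = g x"
proof -
  have "cvs.span S \<subseteq> {x. f x = g x}"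
    using assms(4) by (intro cvs.span_minimal subspace_eq assms(1,2)) auto
  then show ?thesis using assms(3) by blast
qed

lemma span_id: "cvs.subspace S \<Longrightarrow> cvs.span S = S"
  by (simp only: cvs.span_eq_iff)

lemma span_Union_sum:
  assumes "finite I" "t \<in> cvs.span (\<Union>i\<in>I. S i)" "\<And>i. i \<in> I \<Longrightarrow> cvs.subspace (S i)"
  shows "\<exists>x. (\<forall>i\<in>I. x i \<in> S i) \<and> t = (\<Sum>i\<in>I. x i)"
  using assms
proof (induction I arbitrary: t)
  case (insert j I)
  have "t \<in> cvs.span (S j \<union> (\<Union>i\<in>I. S i))" using insert.prems(1) by simp
  then obtain a b where ab: "t = a + b" "a \<in> cvs.span (S j)" "b \<in> cvs.span (\<Union>i\<in>I. S i)"
    unfolding cvs.span_Un by blast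
  have a: "a \<in> S j" using ab(2) span_id[OF insert.prems(2)[of j]] by simp
  obtain x where x: "\<forall>i\<in>I. x i \<in> S i" "b = (\<Sum>i\<in>I. x i)"
    using insert.IH[OF ab(3)] insert.prems(2) by auto
  have "(\<Sum>i\<in>insert j I. (x(j := a)) i) = a + (\<Sum>i\<in>I. (x(j := a)) i)"
    using insert.hyps by simp
  also have "(\<Sum>i\<in>I. (x(j := a)) i) = b"
    unfolding x(2) using insert.hyps by (intro sum.cong) auto
  finally show ?case using ab(1) x(1) a insert.hyps
    by (intro exI[of _ "x(j := a)"]) auto
qed simp

text \<open>
  Finite height is expressed by a bounded rank function, because rank functions can be pulled back
  along jointly injective monotone maps and added.
\<close>

definition finite_height :: "'a set set \<Rightarrow> bool" where
  "finite_height L \<longleftrightarrow> (\<exists>(r::'a set \<Rightarrow> nat) k. (\<forall>N\<in>L. r N \<le> k) \<and>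
     (\<forall>N\<in>L. \<forall>N'\<in>L. N \<subset> N' \<longrightarrow> r N < r N'))"

text \<open>Add the two pulled back ranks: along a proper inclusion neither decreases, and
  \<open>det\<close> makes at least one of them grow. Detection is asked for comparable pairs only,
  which is what modular-law arguments provide.\<close>

lemma finite_height_detect:
  assumes "finite_height L1" "finite_height L2"
    and \<phi>: "\<And>N. N \<in> L \<Longrightarrow> \<phi> N \<in> L1" "\<And>N. N \<in> L \<Longrightarrow> \<psi> N \<in> L2"
    and mono: "\<And>N N'. N \<in> L \<Longrightarrow> N' \<in> L \<Longrightarrow> N \<subseteq> N' \<Longrightarrow> \<phi> N \<subseteq> \<phi> N'"
      "\<And>N N'. N \<in> L \<Longrightarrow> N' \<in> L \<Longrightarrow> N \<subseteq> N' \<Longrightarrow> \<psi> N \<subseteq> \<psi> N'"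
    and det: "\<And>N N'. N \<in> L \<Longrightarrow> N' \<in> L \<Longrightarrow> N \<subseteq> N' \<Longrightarrow> \<phi> N = \<phi> N' \<Longrightarrow> \<psi> N = \<psi> N' \<Longrightarrow> N' \<subseteq> N"
  shows "finite_height L"
proof -
  obtain r1 k1 where r1: "\<And>N. N \<in> L1 \<Longrightarrow> r1 N \<le> (k1::nat)"
    "\<And>N N'. N \<in> L1 \<Longrightarrow> N' \<in> L1 \<Longrightarrow> N \<subset> N' \<Longrightarrow> r1 N < r1 N'"
    using assms(1) unfolding finite_height_def Ball_def by metis
  obtain r2 k2 where r2: "\<And>N. N \<in> L2 \<Longrightarrow> r2 N \<le> (k2::nat)"
    "\<And>N N'. N \<in> L2 \<Longrightarrow> N' \<in> L2 \<Longrightarrow> N \<subset> N' \<Longrightarrow> r2 N < r2 N'"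
    using assms(2) unfolding finite_height_def Ball_def by metis
  let ?r = "\<lambda>N. r1 (\<phi> N) + r2 (\<psi> N)"
  have "?r N \<le> k1 + k2" if "N \<in> L" for N
    using add_mono[OF r1(1)[OF \<phi>(1)[OF that]] r2(1)[OF \<phi>(2)[OF that]]] .
  moreover have "?r N < ?r N'" if N: "N \<in> L" "N' \<in> L" "N \<subset> N'" for N N'
  proof -
    have le1: "r1 (\<phi> N) < r1 (\<phi> N') \<or> \<phi> N = \<phi> N'"
      using mono(1)[OF N(1,2)] r1(2)[OF \<phi>(1)[OF N(1)] \<phi>(1)[OF N(2)]] N(3) by blast
    have le2: "r2 (\<psi> N) < r2 (\<psi> N') \<or> \<psi> N = \<psi> N'"
      using mono(2)[OF N(1,2)] r2(2)[OF \<phi>(2)[OF N(1)] \<phi>(2)[OF N(2)]] N(3) by blast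
    have "\<not> (\<phi> N = \<phi> N' \<and> \<psi> N = \<psi> N')"
      using det[OF N(1,2)] N(3) by blast
    then show ?thesis using le1 le2 add_less_mono[of "r1 (\<phi> N)" "r1 (\<phi> N')" "r2 (\<psi> N)" "r2 (\<psi> N')"]
      by (elim disjE) simp_all
  qed
  ultimately show ?thesis unfolding finite_height_def
    by (intro exI[of _ ?r] exI[of _ "k1 + k2"] conjI ballI impI)
qed

lemma finite_height_detect1:
  assumes "finite_height L1" "\<And>N. N \<in> L \<Longrightarrow> \<phi> N \<in> L1"
    "\<And>N N'. N \<in> L \<Longrightarrow> N' \<in> L \<Longrightarrow> N \<subseteq> N' \<Longrightarrow> \<phi> N \<subseteq> \<phi> N'"
    "\<And>N N'. N \<in> L \<Longrightarrow> N' \<in> L \<Longrightarrow> N \<subseteq> N' \<Longrightarrow> \<phi> N = \<phi> N' \<Longrightarrow> N' \<subseteq> N"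
  shows "finite_height L"
proof (rule finite_height_detect)
  show "finite_height L1" "finite_height L1" by (fact assms(1))+
  show "\<phi> N \<in> L1" "\<phi> N \<in> L1" if "N \<in> L" for N by (rule assms(2)[OF that])+
  show "\<phi> N \<subseteq> \<phi> N'" "\<phi> N \<subseteq> \<phi> N'" if "N \<in> L" "N' \<in> L" "N \<subseteq> N'" for N N'
    by (rule assms(3)[OF that])+
  show "N' \<subseteq> N" if "N \<in> L" "N' \<in> L" "N \<subseteq> N'" "\<phi> N = \<phi> N'" for N N'
    by (rule assms(4)[OF that])
qed

lemma finite_height_mono: "finite_height L \<Longrightarrow> L' \<subseteq> L \<Longrightarrow> finite_height L'"
  by (rule finite_height_detect1[where \<phi> = "\<lambda>N. N" and ?L1.0 = L]) auto

text \<open>The operators form an arbitrary indexed family instead of a Lie algebra action, because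
  the same lattice arguments are run for derivations, for independent actions on single slots and
  for families in which some operators are replaced by 0.\<close>

definition stable :: "'i set \<Rightarrow> ('i \<Rightarrow> 'a \<Rightarrow> 'a) \<Rightarrow> 'a::complex_vector set \<Rightarrow> bool" where
  "stable G A N \<longleftrightarrow> cvs.subspace N \<and> (\<forall>i\<in>G. \<forall>x\<in>N. A i x \<in> N)"

definition subs :: "'i set \<Rightarrow> ('i \<Rightarrow> 'a \<Rightarrow> 'a) \<Rightarrow> 'a::complex_vector set \<Rightarrow> 'a set set" where
  "subs G A S = {N. N \<subseteq> S \<and> stable G A N}"

lemma stable_subspace: "stable G A N \<Longrightarrow> cvs.subspace N"
  and stable_op: "stable G A N \<Longrightarrow> i \<in> G \<Longrightarrow> x \<in> N \<Longrightarrow> A i x \<in> N"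
  by (auto simp: stable_def)

lemma stable_Int: "stable G A S \<Longrightarrow> stable G A S' \<Longrightarrow> stable G A (S \<inter> S')"
  by (auto simp: stable_def cvs.subspace_inter)

lemma stable_mono: "stable G A S \<Longrightarrow> H \<subseteq> G \<Longrightarrow> stable H A S"
  by (auto simp: stable_def)

lemma stable_span:
  assumes "\<And>i. i \<in> G \<Longrightarrow> clinear (A i)" "\<And>j. j \<in> J \<Longrightarrow> stable G A (S j)"
  shows "stable G A (cvs.span (\<Union>j\<in>J. S j))"
  unfolding stable_def
proof (intro conjI ballI cvs.subspace_span)
  fix i x assume i: "i \<in> G" and x: "x \<in> cvs.span (\<Union>j\<in>J. S j)"
  show "A i x \<in> cvs.span (\<Union>j\<in>J. S j)"
    by (rule span_map[OF assms(1)[OF i] x])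
      (use assms(2) i in \<open>auto intro!: cvs.span_base simp: stable_def\<close>)
qed

lemma subs_mono: "S \<subseteq> S' \<Longrightarrow> subs G A S \<subseteq> subs G A S'"
  by (auto simp: subs_def)

text \<open>Additivity of length along the submodule \<open>R\<close> of the sum: a stable
  \<open>N\<close> is compared through its image modulo \<open>R\<close> and through
  \<open>N \<inter> R\<close>.\<close>

lemma finite_height_subs_Un:
  fixes S R :: "'a::complex_vector set"
  assumes lin: "\<And>i. i \<in> G \<Longrightarrow> clinear (A i)"
    and st: "stable G A S" "stable G A R"
    and fh: "finite_height (subs G A S)" "finite_height (subs G A R)"
  shows "finite_height (subs G A (cvs.span (S \<union> R)))"
proof -
  have eq: "cvs.span (S \<union> R) = {x + y | x y. x \<in> S \<and> y \<in> R}"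
    unfolding cvs.span_Un by (simp only: st[THEN stable_subspace, THEN span_id])
  \<comment> \<open>This is the intersection of \<open>S\<close> with \<open>N + R\<close>. It
    represents the image of \<open>N\<close> modulo \<open>R\<close> inside \<open>S\<close>, so
    that no quotient space has to be formed.\<close>
  let ?\<phi> = "\<lambda>N. {x \<in> S. \<exists>y\<in>R. x + y \<in> N}"
  show ?thesis
  proof (rule finite_height_detect[OF fh, where \<phi> = ?\<phi> and \<psi> = "\<lambda>N. N \<inter> R"])
    fix N assume "N \<in> subs G A (cvs.span (S \<union> R))"
    then have N: "stable G A N" by (simp add: subs_def)
    show "N \<inter> R \<in> subs G A R" using N st by (auto simp: subs_def stable_Int)
    have "stable G A (?\<phi> N)"
      unfolding stable_def
    proof (intro conjI ballI cvs.subspaceI)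
      show "0 \<in> ?\<phi> N"
        using cvs.subspace_0[OF stable_subspace[OF N]] cvs.subspace_0[OF stable_subspace[OF st(1)]]
          cvs.subspace_0[OF stable_subspace[OF st(2)]] by auto
    next
      fix x y assume "x \<in> ?\<phi> N" "y \<in> ?\<phi> N"
      then obtain x' y' where *: "x \<in> S" "y \<in> S" "x' \<in> R" "y' \<in> R" "x + x' \<in> N" "y + y' \<in> N"
        by blast
      have "x + y + (x' + y') \<in> N"
        using cvs.subspace_add[OF stable_subspace[OF N] *(5,6)] by (simp add: algebra_simps)
      then show "x + y \<in> ?\<phi> N"
        using cvs.subspace_add[OF stable_subspace[OF st(1)] *(1,2)]
          cvs.subspace_add[OF stable_subspace[OF st(2)] *(3,4)] by blast
    next
      fix c x assume "x \<in> ?\<phi> N"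
      then obtain x' where *: "x \<in> S" "x' \<in> R" "x + x' \<in> N" by blast
      have "c *\<^sub>C x + c *\<^sub>C x' \<in> N"
        using cvs.subspace_scale[OF stable_subspace[OF N] *(3), of c]
        by (simp add: cvs.scale_right_distrib)
      then show "c *\<^sub>C x \<in> ?\<phi> N"
        using cvs.subspace_scale[OF stable_subspace[OF st(1)] *(1), of c]
          cvs.subspace_scale[OF stable_subspace[OF st(2)] *(2), of c] by blast
    next
      fix i x assume i: "i \<in> G" and "x \<in> ?\<phi> N"
      then obtain x' where *: "x \<in> S" "x' \<in> R" "x + x' \<in> N" by blast
      have "A i x + A i x' \<in> N"
        using stable_op[OF N i *(3)] clinear_addD[OF lin[OF i]] by simp
      then show "A i x \<in> ?\<phi> N"
        using stable_op[OF st(1) i *(1)] stable_op[OF st(2) i *(2)] by blast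
    qed
    then show "?\<phi> N \<in> subs G A S" by (auto simp: subs_def)
  next
    fix N N' assume N: "N \<in> subs G A (cvs.span (S \<union> R))" "N' \<in> subs G A (cvs.span (S \<union> R))"
      and le: "N \<subseteq> N'" and 1: "?\<phi> N = ?\<phi> N'" and 2: "N \<inter> R = N' \<inter> R"
    have sub: "cvs.subspace N" "cvs.subspace N'" using N by (auto simp: subs_def stable_def)
    show "N' \<subseteq> N"
    proof
      fix t assume t: "t \<in> N'"
      then obtain x y where xy: "t = x + y" "x \<in> S" "y \<in> R"
        using N(2) unfolding eq subs_def by blast
      then have "x \<in> ?\<phi> N" using t 1 by blast
      then obtain y' where y': "y' \<in> R" "x + y' \<in> N" by blast
      have "t - (x + y') \<in> N'" using cvs.subspace_diff[OF sub(2) t] y'(2) le by blast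
      moreover have eq': "t - (x + y') = y - y'" using xy by simp
      moreover have "y - y' \<in> R"
        using cvs.subspace_diff[OF stable_subspace[OF st(2)] xy(3) y'(1)] .
      ultimately have "y - y' \<in> N \<inter> R" unfolding 2 by simp
      then have "t - (x + y') \<in> N" unfolding eq' by blast
      then have "t - (x + y') + (x + y') \<in> N" using cvs.subspace_add[OF sub(1)] y'(2) by blast
      then show "t \<in> N" by simp
    qed
  next
    fix N N' :: "'a set" assume "N \<subseteq> N'"
    then show "?\<phi> N \<subseteq> ?\<phi> N'" "N \<inter> R \<subseteq> N' \<inter> R" by blast+
  qed
qed

lemma finite_height_subs_0: "finite_height (subs G A {0})"
  unfolding finite_height_def subs_def stable_def
  by (intro exI[of _ "\<lambda>_. 0"] exI[of _ 0]) (auto dest: cvs.subspace_0)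

lemma finite_height_subs_Union:
  fixes S :: "'j \<Rightarrow> 'a::complex_vector set"
  assumes "finite J" and lin: "\<And>i. i \<in> G \<Longrightarrow> clinear (A i)"
    and "\<And>j. j \<in> J \<Longrightarrow> stable G A (S j)" "\<And>j. j \<in> J \<Longrightarrow> finite_height (subs G A (S j))"
  shows "finite_height (subs G A (cvs.span (\<Union>j\<in>J. S j)))"
  using assms(1,3,4)
proof (induction J)
  case (insert j J)
  have "cvs.span (\<Union>i\<in>insert j J. S i) = cvs.span (S j \<union> cvs.span (\<Union>i\<in>J. S i))"
    by (simp add: cvs.span_Un cvs.span_span)
  then show ?case
    using finite_height_subs_Un[where S = "S j" and R = "cvs.span (\<Union>i\<in>J. S i)" and G = G and A = A, OF lin]
      stable_span[where J = J and S = S and G = G and A = A, OF lin] insert by simp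
qed (simp add: finite_height_subs_0)

lemma stable_vimage:
  assumes "clinear \<phi>" "stable G A S" "stable G B N"
    and "\<And>i x. i \<in> G \<Longrightarrow> x \<in> S \<Longrightarrow> \<phi> (A i x) = B i (\<phi> x)"
  shows "stable G A {x \<in> S. \<phi> x \<in> N}"
  using assms subspace_vimage[OF assms(1), of N] unfolding stable_def
  by (auto intro!: subspace_collect_conj)

text \<open>Preimages in \<open>S\<close> separate the stable subspaces of \<open>R\<close>, because
  every element of \<open>R\<close> has a preimage in \<open>S\<close>. The intertwining relation is
  asked on \<open>S\<close> only, which is how it holds for tensors of a fixed degree.\<close>

lemma finite_height_subs_image:
  assumes fh: "finite_height (subs G A S)" and lin: "clinear \<phi>" and st: "stable G A S"
    and eq: "\<And>i x. i \<in> G \<Longrightarrow> x \<in> S \<Longrightarrow> \<phi> (A i x) = B i (\<phi> x)" and R: "R \<subseteq> \<phi> ` S"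
  shows "finite_height (subs G B R)"
proof (rule finite_height_detect1[OF fh, where \<phi> = "\<lambda>N. {x \<in> S. \<phi> x \<in> N}"])
  show "{x \<in> S. \<phi> x \<in> N} \<in> subs G A S" if "N \<in> subs G B R" for N
  proof -
    have "stable G B N" using that by (simp add: subs_def)
    then have "stable G A {x \<in> S. \<phi> x \<in> N}" by (rule stable_vimage[OF lin st]) (rule eq)
    then show ?thesis by (simp add: subs_def Collect_mono)
  qed
  show "{x \<in> S. \<phi> x \<in> N} \<subseteq> {x \<in> S. \<phi> x \<in> N'}" if "N \<subseteq> N'" for N N'
    using that by blast
  show "N' \<subseteq> N" if N: "N \<in> subs G B R" "N' \<in> subs G B R" "N \<subseteq> N'"
    "{x \<in> S. \<phi> x \<in> N} = {x \<in> S. \<phi> x \<in> N'}" for N N'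
  proof
    fix y assume y: "y \<in> N'"
    then obtain x where "x \<in> S" "y = \<phi> x" using N(2) R by (auto simp: subs_def)
    then show "y \<in> N" using N(4) y by blast
  qed
qed

text \<open>Two elements with equal image differ by an element of the kernel. Hence comparable
  stable subspaces coincide as soon as their images and their intersections with the kernel
  do.\<close>

lemma finite_height_subs_kernel:
  fixes S :: "'a::complex_vector set"
  assumes lin: "clinear \<phi>" and fh1: "finite_height (subs G A {x \<in> S. \<phi> x = 0})"
    and fh2: "finite_height (subs G B R)" and R: "\<phi> ` S \<subseteq> R"
    and eq: "\<And>i x. i \<in> G \<Longrightarrow> x \<in> S \<Longrightarrow> \<phi> (A i x) = B i (\<phi> x)" and linB: "\<And>i. i \<in> G \<Longrightarrow> B i 0 = 0"
  shows "finite_height (subs G A S)"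
proof (rule finite_height_detect[OF fh1 fh2, where \<phi> = "\<lambda>N. {x \<in> N. \<phi> x = 0}" and \<psi> = "\<lambda>N. \<phi> ` N"])
  fix N assume N: "N \<in> subs G A S"
  then have st: "stable G A N" "N \<subseteq> S" by (auto simp: subs_def)
  have "stable G B {0}" using linB by (simp add: stable_def cvs.subspace_single_0)
  then have "stable G A {x \<in> N. \<phi> x = 0}"
    using stable_vimage[OF lin st(1), of B "{0}"] eq st(2) by auto
  then show "{x \<in> N. \<phi> x = 0} \<in> subs G A {x \<in> S. \<phi> x = 0}" using st by (auto simp: subs_def)
  have "B i (\<phi> x) \<in> \<phi> ` N" if "i \<in> G" "x \<in> N" for i x
    using eq[of i x] that st stable_op[OF st(1)] by (metis image_eqI subsetD)
  then have "stable G B (\<phi> ` N)"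
    unfolding stable_def using subspace_image[OF lin stable_subspace[OF st(1)]] by auto
  then show "\<phi> ` N \<in> subs G B R" using st R by (auto simp: subs_def)
next
  fix N N' :: "'a set" assume "N \<subseteq> N'"
  then show "{x \<in> N. \<phi> x = 0} \<subseteq> {x \<in> N'. \<phi> x = 0}" "\<phi> ` N \<subseteq> \<phi> ` N'" by blast+
next
  fix N N' assume N: "N \<in> subs G A S" "N' \<in> subs G A S" "N \<subseteq> N'"
    and 1: "{x \<in> N. \<phi> x = 0} = {x \<in> N'. \<phi> x = 0}" and 2: "\<phi> ` N = \<phi> ` N'"
  have sub: "cvs.subspace N" "cvs.subspace N'" using N by (auto simp: subs_def stable_def)
  show "N' \<subseteq> N"
  proof
    fix t assume t: "t \<in> N'"
    then obtain y where y: "y \<in> N" "\<phi> t = \<phi> y" using 2 by blast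
    have "t - y \<in> N'" using cvs.subspace_diff[OF sub(2) t] y N(3) by blast
    then have "t - y \<in> N" using 1 y clinear_diffD[OF lin, of t y] by auto
    then show "t \<in> N" using cvs.subspace_add[OF sub(1), of "t - y" y] y by simp
  qed
qed

text \<open>The kernels are cut out one after the other; each step stays inside \<open>S\<close>, so
  the remaining maps keep their targets \<open>R j\<close>.\<close>

lemma finite_height_subs_kernels:
  assumes "finite I" and lin: "\<And>j. j \<in> I \<Longrightarrow> clinear (\<phi> j)"
    and "finite_height (subs G A {x \<in> S. \<forall>j\<in>I. \<phi> j x = 0})"
    and "\<And>j. j \<in> I \<Longrightarrow> finite_height (subs G B (R j))" "\<And>j. j \<in> I \<Longrightarrow> \<phi> j ` S \<subseteq> R j"
    and "\<And>j i x. j \<in> I \<Longrightarrow> i \<in> G \<Longrightarrow> x \<in> S \<Longrightarrow> \<phi> j (A i x) = B i (\<phi> j x)"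
    and linB: "\<And>i. i \<in> G \<Longrightarrow> B i 0 = 0"
  shows "finite_height (subs G A S)"
  using assms
proof (induction I arbitrary: S)
  case (insert j I)
  let ?S = "{x \<in> S. \<phi> j x = 0}"
  have eq: "{x \<in> ?S. \<forall>i\<in>I. \<phi> i x = 0} = {x \<in> S. \<forall>i\<in>insert j I. \<phi> i x = 0}" by auto
  have sub: "\<phi> i ` ?S \<subseteq> R i" if "i \<in> I" for i
    using insert.prems(4)[of i] that by auto
  have fh: "finite_height (subs G A ?S)"
  proof (rule insert.IH)
    show "finite_height (subs G A {x \<in> ?S. \<forall>i\<in>I. \<phi> i x = 0})"
      unfolding eq by (rule insert.prems(2))
    show "\<phi> i ` ?S \<subseteq> R i" if "i \<in> I" for i by (rule sub[OF that])
    show "clinear (\<phi> i)" "finite_height (subs G B (R i))" if "i \<in> I" for i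
      using that by (auto intro: insert.prems(1,3))
    show "\<phi> i (A k x) = B k (\<phi> i x)" if "i \<in> I" "k \<in> G" "x \<in> ?S" for i k x
      using that by (intro insert.prems(5)) auto
    show "B k 0 = 0" if "k \<in> G" for k by (rule insert.prems(6)[OF that])
  qed
  have j: "j \<in> insert j I" by simp
  show ?case
  proof (rule finite_height_subs_kernel)
    show "clinear (\<phi> j)" by (rule insert.prems(1)[OF j])
    show "finite_height (subs G A ?S)" by (rule fh)
    show "finite_height (subs G B (R j))" by (rule insert.prems(3)[OF j])
    show "\<phi> j ` S \<subseteq> R j" by (rule insert.prems(4)[OF j])
    show "\<phi> j (A i x) = B i (\<phi> j x)" if "i \<in> G" "x \<in> S" for i x
      by (rule insert.prems(5)[OF j that])
    show "B i 0 = 0" if "i \<in> G" for i by (rule insert.prems(6)[OF that])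
  qed
qed simp

text \<open>A proper submodule of greatest rank is maximal, since anything strictly between would
  have larger rank. Recursing into it builds a composition series from the top, and the recursion
  ends because the rank drops.\<close>

lemma finite_height_imp_finite_length:
  assumes "finite_height (subs g (\<lambda>a. endo_apply (\<sigma> a)) UNIV)"
  shows "finite_length g \<sigma>"
proof -
  have subs_iff: "N \<in> subs g (\<lambda>a. endo_apply (\<sigma> a)) UNIV \<longleftrightarrow> submodule g \<sigma> N" for N
    by (auto simp: subs_def stable_def submodule_def)
  obtain r k where r: "\<And>N. submodule g \<sigma> N \<Longrightarrow> r N \<le> (k::nat)"
    "\<And>N N'. submodule g \<sigma> N \<Longrightarrow> submodule g \<sigma> N' \<Longrightarrow> N \<subset> N' \<Longrightarrow> r N < r N'"
    using assms unfolding finite_height_def subs_iff Ball_def by metis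
  have zero: "submodule g \<sigma> {0}"
    by (simp add: submodule_def cvs.subspace_single_0 clinear_0D[OF clinear_endo_apply])
  have series: "\<exists>(n::nat) F. F 0 = {0} \<and> F n = M \<and> (\<forall>i\<le>n. submodule g \<sigma> (F i)) \<and>
      (\<forall>i<n. F i \<subset> F (Suc i) \<and> \<not> (\<exists>L. submodule g \<sigma> L \<and> F i \<subset> L \<and> L \<subset> F (Suc i)))"
    if "submodule g \<sigma> M" for M
    using that
  proof (induction "r M" arbitrary: M rule: less_induct)
    case less
    show ?case
    proof (cases "M = {0}")
      case True
      then show ?thesis using zero by (intro exI[of _ 0] exI[of _ "\<lambda>_. {0}"]) auto
    next
      case False
      let ?P = "\<lambda>L. submodule g \<sigma> L \<and> L \<subset> M"
      have "{0} \<subset> M" using False less.prems cvs.subspace_0 unfolding submodule_def by blast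
      then have "\<exists>L. ?P L \<and> (\<forall>L'. ?P L' \<longrightarrow> r L' \<le> r L)"
        using zero r(1) by (intro ex_has_greatest_nat[of _ "{0}" _ "Suc k"]) (auto simp: less_Suc_eq_le)
      then obtain L where L: "submodule g \<sigma> L" "L \<subset> M" "\<And>L'. ?P L' \<Longrightarrow> r L' \<le> r L" by blast
      obtain n F where F: "F 0 = {0}" "F n = L" "\<forall>i\<le>n. submodule g \<sigma> (F i)"
        "\<forall>i<n. F i \<subset> F (Suc i) \<and> \<not> (\<exists>L. submodule g \<sigma> L \<and> F i \<subset> L \<and> L \<subset> F (Suc i))"
        using less.hyps[OF r(2)[OF L(1) less.prems L(2)] L(1)] by (elim exE conjE)
      have "\<not> (\<exists>L'. submodule g \<sigma> L' \<and> L \<subset> L' \<and> L' \<subset> M)"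
        using r(2)[OF L(1)] L(3) by (meson leD)
      then show ?thesis
        using F L less.prems
        by (intro exI[of _ "Suc n"] exI[of _ "F(Suc n := M)"]) (auto simp: less_Suc_eq le_Suc_eq)
    qed
  qed
  have "submodule g \<sigma> UNIV" by (simp add: submodule_def)
  from series[OF this] show ?thesis unfolding finite_length_def .
qed

text \<open>Applying \<open>A l - v l j\<close> kills \<open>y j\<close> while multiplying
  \<open>x\<close> by the non-zero number \<open>w l - v l j\<close>. The remaining summands stay
  joint eigenvectors, so they can be removed one by one; two different \<open>y j\<close> may share
  their eigenvalues.\<close>

lemma eigenvector_component_mem:
  assumes N: "cvs.subspace N" and lin: "\<And>l. clinear (A l)" and st: "\<And>l x. l \<in> K \<Longrightarrow> x \<in> N \<Longrightarrow> A l x \<in> N"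
    and "finite J" and x: "\<And>l. l \<in> K \<Longrightarrow> A l x = w l *\<^sub>C x"
    and "\<And>l j. l \<in> K \<Longrightarrow> j \<in> J \<Longrightarrow> A l (y j) = v l j *\<^sub>C y j"
    and "\<And>j. j \<in> J \<Longrightarrow> \<exists>l\<in>K. v l j \<noteq> w l"
    and "x + (\<Sum>j\<in>J. y j) \<in> N"
  shows "x \<in> N"
  using assms(4,6-)
proof (induction J arbitrary: y)
  case (insert j J)
  obtain l where l: "l \<in> K" "v l j \<noteq> w l" using insert.prems(2) by blast
  let ?B = "\<lambda>z. A l z - v l j *\<^sub>C z"
  have linB: "clinear ?B"
    using lin[of l] by (simp add: clinear_iff cvs.scale_right_distrib cvs.scale_right_diff_distrib
        cvs.scale_left_commute)
  \<comment> \<open>Normalises the coefficient of \<open>x\<close> to 1, the form that the induction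
    hypothesis expects.\<close>
  let ?d = "inverse (w l - v l j)"
  let ?z = "x + (\<Sum>j\<in>insert j J. y j)"
  have "?B ?z \<in> N"
    using st[OF l(1)] insert.prems(3) cvs.subspace_diff[OF N] cvs.subspace_scale[OF N] by blast
  moreover have "?B ?z = ?B x + (\<Sum>i\<in>insert j J. ?B (y i))"
    using clinear_addD[OF linB] clinear_sumD[OF linB] by simp
  moreover have "?B x = (w l - v l j) *\<^sub>C x" using x l by (simp add: cvs.scale_left_diff_distrib)
  moreover have "(\<Sum>i\<in>insert j J. ?B (y i)) = (\<Sum>i\<in>J. (v l i - v l j) *\<^sub>C y i)"
    using insert.hyps insert.prems(1)[OF l(1)] by (simp add: cvs.scale_left_diff_distrib)
  ultimately have "?d *\<^sub>C ((w l - v l j) *\<^sub>C x + (\<Sum>i\<in>J. (v l i - v l j) *\<^sub>C y i)) \<in> N"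
    using cvs.subspace_scale[OF N] by simp
  moreover have "?d *\<^sub>C ((w l - v l j) *\<^sub>C x + (\<Sum>i\<in>J. (v l i - v l j) *\<^sub>C y i))
      = x + (\<Sum>i\<in>J. (?d * (v l i - v l j)) *\<^sub>C y i)"
    using l by (simp add: cvs.scale_right_distrib cvs.scale_sum_right)
  ultimately have "x + (\<Sum>i\<in>J. (?d * (v l i - v l j)) *\<^sub>C y i) \<in> N" by simp
  then show ?case
    by (rule insert.IH[rotated 2])
      (use insert.prems clinear_scaleD[OF lin] in \<open>auto simp: cvs.scale_left_commute mult.commute\<close>)
qed simp

section \<open>Operators on the tensor algebra\<close>

definition tens :: "'x::complex_vector list \<Rightarrow> 'x tensor_algebra" where
  "tens u = abs_tensor_algebra (word u)"

definition multilinear :: "('x::complex_vector list \<Rightarrow> 'a::complex_vector) \<Rightarrow> bool" where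
  "multilinear F \<longleftrightarrow> (\<forall>u i. i < length u \<longrightarrow> clinear (\<lambda>x. F (u[i := x])))"

definition free_lift :: "('x list \<Rightarrow> 'a::complex_vector) \<Rightarrow> ('x list \<Rightarrow>\<^sub>0 complex) \<Rightarrow> 'a" where
  "free_lift F p = (\<Sum>w\<in>Poly_Mapping.keys p. Poly_Mapping.lookup p w *\<^sub>C F w)"

text \<open>The map out of the tensor algebra that its universal property promises.
  \<open>rep_tensor_algebra\<close> chooses a representative, and it is multilinearity of
  \<open>F\<close> that makes the choice irrelevant, see \<open>tensor_lift_abs\<close>.\<close>

definition tensor_lift :: "('x::complex_vector list \<Rightarrow> 'a::complex_vector) \<Rightarrow> 'x tensor_algebra \<Rightarrow> 'a" where
  "tensor_lift F t = free_lift F (rep_tensor_algebra t)"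

lemma free_lift_superset:
  assumes "finite A" "Poly_Mapping.keys p \<subseteq> A"
  shows "free_lift F p = (\<Sum>w\<in>A. Poly_Mapping.lookup p w *\<^sub>C F w)"
  unfolding free_lift_def using assms
  by (intro sum.mono_neutral_left) (auto simp: in_keys_iff)

lemma clinear_free_lift: "clinear (free_lift F)"
  unfolding clinear_iff
proof safe
  fix p q :: "'a list \<Rightarrow>\<^sub>0 complex" and c
  let ?A = "Poly_Mapping.keys p \<union> Poly_Mapping.keys q"
  have "Poly_Mapping.keys (p + q) \<subseteq> ?A" by (rule Poly_Mapping.keys_add)
  then show "free_lift F (p + q) = free_lift F p + free_lift F q"
    by (simp add: free_lift_superset[of ?A] lookup_add cvs.scale_left_distrib sum.distrib)
  have "Poly_Mapping.keys (c *\<^sub>C p) \<subseteq> Poly_Mapping.keys p" by (auto simp: in_keys_iff)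
  then show "free_lift F (c *\<^sub>C p) = c *\<^sub>C free_lift F p"
    by (simp add: free_lift_superset[of "Poly_Mapping.keys p"] cvs.scale_sum_right scaleC_complex_def)
qed

lemma free_lift_word: "free_lift F (word w) = F w"
  by (simp add: free_lift_def)

lemma free_expansion: "p = (\<Sum>w\<in>Poly_Mapping.keys p. Poly_Mapping.lookup p w *\<^sub>C word w)"
  for p :: "'x list \<Rightarrow>\<^sub>0 complex"
proof (rule poly_mapping_eqI)
  fix k
  have "Poly_Mapping.lookup (\<Sum>w\<in>Poly_Mapping.keys p. Poly_Mapping.lookup p w *\<^sub>C word w) k
      = (\<Sum>w\<in>Poly_Mapping.keys p. if w = k then Poly_Mapping.lookup p w else 0)"
    by (simp add: lookup_sum lookup_single when_def scaleC_complex_def if_distrib cong: if_cong)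
  then show "Poly_Mapping.lookup p k =
      Poly_Mapping.lookup (\<Sum>w\<in>Poly_Mapping.keys p. Poly_Mapping.lookup p w *\<^sub>C word w) k"
    by (simp add: in_keys_iff)
qed

lemma multilinearD: "multilinear F \<Longrightarrow> i < length u \<Longrightarrow> clinear (\<lambda>x. F (u[i := x]))"
  unfolding multilinear_def by blast

lemma multilinear_add:
  assumes "multilinear F"
  shows "F (us @ [x + y] @ vs) = F (us @ [x] @ vs) + F (us @ [y] @ vs)"
  using clinear_addD[OF multilinearD[OF assms, of "length us" "us @ [0] @ vs"], of x y] by simp

lemma multilinear_scale:
  assumes "multilinear F"
  shows "F (us @ [c *\<^sub>C x] @ vs) = c *\<^sub>C F (us @ [x] @ vs)"
  using clinear_scaleD[OF multilinearD[OF assms, of "length us" "us @ [0] @ vs"], of c x] by simp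

lemma free_lift_tensor_relations:
  assumes F: "multilinear F" and "p \<in> tensor_relations"
  shows "free_lift F p = 0"
proof -
  let ?R = "{word (us @ [x + y] @ vs) - word (us @ [x] @ vs) - word (us @ [y] @ vs) | us vs x y. True} \<union>
      {word (us @ [c *\<^sub>C x] @ vs) - c *\<^sub>C word (us @ [x] @ vs) | us vs c x. True}"
  have "p \<in> cvs.span ?R" using assms(2) by (simp only: tensor_relations_def)
  moreover have "clinear (\<lambda>_. 0)" by (simp add: clinear_iff)
  moreover have "free_lift F q = 0" if "q \<in> ?R" for q
    using that
  proof
    assume "q \<in> {word (us @ [x + y] @ vs) - word (us @ [x] @ vs) - word (us @ [y] @ vs) | us vs x y. True}"
    then show ?thesis
      by (elim CollectE exE conjE)
        (simp only: clinear_diffD[OF clinear_free_lift] free_lift_word multilinear_add[OF F] diff_add_eq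
          add_diff_cancel_left' diff_self)
  next
    assume "q \<in> {word (us @ [c *\<^sub>C x] @ vs) - c *\<^sub>C word (us @ [x] @ vs) | us vs c x. True}"
    then show ?thesis
      by (elim CollectE exE conjE)
        (simp only: clinear_diffD[OF clinear_free_lift] clinear_scaleD[OF clinear_free_lift]
          free_lift_word multilinear_scale[OF F] diff_self)
  qed
  ultimately show ?thesis
    using span_eq_on[OF clinear_free_lift, of "\<lambda>_. 0" p ?R F] by blast
qed

lemma tensor_lift_abs:
  assumes F: "multilinear F"
  shows "tensor_lift F (abs_tensor_algebra p) = free_lift F p"
proof -
  have "tensor_equiv (rep_tensor_algebra (abs_tensor_algebra p)) p"
    using Quotient3_rep_abs[OF Quotient3_tensor_algebra] equivp_reflp[OF tensor_algebra_equivp] by blast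
  then have "free_lift F (rep_tensor_algebra (abs_tensor_algebra p) - p) = 0"
    using free_lift_tensor_relations[OF F] by (simp add: tensor_equiv_def)
  then show ?thesis
    by (simp add: tensor_lift_def clinear_diffD[OF clinear_free_lift])
qed

lemma abs_tensor_algebra_cases:
  obtains p where "t = abs_tensor_algebra p"
  using Quotient3_abs_rep[OF Quotient3_tensor_algebra, of t] by metis

lemma clinear_abs_tensor_algebra: "clinear abs_tensor_algebra"
  by (simp add: clinear_iff plus_tensor_algebra.abs_eq scaleC_tensor_algebra.abs_eq)

lemma clinear_tensor_lift:
  assumes F: "multilinear F"
  shows "clinear (tensor_lift F)"
  unfolding clinear_iff
proof safe
  fix s t :: "'a tensor_algebra" and c
  obtain p q where "s = abs_tensor_algebra p" "t = abs_tensor_algebra q"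
    by (metis abs_tensor_algebra_cases)
  then show "tensor_lift F (s + t) = tensor_lift F s + tensor_lift F t"
    "tensor_lift F (c *\<^sub>C s) = c *\<^sub>C tensor_lift F s"
    by (simp_all add: tensor_lift_abs[OF F] clinear_addD[OF clinear_free_lift]
        clinear_scaleD[OF clinear_free_lift] clinear_addD[OF clinear_abs_tensor_algebra, symmetric]
        clinear_scaleD[OF clinear_abs_tensor_algebra, symmetric])
qed

lemma tensor_lift_tens: "multilinear F \<Longrightarrow> tensor_lift F (tens u) = F u"
  by (simp add: tens_def tensor_lift_abs free_lift_word)

lemma span_tens: "cvs.span (range tens) = UNIV"
proof -
  have "t \<in> cvs.span (range tens)" for t :: "'a tensor_algebra"
  proof -
    obtain p where "t = abs_tensor_algebra p" by (rule abs_tensor_algebra_cases)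
    then have "t = abs_tensor_algebra (\<Sum>w\<in>Poly_Mapping.keys p. Poly_Mapping.lookup p w *\<^sub>C word w)"
      using free_expansion[of p] by simp
    also have "\<dots> = (\<Sum>w\<in>Poly_Mapping.keys p. Poly_Mapping.lookup p w *\<^sub>C tens w)"
      by (simp add: clinear_sumD[OF clinear_abs_tensor_algebra] tens_def
          clinear_scaleD[OF clinear_abs_tensor_algebra])
    finally show ?thesis by (simp add: cvs.span_sum cvs.span_scale cvs.span_base)
  qed
  then show ?thesis by blast
qed

lemma multilinear_tens: "multilinear tens"
  unfolding multilinear_def
proof (intro allI impI)
  fix u :: "'a list" and i assume i: "i < length u"
  let ?us = "take i u" and ?vs = "drop (Suc i) u"
  note eq = upd_conv_take_nth_drop[OF i]
  show "clinear (\<lambda>x. tens (u[i := x]))"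
    unfolding clinear_iff
  proof safe
    fix x y :: 'a and c
    have "abs_tensor_algebra (word (?us @ [x + y] @ ?vs)) =
        abs_tensor_algebra (word (?us @ [x] @ ?vs) + word (?us @ [y] @ ?vs))"
      unfolding tensor_algebra.abs_eq_iff tensor_equiv_def tensor_relations_def
      by (rule cvs.span_base) (auto simp: diff_diff_eq)
    then show "tens (u[i := x + y]) = tens (u[i := x]) + tens (u[i := y])"
      by (simp add: tens_def eq clinear_addD[OF clinear_abs_tensor_algebra])
    have "abs_tensor_algebra (word (?us @ [c *\<^sub>C x] @ ?vs)) =
        abs_tensor_algebra (c *\<^sub>C word (?us @ [x] @ ?vs))"
      unfolding tensor_algebra.abs_eq_iff tensor_equiv_def tensor_relations_def
      by (rule cvs.span_base) blast
    then show "tens (u[i := c *\<^sub>C x]) = c *\<^sub>C tens (u[i := x])"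
      by (simp add: tens_def eq clinear_scaleD[OF clinear_abs_tensor_algebra])
  qed
qed

lemma tens_ext:
  assumes "clinear f" "clinear g" "\<And>u. f (tens u) = g (tens u)"
  shows "f t = g t"
  using span_eq_on[OF assms(1,2), of t "range tens"] assms(3) span_tens by blast

lemma clinear_tens_update: "i < length u \<Longrightarrow> clinear (\<lambda>x. tens (u[i := x]))"
  by (rule multilinearD[OF multilinear_tens])

text \<open>A derivation moves all letters at once. Its summands are operators of their own here,
  because those at different slots commute. Words too short for the slot go to 0, which keeps the
  map linear on the whole tensor algebra.\<close>

definition slot :: "nat \<Rightarrow> 'x::complex_vector endo \<Rightarrow> 'x tensor_algebra \<Rightarrow> 'x tensor_algebra" where
  "slot s b = tensor_lift (\<lambda>u. if s < length u then tens (u[s := endo_apply b (u ! s)]) else 0)"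

lemma multilinear_slot:
  "multilinear (\<lambda>u. if s < length u then tens (u[s := endo_apply b (u ! s)]) else 0)"
  unfolding multilinear_def
proof (intro allI impI)
  fix u :: "'a list" and i assume i: "i < length u"
  show "clinear (\<lambda>x. if s < length (u[i := x]) then tens (u[i := x, s := endo_apply b (u[i := x] ! s)]) else 0)"
  proof (cases "s < length u \<and> s \<noteq> i")
    case True
    then have "(\<lambda>x. if s < length (u[i := x]) then tens (u[i := x, s := endo_apply b (u[i := x] ! s)]) else 0)
      = (\<lambda>x. tens ((u[s := endo_apply b (u ! s)])[i := x]))"
      by (auto simp: fun_eq_iff list_update_swap)
    then show ?thesis by (simp only:) (rule clinear_tens_update, simp add: i)
  next
    case False
    then show ?thesis
      using clinear_compose[OF clinear_tens_update[OF i] clinear_endo_apply[of b]] i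
      by (cases "s < length u") (auto simp: clinear_iff)
  qed
qed

lemma slot_tens: "slot s b (tens u) = (if s < length u then tens (u[s := endo_apply b (u ! s)]) else 0)"
  unfolding slot_def by (rule tensor_lift_tens[OF multilinear_slot])

lemma clinear_slot: "clinear (slot s b)"
  unfolding slot_def by (rule clinear_tensor_lift[OF multilinear_slot])

lemmas slot_add = clinear_addD[OF clinear_slot] and slot_scale = clinear_scaleD[OF clinear_slot]
  and slot_sum = clinear_sumD[OF clinear_slot] and slot_0 = clinear_0D[OF clinear_slot]

lift_definition endo_comp :: "'a::complex_vector endo \<Rightarrow> 'a endo \<Rightarrow> 'a endo" (infixl "\<circ>\<^sub>e" 75)
  is "\<lambda>f g x. f (g x)" by (simp add: clinear_iff)

lemma endo_eqI: "(\<And>x. endo_apply a x = endo_apply b x) \<Longrightarrow> a = b"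
  by (metis endo_apply_inject ext)

lemma slot_comp: "slot s b (slot s c t) = slot s (b \<circ>\<^sub>e c) t"
  by (rule tens_ext) (auto simp: slot_tens endo_comp.rep_eq slot_0 intro: clinear_compose clinear_slot)

lemma slot_commute: "s \<noteq> s' \<Longrightarrow> slot s b (slot s' c t) = slot s' c (slot s b t)"
  by (rule tens_ext) (auto simp: slot_tens slot_0 list_update_swap intro: clinear_compose clinear_slot)

lemma slot_add_left: "slot s (b + c) t = slot s b t + slot s c t"
proof (rule tens_ext[where f = "slot s (b + c)" and g = "\<lambda>t. slot s b t + slot s c t"])
  show "clinear (\<lambda>t. slot s b t + slot s c t)"
    by (simp add: clinear_iff slot_add slot_scale cvs.scale_right_distrib)
  show "slot s (b + c) (tens u) = slot s b (tens u) + slot s c (tens u)" for u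
    by (simp add: slot_tens plus_endo.rep_eq clinear_addD[OF clinear_tens_update])
qed (rule clinear_slot)

lemma slot_scale_left: "slot s (k *\<^sub>C b) t = k *\<^sub>C slot s b t"
proof (rule tens_ext[where f = "slot s (k *\<^sub>C b)" and g = "\<lambda>t. k *\<^sub>C slot s b t"])
  show "clinear (\<lambda>t. k *\<^sub>C slot s b t)" by (rule clinear_scale[OF clinear_slot])
  show "slot s (k *\<^sub>C b) (tens u) = k *\<^sub>C slot s b (tens u)" for u
    by (simp add: slot_tens scaleC_endo.rep_eq clinear_scaleD[OF clinear_tens_update])
qed (rule clinear_slot)

lemma clinear_slot_left: "clinear (\<lambda>b. slot s b t)"
  by (simp add: clinear_iff slot_add_left slot_scale_left)

lemmas slot_0_left = clinear_0D[OF clinear_slot_left] and slot_sum_left = clinear_sumD[OF clinear_slot_left]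

lemma slot_comp0: "b \<circ>\<^sub>e c = 0 \<Longrightarrow> slot s c t = t \<Longrightarrow> slot s b t = 0"
  using slot_comp[of s b c t] by (simp add: slot_0_left)

definition tpow :: "nat \<Rightarrow> 'x::complex_vector tensor_algebra set" where
  "tpow d = cvs.span {tens u | u. length u = d}"

lemma tens_tpow: "length u = d \<Longrightarrow> tens u \<in> tpow d"
  unfolding tpow_def by (rule cvs.span_base) blast

lemma subspace_tpow: "cvs.subspace (tpow d)"
  by (simp add: tpow_def)

lemma tpow_ext:
  assumes "clinear f" "clinear g" "t \<in> tpow d" "\<And>u. length u = d \<Longrightarrow> f (tens u) = g (tens u)"
  shows "f t = g t"
  by (rule span_eq_on[OF assms(1,2) assms(3)[unfolded tpow_def]]) (use assms(4) in auto)

lemma tpow_map: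
  assumes "clinear f" "t \<in> tpow d" "cvs.subspace N" "\<And>u. length u = d \<Longrightarrow> f (tens u) \<in> N"
  shows "f t \<in> N"
  using span_map[OF assms(1) assms(2)[unfolded tpow_def], of N] assms(4) span_id[OF assms(3)] by auto

lemma slot_tpow: "t \<in> tpow d \<Longrightarrow> slot s b t \<in> tpow d"
  by (rule tpow_map[OF clinear_slot _ subspace_tpow])
    (auto simp: slot_tens cvs.subspace_0[OF subspace_tpow] intro: tens_tpow)

lemma tensor_derivation_tens:
  "endo_apply (tensor_derivation D) (tens u) = (\<Sum>s<length u. slot s D (tens u))"
proof -
  have "endo_apply (tensor_derivation D) (tens u) = abs_tensor_algebra (word_derivation D u)"
    by (simp add: tensor_derivation.rep_eq tens_def tensor_derivation_fun.abs_eq free_derivation_word)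
  then show ?thesis
    by (simp add: word_derivation_def clinear_sumD[OF clinear_abs_tensor_algebra] slot_tens)
      (simp add: tens_def)
qed

lemma tensor_derivation_tpow:
  assumes "t \<in> tpow d"
  shows "endo_apply (tensor_derivation D) t = (\<Sum>s<d. slot s D t)"
  by (rule tpow_ext[OF clinear_endo_apply clinear_sum[OF clinear_slot] assms])
    (simp add: tensor_derivation_tens)

text \<open>Common form of a contraction and of the insertion of a dual pair: a bilinear form
  evaluates the letters in two slots, and fixed letters \<open>p\<close> and \<open>q\<close> are
  put in their place.\<close>

definition slot_pair ::
    "('x \<Rightarrow> 'x \<Rightarrow> complex) \<Rightarrow> nat \<Rightarrow> nat \<Rightarrow> 'x \<Rightarrow> 'x \<Rightarrow> 'x::complex_vector tensor_algebra \<Rightarrow> 'x tensor_algebra" where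
  "slot_pair B s s' p q = tensor_lift (\<lambda>u. if s < length u \<and> s' < length u
     then B (u ! s) (u ! s') *\<^sub>C tens (u[s := p, s' := q]) else 0)"

context
  fixes B :: "'x::complex_vector \<Rightarrow> 'x \<Rightarrow> complex" and s s' :: nat
  assumes B: "\<And>x. clinear (B x)" "\<And>y. clinear (\<lambda>x. B x y)" and ne: "s \<noteq> s'"
begin

lemma multilinear_slot_pair: "multilinear (\<lambda>u. if s < length u \<and> s' < length u
     then B (u ! s) (u ! s') *\<^sub>C tens (u[s := p, s' := q]) else 0)"
  unfolding multilinear_def
proof (intro allI impI)
  fix u :: "'x list" and i assume i: "i < length u"
  let ?g = "\<lambda>x. if s < length (u[i := x]) \<and> s' < length (u[i := x])
     then B (u[i := x] ! s) (u[i := x] ! s') *\<^sub>C tens (u[i := x, s := p, s' := q]) else 0"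
  show "clinear ?g"
  proof (cases "s < length u \<and> s' < length u")
    case True
    consider "i = s" | "i = s'" | "i \<noteq> s" "i \<noteq> s'" by blast
    then show ?thesis
    proof cases
      case 1
      then have "?g = (\<lambda>x. B x (u ! s') *\<^sub>C tens (u[s := p, s' := q]))" using True ne by (simp add: fun_eq_iff)
      then show ?thesis using B(2)[of "u ! s'"]
        by (simp add: clinear_iff cvs.scale_left_distrib) (simp add: scaleC_complex_def)
    next
      case 2
      then have "?g = (\<lambda>x. B (u ! s) x *\<^sub>C tens (u[s := p, s' := q]))"
        using True ne by (simp add: fun_eq_iff list_update_swap[of s' s])
      then show ?thesis using B(1)[of "u ! s"]
        by (simp add: clinear_iff cvs.scale_left_distrib) (simp add: scaleC_complex_def)
    next
      case 3
      then have "?g = (\<lambda>x. B (u ! s) (u ! s') *\<^sub>C tens ((u[s := p, s' := q])[i := x]))"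
        using True by (simp add: fun_eq_iff list_update_swap)
      then show ?thesis by (simp only:) (intro clinear_scale clinear_tens_update, simp add: i)
    qed
  next
    case False
    then show ?thesis by (auto simp: clinear_iff)
  qed
qed

lemma slot_pair_tens: "slot_pair B s s' p q (tens u) = (if s < length u \<and> s' < length u
     then B (u ! s) (u ! s') *\<^sub>C tens (u[s := p, s' := q]) else 0)"
  unfolding slot_pair_def by (rule tensor_lift_tens[OF multilinear_slot_pair])

lemma clinear_slot_pair: "clinear (slot_pair B s s' p q)"
  unfolding slot_pair_def by (rule clinear_tensor_lift[OF multilinear_slot_pair])

end

section \<open>Extended letters and their operators\<close>

text \<open>
  A third, trivial component is added to the letters of the tensor algebra: a contraction replaces
  the two letters it consumes by trivial ones, so that positions of letters never shift.
\<close>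

text \<open>The kind of a slot says which component of its letter may be non-zero.\<close>

datatype kind = Dl | Vc | Tr

type_synonym 'v ext = "'v dual \<times> 'v \<times> complex"

lemma dual_eqI: "(\<And>x. dual_apply f x = dual_apply g x) \<Longrightarrow> f = g"
  by (metis dual_apply_inject ext)

lemma dual_add: "dual_apply f (x + y) = dual_apply f x + dual_apply f y"
  and dual_scale: "dual_apply f (c *\<^sub>C x) = c * dual_apply f x"
  and clinear_dual_apply: "clinear (dual_apply f)"
proof -
  show "clinear (dual_apply f)" using dual_apply[of f] by simp
  from clinear_addD[OF this] clinear_scaleD[OF this]
  show "dual_apply f (x + y) = dual_apply f x + dual_apply f y"
    and "dual_apply f (c *\<^sub>C x) = c * dual_apply f x"
    by (simp_all add: scaleC_complex_def)
qed

lemma clinear_dual_apply_left: "clinear (\<lambda>f. dual_apply f x)"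
  by (simp add: clinear_iff plus_dual.rep_eq scaleC_dual.rep_eq)

lemma clinear_dual_endo: "clinear (dual_endo a)"
  unfolding clinear_iff
  by (auto intro!: dual_eqI simp: dual_endo.rep_eq plus_dual.rep_eq scaleC_dual.rep_eq)

lemmas dual_endo_0 = clinear_0D[OF clinear_dual_endo]

lemma dual_0: "dual_apply f 0 = 0"
  using dual_scale[of f 0 0] by simp

lemma endo_0: "endo_apply a 0 = 0"
  by (rule clinear_0D[OF clinear_endo_apply])

lemma coadjoint_apply: "endo_apply (coadjoint a) f = - dual_endo a f"
  by (simp add: coadjoint.rep_eq)

lemma dual_endo_comp: "dual_endo a (dual_endo b f) = dual_endo (b \<circ>\<^sub>e a) f"
  by (rule dual_eqI) (simp add: dual_endo.rep_eq endo_comp.rep_eq)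

lift_definition act :: "'v::complex_vector endo \<Rightarrow> 'v ext endo" is
  "\<lambda>a (f, x, z). (- dual_endo (Endo a) f, a x, 0)"
  by (auto simp: clinear_iff scaleC_prod_def cvs.scale_minus_right Endo_inverse
      clinear_addD[OF clinear_dual_endo] clinear_scaleD[OF clinear_dual_endo])

text \<open>On the dual component this is the plain transpose without the sign of the coadjoint
  action: \<open>cmp Dl\<close> reverses products, and \<open>act\<close> differs from it by a sign.
  For \<open>Tr\<close> the result is always the projection.\<close>

lift_definition cmp :: "kind \<Rightarrow> 'v::complex_vector endo \<Rightarrow> 'v ext endo" is
  "\<lambda>k a (f, x, z). (if k = Dl then dual_endo (Endo a) f else 0, if k = Vc then a x else 0,
     if k = Tr then z else 0)"
  by (auto simp: clinear_iff scaleC_prod_def Endo_inverse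
      clinear_addD[OF clinear_dual_endo] clinear_scaleD[OF clinear_dual_endo])

text \<open>A slot whose letters are multiples of the trivial letter (0, 0, 1) gets the letter \<xi>
  instead. This maps tensors with a trivial slot to tensors with a prescribed letter in that
  slot.\<close>

definition put :: "'v::complex_vector ext \<Rightarrow> 'v ext endo" where
  "put \<xi> = Endo (\<lambda>(f, x, z). z *\<^sub>C \<xi>)"

lemma act_apply: "endo_apply (act a) (f, x, z) = (- dual_endo a f, endo_apply a x, 0)"
  by (simp add: act.rep_eq endo_apply_inverse)

lemma cmp_apply: "endo_apply (cmp k a) (f, x, z) =
    (if k = Dl then dual_endo a f else 0, if k = Vc then endo_apply a x else 0, if k = Tr then z else 0)"
  by (simp add: cmp.rep_eq endo_apply_inverse)

lemma put_apply: "endo_apply (put \<xi>) (f, x, z) = z *\<^sub>C \<xi>"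
proof -
  have "clinear (\<lambda>(f::'a dual, x::'a, z). z *\<^sub>C \<xi>)"
    by (auto simp: clinear_iff scaleC_prod_def cvs.scale_left_distrib)
      (auto simp: scaleC_complex_def algebra_simps)
  then show ?thesis by (simp add: put_def Endo_inverse)
qed

lemma ext_endo_eqI: "(\<And>f x z. endo_apply a (f, x, z) = endo_apply b (f, x, z)) \<Longrightarrow> a = b"
  for a b :: "'v::complex_vector ext endo"
  by (rule endo_eqI) auto

lemma dual_endo_neg: "dual_endo a (- f) = - dual_endo a f"
  using clinear_diffD[OF clinear_dual_endo, of a 0 f] by (simp add: dual_endo_0)

lemmas ext_simps = dual_endo_neg act_apply cmp_apply put_apply endo_comp.rep_eq dual_endo_comp zero_endo.rep_eq
  uminus_endo.rep_eq endo_0 dual_endo_0 scaleC_prod_def zero_prod_def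

lemma act_cmp_Dl: "act a \<circ>\<^sub>e cmp Dl e = - cmp Dl (e \<circ>\<^sub>e a)"
  and act_cmp_Vc: "act a \<circ>\<^sub>e cmp Vc e = cmp Vc (a \<circ>\<^sub>e e)"
  and act_cmp_Tr: "act a \<circ>\<^sub>e cmp Tr e = 0"
  and cmp_act_Dl: "cmp Dl e \<circ>\<^sub>e act a = - cmp Dl (a \<circ>\<^sub>e e)"
  and cmp_act_Vc: "cmp Vc e \<circ>\<^sub>e act a = cmp Vc (e \<circ>\<^sub>e a)"
  and cmp_act_Tr: "cmp Tr e \<circ>\<^sub>e act a = 0"
  and cmp_Dl_Dl: "cmp Dl e \<circ>\<^sub>e cmp Dl e' = cmp Dl (e' \<circ>\<^sub>e e)"
  and cmp_Vc_Vc: "cmp Vc e \<circ>\<^sub>e cmp Vc e' = cmp Vc (e \<circ>\<^sub>e e')"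
  and cmp_Tr_Tr: "cmp Tr e \<circ>\<^sub>e cmp Tr e' = cmp Tr e''"
  by (rule ext_endo_eqI; force simp: ext_simps)+

lemma cmp_put: "cmp k e \<circ>\<^sub>e put \<xi> = put (endo_apply (cmp k e) \<xi>)"
  by (rule ext_endo_eqI) (simp add: endo_comp.rep_eq put_apply endo_scaleC)

lemma cmp_0: "k \<noteq> Tr \<Longrightarrow> cmp k 0 = 0"
  by (rule ext_endo_eqI) (auto simp: ext_simps zero_dual.rep_eq dual_endo.rep_eq dual_0 intro!: dual_eqI)

lemma clinear_put: "clinear put"
  unfolding clinear_iff
proof safe
  fix x y :: "'a ext" and c
  show "put (x + y) = put x + put y"
    by (rule ext_endo_eqI) (simp add: put_apply plus_endo.rep_eq cvs.scale_right_distrib)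
  show "put (c *\<^sub>C x) = c *\<^sub>C put x"
    by (rule ext_endo_eqI) (simp only: put_apply scaleC_endo.rep_eq cvs.scale_left_commute)
qed

lemma slot_neg_left: "slot s (- b) t = - slot s b t"
  using clinear_diffD[OF clinear_slot_left, of s 0 b t] by (simp add: slot_0_left)

text \<open>The pairing enters the sections on tensors only through these two families; in the
  application the \<open>eps i\<close> span \<open>V_*\<close>.\<close>

locale dual_bases =
  fixes v :: "nat \<Rightarrow> 'v::complex_vector" and eps :: "nat \<Rightarrow> 'v dual"
  assumes eps_v: "dual_apply (eps i) (v j) = (if i = j then 1 else 0)"
    and span_v: "cvs.span (range v) = UNIV"
begin

lemma clinear_v_ext: "clinear f \<Longrightarrow> clinear g \<Longrightarrow> (\<And>j. f (v j) = g (v j)) \<Longrightarrow> f x = g x"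
  by (rule span_eq_on[of f g x "range v"]) (auto simp: span_v)

lemma endo_v_ext: "(\<And>j. endo_apply a (v j) = endo_apply b (v j)) \<Longrightarrow> a = b"
  by (rule endo_eqI) (rule clinear_v_ext[OF clinear_endo_apply clinear_endo_apply])

lemma dual_v_ext: "(\<And>j. dual_apply f (v j) = dual_apply g (v j)) \<Longrightarrow> f = g"
  by (rule dual_eqI) (rule clinear_v_ext[OF clinear_dual_apply clinear_dual_apply])

lemma inj_v: "inj v"
  by (rule injI) (metis eps_v zero_neq_one)

lemma independent_v: "cvs.independent (range v)"
  unfolding cvs.dependent_def
proof safe
  fix j assume "v j \<in> cvs.span (range v - {v j})"
  then have "dual_apply (eps j) (v j) = 0"
    by (rule span_eq_on[where g = "\<lambda>_. 0", OF clinear_dual_apply, rotated]) (auto simp: clinear_iff eps_v)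
  then show False by (simp add: eps_v)
qed

lemma ex_clinear_v: "\<exists>g. clinear g \<and> (\<forall>j. g (v j) = h j)"
  for h :: "nat \<Rightarrow> 'a::complex_vector"
proof -
  have "vector_space_pair (scaleC :: complex \<Rightarrow> 'v \<Rightarrow> 'v) (scaleC :: complex \<Rightarrow> 'a \<Rightarrow> 'a)"
    by (intro vector_space_pair.intro cvs.vector_space_axioms)
  from vector_space_pair.linear_independent_extend[OF this independent_v, of "\<lambda>x. h (inv v x)"]
  show ?thesis using inj_v by auto
qed

definition mk_endo :: "(nat \<Rightarrow> 'v) \<Rightarrow> 'v endo" where
  "mk_endo h = Endo (SOME g. clinear g \<and> (\<forall>j. g (v j) = h j))"

lemma mk_endo_v: "endo_apply (mk_endo h) (v j) = h j"
  using someI_ex[OF ex_clinear_v[of h]] by (simp add: mk_endo_def Endo_inverse)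

definition mk_dual :: "(nat \<Rightarrow> complex) \<Rightarrow> 'v dual" where
  "mk_dual h = Dual (SOME g. clinear g \<and> (\<forall>j. g (v j) = h j))"

lemma mk_dual_v: "dual_apply (mk_dual h) (v j) = h j"
  using someI_ex[OF ex_clinear_v[of h]] by (simp add: mk_dual_def Dual_inverse)

text \<open>Block projections, matrix units and injections of one block into another are all of this
  shape, so that the single composition rule \<open>relabel_comp\<close> covers them.\<close>

definition relabel :: "nat set \<Rightarrow> (nat \<Rightarrow> nat) \<Rightarrow> 'v endo" where
  "relabel Q m = mk_endo (\<lambda>j. if j \<in> Q then v (m j) else 0)"

abbreviation prj :: "nat set \<Rightarrow> 'v endo" where
  "prj S \<equiv> relabel S (\<lambda>j. j)"

lemma relabel_v: "endo_apply (relabel Q m) (v j) = (if j \<in> Q then v (m j) else 0)"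
  by (simp add: relabel_def mk_endo_v)

lemma relabel_comp: "relabel Q m \<circ>\<^sub>e relabel Q' m' = relabel {j \<in> Q'. m' j \<in> Q} (\<lambda>j. m (m' j))"
  by (rule endo_v_ext) (simp add: endo_comp.rep_eq relabel_v endo_0)

lemma relabel_cong: "Q = Q' \<Longrightarrow> (\<And>j. j \<in> Q' \<Longrightarrow> m j = m' j) \<Longrightarrow> relabel Q m = relabel Q' m'"
  by (rule endo_v_ext) (simp add: relabel_v)

lemma relabel_empty: "relabel {} m = 0"
  by (rule endo_v_ext) (simp add: relabel_v zero_endo.rep_eq)

lemma prj_prj: "prj S \<circ>\<^sub>e prj S' = prj (S \<inter> S')"
  unfolding relabel_comp by (rule relabel_cong) auto

lemma eps_prj: "dual_apply (eps i) (endo_apply (prj S) x) = (if i \<in> S then dual_apply (eps i) x else 0)"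
proof (rule clinear_v_ext[where f = "\<lambda>x. dual_apply (eps i) (endo_apply (prj S) x)"])
  show "clinear (\<lambda>x. dual_apply (eps i) (endo_apply (prj S) x))"
    by (rule clinear_compose[OF clinear_dual_apply clinear_endo_apply])
  show "clinear (\<lambda>x. if i \<in> S then dual_apply (eps i) x else 0)"
    using clinear_dual_apply by (cases "i \<in> S") (simp_all add: clinear_iff)
qed (simp add: relabel_v eps_v dual_0)

lemma prj_finite: "finite J \<Longrightarrow> endo_apply (prj J) x = (\<Sum>j\<in>J. dual_apply (eps j) x *\<^sub>C v j)"
proof (rule clinear_v_ext[OF clinear_endo_apply])
  show "clinear (\<lambda>x. \<Sum>j\<in>J. dual_apply (eps j) x *\<^sub>C v j)"
    by (intro clinear_sum)
      (simp add: clinear_iff dual_add dual_scale cvs.scale_left_distrib)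
  show "endo_apply (prj J) (v i) = (\<Sum>j\<in>J. dual_apply (eps j) (v i) *\<^sub>C v j)" if "finite J" for i
    using that by (simp add: relabel_v eps_v if_distrib[of "\<lambda>c. c *\<^sub>C _"] cong: if_cong)
qed

lemma ex_finite_support: "\<exists>J. finite J \<and> endo_apply (prj J) x = x"
proof -
  have "cvs.subspace {x. \<exists>J. finite J \<and> endo_apply (prj J) x = x}"
  proof (rule cvs.subspaceI)
    fix x y assume "x \<in> {x. \<exists>J. finite J \<and> endo_apply (prj J) x = x}"
      "y \<in> {x. \<exists>J. finite J \<and> endo_apply (prj J) x = x}"
    then obtain J K where *: "finite J" "endo_apply (prj J) x = x" "finite K" "endo_apply (prj K) y = y"
      by blast
    have "(J \<union> K) \<inter> J = J" "(J \<union> K) \<inter> K = K" by auto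
    then have "endo_apply (prj (J \<union> K)) (endo_apply (prj J) x) = endo_apply (prj J) x"
      "endo_apply (prj (J \<union> K)) (endo_apply (prj K) y) = endo_apply (prj K) y"
      using prj_prj[of "J \<union> K" J] prj_prj[of "J \<union> K" K] by (metis endo_comp.rep_eq)+
    then show "x + y \<in> {x. \<exists>J. finite J \<and> endo_apply (prj J) x = x}"
      using * finite_UnI[OF *(1,3)] by (intro CollectI exI[of _ "J \<union> K"]) (simp add: endo_add)
  next
    fix c x assume "x \<in> {x. \<exists>J. finite J \<and> endo_apply (prj J) x = x}"
    then show "c *\<^sub>C x \<in> {x. \<exists>J. finite J \<and> endo_apply (prj J) x = x}"
      by (auto simp: endo_scaleC)
  next
    show "0 \<in> {x. \<exists>J. finite J \<and> endo_apply (prj J) x = x}"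
      by (intro CollectI exI[of _ "{}"]) (simp add: endo_0)
  qed
  moreover have "v j \<in> {x. \<exists>J. finite J \<and> endo_apply (prj J) x = x}" for j
    by (intro CollectI exI[of _ "{j}"]) (simp add: relabel_v)
  then have "range v \<subseteq> {x. \<exists>J. finite J \<and> endo_apply (prj J) x = x}" by blast
  ultimately have "cvs.span (range v) \<subseteq> {x. \<exists>J. finite J \<and> endo_apply (prj J) x = x}"
    by (intro cvs.span_minimal)
  then have "x \<in> {x. \<exists>J. finite J \<and> endo_apply (prj J) x = x}" unfolding span_v by blast
  then show ?thesis by simp
qed

text \<open>Equivalently, the transpose of \<open>a\<close> preserves the span of the
  \<open>eps i\<close>. Columns are finite because the \<open>v j\<close> span the space.\<close>

definition rowfin :: "'v endo set" where
  "rowfin = {a. \<forall>i. finite {j. dual_apply (eps i) (endo_apply a (v j)) \<noteq> 0}}"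

lemma relabel_rowfin:
  assumes "inj_on m Q" shows "relabel Q m \<in> rowfin"
  unfolding rowfin_def
proof safe
  fix i
  have "{j. dual_apply (eps i) (endo_apply (relabel Q m) (v j)) \<noteq> 0} \<subseteq> {j \<in> Q. m j = i}"
    by (auto simp: relabel_v eps_v dual_0 split: if_splits)
  moreover have "finite {j \<in> Q. m j = i}"
  proof (rule finite_imageD)
    show "finite (m ` {j \<in> Q. m j = i})" by (rule finite_subset[of _ "{i}"]) auto
    show "inj_on m {j \<in> Q. m j = i}" using assms by (auto simp: inj_on_def)
  qed
  ultimately show "finite {j. dual_apply (eps i) (endo_apply (relabel Q m) (v j)) \<noteq> 0}"
    by (rule finite_subset)
qed

end

section \<open>Tensors with prescribed kinds of letters\<close>

lemma endo_comp_assoc: "a \<circ>\<^sub>e b \<circ>\<^sub>e c = a \<circ>\<^sub>e (b \<circ>\<^sub>e c)"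
  by (rule endo_eqI) (simp add: endo_comp.rep_eq)

context dual_bases
begin

definition cprj :: "kind \<Rightarrow> nat set \<Rightarrow> 'v ext endo" where
  "cprj k S = cmp k (prj S)"

lemma cprj_cprj: "cprj k S \<circ>\<^sub>e cprj k S' = cprj k (S \<inter> S')"
  by (cases k) (simp_all add: cprj_def cmp_Dl_Dl cmp_Vc_Vc cmp_Tr_Tr prj_prj Int_commute)

text \<open>For a trivial slot the set of indices is irrelevant.\<close>

definition Box :: "nat \<Rightarrow> (nat \<Rightarrow> kind) \<Rightarrow> (nat \<Rightarrow> nat set) \<Rightarrow> 'v ext tensor_algebra set" where
  "Box d \<tau> S = {t \<in> tpow d. \<forall>s<d. slot s (cprj (\<tau> s) (S s)) t = t}"

lemma BoxI: "t \<in> tpow d \<Longrightarrow> (\<And>s. s < d \<Longrightarrow> slot s (cprj (\<tau> s) (S s)) t = t) \<Longrightarrow> t \<in> Box d \<tau> S"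
  and Box_tpow: "t \<in> Box d \<tau> S \<Longrightarrow> t \<in> tpow d"
  and Box_slot: "t \<in> Box d \<tau> S \<Longrightarrow> s < d \<Longrightarrow> slot s (cprj (\<tau> s) (S s)) t = t"
  by (simp_all add: Box_def)

lemma subspace_Box: "cvs.subspace (Box d \<tau> S)"
  by (rule cvs.subspaceI) (auto simp: Box_def slot_add slot_scale slot_0 cvs.subspace_0[OF subspace_tpow]
      cvs.subspace_add[OF subspace_tpow] cvs.subspace_scale[OF subspace_tpow])

lemma Box_slot_other:
  assumes "t \<in> Box d \<tau> S" "s < d" "s' < d" "s \<noteq> s'"
  shows "slot s (cprj (\<tau> s) (S s)) (slot s' b t) = slot s' b t"
  by (simp only: slot_commute[OF assms(4)] Box_slot[OF assms(1,2)])

lemma Box_slot_update: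
  assumes t: "t \<in> Box d \<tau> S" and s: "s < d"
    and b: "cprj k R \<circ>\<^sub>e b \<circ>\<^sub>e cprj (\<tau> s) (S s) = b \<circ>\<^sub>e cprj (\<tau> s) (S s)"
  shows "slot s b t \<in> Box d (\<tau>(s := k)) (S(s := R))"
proof (rule BoxI)
  show "slot s b t \<in> tpow d" by (rule slot_tpow[OF Box_tpow[OF t]])
  fix s' assume s': "s' < d"
  show "slot s' (cprj ((\<tau>(s := k)) s') ((S(s := R)) s')) (slot s b t) = slot s b t"
  proof (cases "s' = s")
    case True
    have "slot s (cprj k R) (slot s b t) = slot s (cprj k R) (slot s b (slot s (cprj (\<tau> s) (S s)) t))"
      by (simp add: Box_slot[OF t s])
    also have "\<dots> = slot s (b \<circ>\<^sub>e cprj (\<tau> s) (S s)) t" by (simp only: slot_comp b[unfolded endo_comp_assoc])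
    also have "\<dots> = slot s b t" by (simp only: slot_comp[symmetric] Box_slot[OF t s])
    finally show ?thesis using True by simp
  next
    case False
    then show ?thesis using Box_slot_other[OF t s' s, of b] by simp
  qed
qed

lemma slot_eq_on_Box:
  assumes "t \<in> Box d \<tau> S" "s < d" "b \<circ>\<^sub>e cprj (\<tau> s) (S s) = c \<circ>\<^sub>e cprj (\<tau> s) (S s)"
  shows "slot s b t = slot s c t"
  using Box_slot[OF assms(1,2)] slot_comp[of s _ "cprj (\<tau> s) (S s)" t] assms(3) by metis

lemma slot_zero_on_Box:
  assumes "t \<in> Box d \<tau> S" "s < d" "b \<circ>\<^sub>e cprj (\<tau> s) (S s) = 0"
  shows "slot s b t = 0"
  by (rule slot_comp0[OF assms(3) Box_slot[OF assms(1,2)]])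

lemma Box_mono:
  assumes "\<And>s. s < d \<Longrightarrow> \<tau> s \<noteq> Tr \<Longrightarrow> S s \<subseteq> S' s"
  shows "Box d \<tau> S \<subseteq> Box d \<tau> S'"
proof
  fix t assume t: "t \<in> Box d \<tau> S"
  show "t \<in> Box d \<tau> S'"
  proof (rule BoxI)
    show "t \<in> tpow d" by (rule Box_tpow[OF t])
    fix s assume s: "s < d"
    have "cprj (\<tau> s) (S' s) \<circ>\<^sub>e cprj (\<tau> s) (S s) = cprj (\<tau> s) (S s)"
    proof (cases "\<tau> s = Tr")
      case True
      then show ?thesis by (simp add: cprj_def cmp_Tr_Tr)
    next
      case False
      then have "S' s \<inter> S s = S s" using assms[OF s] by blast
      then show ?thesis by (simp add: cprj_cprj)
    qed
    then show "slot s (cprj (\<tau> s) (S' s)) t = t"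
      using Box_slot[OF t s] slot_comp[of s "cprj (\<tau> s) (S' s)" "cprj (\<tau> s) (S s)" t] by simp
  qed
qed

text \<open>A member of the box is fixed by the projection in each slot. Applying these projections
  one slot at a time to an expansion into pure tensors leaves the tensor unchanged but forces the
  letters into their components.\<close>

lemma Box_span: "Box d \<tau> S \<subseteq> cvs.span {tens u | u. length u = d \<and>
    (\<forall>s<d. endo_apply (cprj (\<tau> s) (S s)) (u ! s) = u ! s)}"
proof
  fix t assume t: "t \<in> Box d \<tau> S"
  let ?p = "\<lambda>s. cprj (\<tau> s) (S s)"
  let ?G = "\<lambda>m. {tens u | u. length u = d \<and> (\<forall>s<m. endo_apply (?p s) (u ! s) = u ! s)}"
  have "t \<in> cvs.span (?G m)" if "m \<le> d" for m
    using that
  proof (induction m)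
    case 0
    then show ?case using Box_tpow[OF t] by (simp add: tpow_def)
  next
    case (Suc m)
    have "slot m (?p m) t \<in> cvs.span (?G (Suc m))"
    proof (rule span_map[OF clinear_slot Suc.IH])
      show "m \<le> d" using Suc.prems by simp
      fix y assume "y \<in> ?G m"
      then obtain u where u: "y = tens u" "length u = d" "\<forall>s<m. endo_apply (?p s) (u ! s) = u ! s"
        by blast
      let ?u = "u[m := endo_apply (?p m) (u ! m)]"
      have "endo_apply (?p m) (endo_apply (?p m) (u ! m)) = endo_apply (?p m) (u ! m)"
        using cprj_cprj[of "\<tau> m" "S m" "S m"] by (metis endo_comp.rep_eq Int_absorb)
      then have "length ?u = d \<and> (\<forall>s<Suc m. endo_apply (?p s) (?u ! s) = ?u ! s)"
        using u Suc.prems by (auto simp: nth_list_update less_Suc_eq)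
      moreover have "slot m (?p m) y = tens ?u" using u Suc.prems by (simp add: slot_tens)
      ultimately show "slot m (?p m) y \<in> cvs.span (?G (Suc m))" by (intro cvs.span_base) blast
    qed
    then show ?case using Box_slot[OF t, of m] Suc.prems by simp
  qed
  then show "t \<in> cvs.span (?G d)" by blast
qed

lemma Box_map:
  assumes "clinear f" "t \<in> Box d \<tau> S" "cvs.subspace N"
    and "\<And>u. length u = d \<Longrightarrow> (\<forall>s<d. endo_apply (cprj (\<tau> s) (S s)) (u ! s) = u ! s) \<Longrightarrow> f (tens u) \<in> N"
  shows "f t \<in> N"
proof -
  have "t \<in> cvs.span {tens u | u. length u = d \<and> (\<forall>s<d. endo_apply (cprj (\<tau> s) (S s)) (u ! s) = u ! s)}"
    using assms(2) Box_span by blast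
  from span_map[OF assms(1) this, of N] show ?thesis
    using assms(4) span_id[OF assms(3)] by auto
qed

lemma tens_Box:
  assumes "length u = d" "\<And>s. s < d \<Longrightarrow> endo_apply (cprj (\<tau> s) (S s)) (u ! s) = u ! s"
  shows "tens u \<in> Box d \<tau> S"
  by (rule BoxI) (use assms in \<open>auto simp: slot_tens intro: tens_tpow\<close>)

text \<open>Expand one slot after the other. The projections only have to add up to the identity on
  \<open>t\<close> itself: a slot of \<open>V\<close> will later be given the finite block as its
  only label.\<close>

lemma tpow_decompose:
  assumes t: "t \<in> tpow d" and pr: "\<And>s l. s < d \<Longrightarrow> l \<in> L s \<Longrightarrow> pr s l \<circ>\<^sub>e pr s l = pr s l"
    and sum: "\<And>s. s < d \<Longrightarrow> (\<Sum>l\<in>L s. slot s (pr s l) t) = t"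
  shows "t \<in> cvs.span (\<Union>\<mu>\<in>Pi\<^sub>E {..<d} L. {t \<in> tpow d. \<forall>s<d. slot s (pr s (\<mu> s)) t = t})"
proof -
  \<comment> \<open>The slots below \<open>m\<close> carry a label already; the others still satisfy
    the sum condition, which survives because operators in different slots commute.\<close>
  let ?G = "\<lambda>m. {x \<in> tpow d. (\<forall>s. m \<le> s \<longrightarrow> s < d \<longrightarrow> (\<Sum>l\<in>L s. slot s (pr s l) x) = x) \<and>
      (\<exists>\<mu>. \<forall>s<m. \<mu> s \<in> L s \<and> slot s (pr s (\<mu> s)) x = x)}"
  have "t \<in> cvs.span (?G m)" if "m \<le> d" for m
    using that
  proof (induction m)
    case 0
    then show ?case using t sum by (intro cvs.span_base) simp
  next
    case (Suc m)
    have m: "m < d" using Suc.prems by simp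
    have "(\<Sum>l\<in>L m. slot m (pr m l) t) \<in> cvs.span (?G (Suc m))"
    proof (rule span_map[where f = "\<lambda>t. \<Sum>l\<in>L m. slot m (pr m l) t" and S = "?G m"])
      show "clinear (\<lambda>t. \<Sum>l\<in>L m. slot m (pr m l) t)" by (intro clinear_sum clinear_slot)
      show "t \<in> cvs.span (?G m)" using Suc by simp
      fix y assume "y \<in> ?G m"
      then obtain \<mu> where y: "y \<in> tpow d" "\<And>s. m \<le> s \<Longrightarrow> s < d \<Longrightarrow> (\<Sum>l\<in>L s. slot s (pr s l) y) = y"
        "\<And>s. s < m \<Longrightarrow> \<mu> s \<in> L s \<and> slot s (pr s (\<mu> s)) y = y" by blast
      have "slot m (pr m l) y \<in> ?G (Suc m)" if l: "l \<in> L m" for l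
      proof (intro CollectI conjI exI[of _ "\<mu>(m := l)"] allI impI)
        show "slot m (pr m l) y \<in> tpow d" by (rule slot_tpow[OF y(1)])
        fix s assume s: "Suc m \<le> s" "s < d"
        show "(\<Sum>l'\<in>L s. slot s (pr s l') (slot m (pr m l) y)) = slot m (pr m l) y"
          using y(2)[of s] s by (simp add: slot_commute[of s m] slot_sum[symmetric])
      next
        fix s assume s: "s < Suc m"
        show "(\<mu>(m := l)) s \<in> L s" using y(3) s l by (auto simp: less_Suc_eq)
        show "slot s (pr s ((\<mu>(m := l)) s)) (slot m (pr m l) y) = slot m (pr m l) y"
        proof (cases "s = m")
          case True
          then show ?thesis using pr[OF m l] by (simp add: slot_comp)
        next
          case False
          then have "slot s (pr s (\<mu> s)) y = y" using y(3)[of s] s by simp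
          then show ?thesis using False by (simp add: slot_commute[OF False])
        qed
      qed
      then show "(\<Sum>l\<in>L m. slot m (pr m l) y) \<in> cvs.span (?G (Suc m))"
        by (intro cvs.span_sum cvs.span_base)
    qed
    then show ?case using sum[OF m] by simp
  qed
  then have "t \<in> cvs.span (?G d)" by blast
  moreover have "?G d \<subseteq> (\<Union>\<mu>\<in>Pi\<^sub>E {..<d} L. {t \<in> tpow d. \<forall>s<d. slot s (pr s (\<mu> s)) t = t})"
  proof
    fix x assume "x \<in> ?G d"
    then obtain \<mu> where x: "x \<in> tpow d" "\<And>s. s < d \<Longrightarrow> \<mu> s \<in> L s \<and> slot s (pr s (\<mu> s)) x = x" by blast
    show "x \<in> (\<Union>\<mu>\<in>Pi\<^sub>E {..<d} L. {t \<in> tpow d. \<forall>s<d. slot s (pr s (\<mu> s)) t = t})"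
      using x by (intro UN_I[of "restrict \<mu> {..<d}"]) auto
  qed
  ultimately show ?thesis using cvs.span_mono by blast
qed

end

section \<open>Subspaces stable under independent actions on the slots\<close>

text \<open>Induction on the finite set. With \<open>z\<close> dual to \<open>g\<close>, subtract
  f(z) times \<open>g\<close> from \<open>f\<close>, separate the difference from the remaining
  functionals, and correct the vector found by a multiple of \<open>z\<close> so that
  \<open>g\<close> vanishes on it. A \<open>g\<close> in the span of the others vanishes wherever
  they do.\<close>

lemma functional_separation:
  fixes f :: "'v::complex_vector dual"
  assumes "finite \<Phi>" "f \<notin> cvs.span \<Phi>"
  shows "\<exists>z. dual_apply f z = 1 \<and> (\<forall>g\<in>\<Phi>. dual_apply g z = 0)"
  using assms
proof (induction \<Phi> arbitrary: f)
  case empty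
  then have "f \<noteq> 0" by simp
  then obtain x where "dual_apply f x \<noteq> 0" using dual_eqI[of f 0] by (auto simp: zero_dual.rep_eq)
  then show ?case by (intro exI[of _ "inverse (dual_apply f x) *\<^sub>C x"]) (simp add: dual_scale)
next
  case (insert g \<Phi>)
  have sub: "cvs.span \<Phi> \<subseteq> cvs.span (insert g \<Phi>)" by (intro cvs.span_mono) blast
  show ?case
  proof (cases "g \<in> cvs.span \<Phi>")
    case True
    obtain z where z: "dual_apply f z = 1" "\<forall>h\<in>\<Phi>. dual_apply h z = 0"
      using insert.IH[of f] insert.prems sub by blast
    have "dual_apply g z = 0"
      using span_eq_on[OF clinear_dual_apply_left[of z], of "\<lambda>_. 0" g \<Phi>] True z(2)
      by (simp add: clinear_iff)
    then show ?thesis using z by auto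
  next
    case False
    obtain z where z: "dual_apply g z = 1" "\<forall>h\<in>\<Phi>. dual_apply h z = 0"
      using insert.IH[OF False] by blast
    let ?f = "f - dual_apply f z *\<^sub>C g"
    have "?f \<notin> cvs.span \<Phi>"
    proof
      assume "?f \<in> cvs.span \<Phi>"
      then have "?f + dual_apply f z *\<^sub>C g \<in> cvs.span (insert g \<Phi>)"
        using sub by (intro cvs.span_add cvs.span_scale) (auto intro: cvs.span_base)
      then show False using insert.prems by simp
    qed
    then obtain y where y: "dual_apply ?f y = 1" "\<forall>h\<in>\<Phi>. dual_apply h y = 0"
      using insert.IH by blast
    let ?z = "y - dual_apply g y *\<^sub>C z"
    have "dual_apply h ?z = dual_apply h y - dual_apply g y * dual_apply h z" for h
      by (simp add: clinear_diffD[OF clinear_dual_apply] dual_scale)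
    then show ?thesis using z y
      by (intro exI[of _ ?z]) (auto simp: minus_dual.rep_eq scaleC_dual.rep_eq scaleC_complex_def mult.commute)
  qed
qed

lemma endo_comp_neg: "(- a) \<circ>\<^sub>e b = - (a \<circ>\<^sub>e b)" "a \<circ>\<^sub>e (- b) = - (a \<circ>\<^sub>e b)"
  by (auto intro!: endo_eqI simp: endo_comp.rep_eq uminus_endo.rep_eq
      clinear_diffD[OF clinear_endo_apply, of a 0, simplified endo_0, simplified])

lemma endo_comp_0: "0 \<circ>\<^sub>e b = 0" "a \<circ>\<^sub>e 0 = 0"
  by (auto intro!: endo_eqI simp: endo_comp.rep_eq zero_endo.rep_eq endo_0)

lemma clinear_endo_apply_left: "clinear (\<lambda>a. endo_apply a x)"
  by (simp add: clinear_iff plus_endo.rep_eq scaleC_endo.rep_eq)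

lemma clinear_dual_endo_left: "clinear (\<lambda>a. dual_endo a f)"
  unfolding clinear_iff
  by (auto intro!: dual_eqI simp: dual_endo.rep_eq plus_dual.rep_eq scaleC_dual.rep_eq
      plus_endo.rep_eq scaleC_endo.rep_eq dual_add dual_scale scaleC_complex_def)

lemma clinear_cmp: "k \<noteq> Tr \<Longrightarrow> clinear (cmp k)"
  unfolding clinear_iff
  by (auto intro!: ext_endo_eqI simp: cmp_apply plus_endo.rep_eq scaleC_endo.rep_eq
      clinear_addD[OF clinear_dual_endo_left] clinear_scaleD[OF clinear_dual_endo_left] scaleC_prod_def)

context dual_bases
begin

text \<open>With pairwise disjoint index sets for the slots, each of these algebras acts on one slot
  only; this is the source of the independence of the slots.\<close>

definition local_ops :: "nat set \<Rightarrow> 'v endo set" where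
  "local_ops S = {a \<in> rowfin. prj S \<circ>\<^sub>e a \<circ>\<^sub>e prj S = a}"

lemma local_opsD:
  assumes "a \<in> local_ops S" shows "prj S \<circ>\<^sub>e a = a" "a \<circ>\<^sub>e prj S = a" "a \<in> rowfin"
proof -
  have *: "prj S \<circ>\<^sub>e (a \<circ>\<^sub>e prj S) = a" "a \<in> rowfin"
    using assms by (auto simp: local_ops_def endo_comp_assoc)
  have "prj S \<circ>\<^sub>e (prj S \<circ>\<^sub>e (a \<circ>\<^sub>e prj S)) = prj S \<circ>\<^sub>e (a \<circ>\<^sub>e prj S)"
    by (simp add: endo_comp_assoc[symmetric] prj_prj)
  then show "prj S \<circ>\<^sub>e a = a" using * by simp
  have "prj S \<circ>\<^sub>e (a \<circ>\<^sub>e prj S) \<circ>\<^sub>e prj S = prj S \<circ>\<^sub>e (a \<circ>\<^sub>e prj S)"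
    by (simp add: endo_comp_assoc prj_prj)
  then show "a \<circ>\<^sub>e prj S = a" using * by simp
  show "a \<in> rowfin" by fact
qed

lemma cprj_act_local: "a \<in> local_ops S \<Longrightarrow> cprj k S \<circ>\<^sub>e act a \<circ>\<^sub>e cprj k S = act a \<circ>\<^sub>e cprj k S"
  by (cases k) (simp_all add: cprj_def act_cmp_Dl act_cmp_Vc act_cmp_Tr
      cmp_Dl_Dl cmp_Vc_Vc local_opsD cmp_act_Dl cmp_act_Vc cmp_act_Tr endo_comp_neg endo_comp_0)

definition slot_ops :: "nat \<Rightarrow> (nat \<Rightarrow> nat set) \<Rightarrow> (nat \<times> 'v endo) set" where
  "slot_ops d S = {(s, a). s < d \<and> a \<in> local_ops (S s)}"

definition slot_act :: "nat \<times> 'v endo \<Rightarrow> 'v ext tensor_algebra \<Rightarrow> 'v ext tensor_algebra" where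
  "slot_act = (\<lambda>(s, a). slot s (act a))"

lemma slot_act_Box:
  assumes "a \<in> local_ops (S s)" "s < d" "t \<in> Box d \<tau> S"
  shows "slot s (act a) t \<in> Box d \<tau> S"
  using Box_slot_update[OF assms(3,2) cprj_act_local[OF assms(1), of "\<tau> s"]] by simp

lemma slot_act_cmp:
  assumes "t \<in> Box d \<tau> S" "s < d"
  shows "\<tau> s = Dl \<Longrightarrow> slot s (act a) t = - slot s (cmp Dl a) t"
    and "\<tau> s = Vc \<Longrightarrow> slot s (act a) t = slot s (cmp Vc a) t"
    and "\<tau> s = Tr \<Longrightarrow> slot s (act a) t = 0"
proof -
  show "slot s (act a) t = - slot s (cmp Dl a) t" if "\<tau> s = Dl"
    unfolding slot_neg_left[symmetric]
    by (rule slot_eq_on_Box[OF assms]) (simp add: that cprj_def act_cmp_Dl cmp_Dl_Dl endo_comp_neg)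
  show "slot s (act a) t = slot s (cmp Vc a) t" if "\<tau> s = Vc"
    by (rule slot_eq_on_Box[OF assms]) (simp add: that cprj_def act_cmp_Vc cmp_Vc_Vc)
  show "slot s (act a) t = 0" if "\<tau> s = Tr"
    by (rule slot_zero_on_Box[OF assms]) (simp add: that cprj_def act_cmp_Tr)
qed

text \<open>The sign between \<open>act\<close> and \<open>cmp\<close> on a dual slot is harmless
  for subspaces, so both kinds of slots can be treated by \<open>cmp\<close> alike.\<close>

lemma slot_cmp_mem:
  assumes "N \<in> subs (slot_ops d S) slot_act (Box d \<tau> S)" "t \<in> N" "s < d" "\<tau> s \<noteq> Tr" "a \<in> local_ops (S s)"
  shows "slot s (cmp (\<tau> s) a) t \<in> N"
proof -
  have N: "stable (slot_ops d S) slot_act N" "t \<in> Box d \<tau> S" using assms(1,2) by (auto simp: subs_def)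
  have mem: "slot s (act a) t \<in> N"
    using stable_op[OF N(1), of "(s, a)" t] assms by (simp add: slot_ops_def slot_act_def)
  show ?thesis
  proof (cases "\<tau> s")
    case Dl
    then show ?thesis
      using mem slot_act_cmp(1)[OF N(2) assms(3)] cvs.subspace_neg[OF stable_subspace[OF N(1)] mem] by simp
  qed (use mem slot_act_cmp(2)[OF N(2) assms(3)] assms(4) in auto)
qed

definition vec :: "kind \<Rightarrow> nat \<Rightarrow> 'v ext" where
  "vec k i = (if k = Dl then (eps i, 0, 0) else (0, v i, 0))"

text \<open>The matrix unit that turns the letter \<open>vec k i\<close> into
  \<open>vec k c\<close>. On functionals it acts by its transpose, whence the exchanged indices in
  the case \<open>Dl\<close>.\<close>

definition mv :: "kind \<Rightarrow> nat \<Rightarrow> nat \<Rightarrow> 'v endo" where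
  "mv k i c = (if k = Dl then relabel {c} (\<lambda>_. i) else relabel {i} (\<lambda>_. c))"

text \<open>Stores the coordinate \<open>i\<close> in the trivial component, so that a matrix unit
  factors as \<open>pick\<close> followed by \<open>put\<close>, see \<open>cmp_mv\<close>.\<close>

definition pick :: "kind \<Rightarrow> nat \<Rightarrow> 'v ext endo" where
  "pick k i = Endo (\<lambda>(f, x, z). (0, 0, if k = Dl then dual_apply f (v i) else dual_apply (eps i) x))"

lemma pick_apply: "endo_apply (pick k i) (f, x, z) =
    (0, 0, if k = Dl then dual_apply f (v i) else dual_apply (eps i) x)"
proof -
  have "clinear (\<lambda>(f, x, z::complex). (0::'v dual, 0::'v, if k = Dl then dual_apply f (v i) else dual_apply (eps i) x))"
    by (auto simp: clinear_iff scaleC_prod_def plus_dual.rep_eq scaleC_dual.rep_eq dual_add dual_scale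
        scaleC_complex_def)
  then show ?thesis by (simp add: pick_def Endo_inverse)
qed

lemma mv_local: "i \<in> S \<Longrightarrow> c \<in> S \<Longrightarrow> mv k i c \<in> local_ops S"
  by (auto simp: local_ops_def mv_def relabel_rowfin relabel_comp intro!: relabel_cong)

lemma relabel_single: "endo_apply (relabel {i} m) x = dual_apply (eps i) x *\<^sub>C v (m i)"
proof (rule clinear_v_ext[OF clinear_endo_apply])
  show "clinear (\<lambda>x. dual_apply (eps i) x *\<^sub>C v (m i))"
    by (simp add: clinear_iff dual_add dual_scale cvs.scale_left_distrib)
qed (auto simp: relabel_v eps_v)

lemma dual_endo_relabel_single: "dual_endo (relabel {c} m) f = dual_apply f (v (m c)) *\<^sub>C eps c"
  by (rule dual_v_ext) (simp add: dual_endo.rep_eq relabel_v scaleC_dual.rep_eq eps_v dual_0 scaleC_complex_def)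

lemma cmp_mv: "k \<noteq> Tr \<Longrightarrow> cmp k (mv k i c) = put (vec k c) \<circ>\<^sub>e pick k i"
  by (rule ext_endo_eqI) (cases k; simp add: cmp_apply mv_def endo_comp.rep_eq pick_apply put_apply
      vec_def relabel_single dual_endo_relabel_single scaleC_prod_def)

lemma mv_same: "mv k i i = prj {i}"
  by (auto simp: mv_def intro: relabel_cong)

lemma cmp_mv_vec: "k \<noteq> Tr \<Longrightarrow> endo_apply (cmp k (mv k c i)) (vec k c) = vec k i"
  by (cases k; simp add: cmp_apply mv_def vec_def relabel_v dual_endo_relabel_single eps_v)

lemma cmp_Tr_pick: "cmp Tr e \<circ>\<^sub>e pick k i = pick k i"
  by (rule ext_endo_eqI) (simp add: endo_comp.rep_eq pick_apply cmp_apply)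

lemma prj_sum: "finite J \<Longrightarrow> prj J = (\<Sum>i\<in>J. prj {i})"
  by (rule endo_v_ext) (simp add: clinear_sumD[OF clinear_endo_apply_left] relabel_v)

text \<open>Automatic for a slot of \<open>V\<close>. For a dual slot it singles out the tensors
  whose letters there lie in the span of the \<open>eps i\<close>, that is, in
  \<open>V_*\<close>.\<close>

definition finite_at :: "nat \<Rightarrow> kind \<Rightarrow> 'v ext tensor_algebra \<Rightarrow> bool" where
  "finite_at s k t \<longleftrightarrow> (\<exists>J. finite J \<and> slot s (cprj k J) t = t)"

lemma finite_at_add:
  assumes "finite_at s k t" "finite_at s k t'" shows "finite_at s k (t + t')"
proof -
  obtain J J' where J: "finite J" "slot s (cprj k J) t = t" "finite J'" "slot s (cprj k J') t' = t'"
    using assms unfolding finite_at_def by blast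
  have eq: "(J \<union> J') \<inter> J = J" "(J \<union> J') \<inter> J' = J'" by auto
  have "slot s (cprj k (J \<union> J')) (slot s (cprj k J) t) = slot s (cprj k J) t"
    "slot s (cprj k (J \<union> J')) (slot s (cprj k J') t') = slot s (cprj k J') t'"
    by (simp_all only: slot_comp cprj_cprj eq)
  then have "slot s (cprj k (J \<union> J')) (t + t') = t + t'" by (simp only: slot_add J(2,4))
  then show ?thesis unfolding finite_at_def using J(1,3) by blast
qed

lemma subspace_finite_at: "cvs.subspace {t. finite_at s k t}"
proof (rule cvs.subspaceI)
  show "0 \<in> {t. finite_at s k t}"
    unfolding finite_at_def mem_Collect_eq by (rule exI[of _ "{}"]) (simp add: slot_0)
  show "c *\<^sub>C t \<in> {t. finite_at s k t}" if "t \<in> {t. finite_at s k t}" for c t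
    using that unfolding finite_at_def mem_Collect_eq by (metis slot_scale)
qed (simp add: finite_at_add)

lemma finite_at_other: "s \<noteq> s' \<Longrightarrow> finite_at s k t \<Longrightarrow> finite_at s k (slot s' b t)"
  unfolding finite_at_def by (metis slot_commute)

lemma finite_at_Vc: "t \<in> Box d \<tau> S \<Longrightarrow> \<tau> s = Vc \<Longrightarrow> s < d \<Longrightarrow> finite_at s Vc t"
proof -
  assume t: "t \<in> Box d \<tau> S" and s: "\<tau> s = Vc" "s < d"
  have id: "clinear (\<lambda>t::'v ext tensor_algebra. t)" by (simp add: clinear_iff)
  have "t \<in> {t. finite_at s Vc t}"
  proof (rule Box_map[OF id t subspace_finite_at])
    fix u assume u: "length u = d" "\<forall>s<d. endo_apply (cprj (\<tau> s) (S s)) (u ! s) = u ! s"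
    obtain f x z where fxz: "u ! s = (f, x, z)" by (cases "u ! s")
    then have "u ! s = (0, x, 0)"
      using u(2)[rule_format, OF s(2)] s(1) by (auto simp: cprj_def cmp_apply)
    moreover obtain J where J: "finite J" "endo_apply (prj J) x = x" using ex_finite_support by blast
    ultimately have "slot s (cprj Vc J) (tens u) = tens (u[s := u ! s])"
      using u(1) s(2) by (simp add: slot_tens cprj_def cmp_apply)
    then show "tens u \<in> {t. finite_at s Vc t}"
      unfolding finite_at_def using J(1) by auto
  qed
  then show ?thesis by simp
qed

lemma finite_at_expand:
  assumes t: "t \<in> Box d \<tau> S" and s: "s < d" "\<tau> s = k" "k \<noteq> Tr" and fin: "finite_at s k t"
  obtains J where "finite J" "J \<subseteq> S s" "t = (\<Sum>i\<in>J. slot s (cmp k (mv k i i)) t)"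
proof -
  obtain J where J: "finite J" "slot s (cprj k J) t = t" using fin unfolding finite_at_def by blast
  \<comment> \<open>Shrinking the support to \<open>S s\<close> keeps the matrix units used later
    inside \<open>local_ops (S s)\<close>.\<close>
  have "slot s (cprj k (J \<inter> S s)) t = t"
    using J(2) Box_slot[OF t s(1)] s(2) slot_comp[of s "cprj k J" "cprj k (S s)" t] by (simp add: cprj_cprj)
  moreover have "cprj k (J \<inter> S s) = (\<Sum>i\<in>J \<inter> S s. cmp k (mv k i i))"
    unfolding cprj_def mv_same using prj_sum[of "J \<inter> S s"] J(1) clinear_sumD[OF clinear_cmp[OF s(3)]] by simp
  ultimately have "t = (\<Sum>i\<in>J \<inter> S s. slot s (cmp k (mv k i i)) t)"
    by (simp add: slot_sum_left)
  then show thesis using that[of "J \<inter> S s"] J(1) by simp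
qed

lemma pick_Box:
  assumes "t \<in> Box d \<tau> S" "s < d"
  shows "slot s (pick k i) t \<in> Box d (\<tau>(s := Tr)) S"
  using Box_slot_update[OF assms, of Tr "S s" "pick k i"] by (simp add: cprj_def cmp_Tr_pick)

lemma slot_put_cmp:
  assumes "k \<noteq> Tr"
  shows "slot s (put (vec k c)) (slot s (pick k i) t) = slot s (cmp k (mv k i c)) t"
  using assms by (simp add: slot_comp cmp_mv)

lemma slot_cmp_put: "slot s (cmp k a) (slot s (put \<xi>) y) = slot s (put (endo_apply (cmp k a) \<xi>)) y"
  by (simp add: slot_comp cmp_put)

text \<open>\<open>put\<close> goes from a trivial slot, on which every operator acts by 0, to a
  slot on which they act non-trivially. To make it equivariant the operators at \<open>s\<close> are
  set to 0 on the target, and \<open>N\<close> stays stable because it contains 0.\<close>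

lemma stable_other_slots:
  assumes "stable (slot_ops d S) slot_act N"
  shows "stable (slot_ops d S) (\<lambda>(s', a) t. if s' = s then 0 else slot s' (act a) t) N"
  using assms cvs.subspace_0[OF stable_subspace[OF assms]] unfolding stable_def slot_act_def by auto

lemma slot_put_equivariant:
  assumes "(s', a) \<in> slot_ops d S" "s < d" "y \<in> Box d (\<tau>(s := Tr)) S"
  shows "slot s (put \<xi>) (slot_act (s', a) y) = (if s' = s then 0 else slot s' (act a) (slot s (put \<xi>) y))"
  using slot_act_cmp(3)[OF assms(3,2)] assms(2)
  by (simp add: slot_act_def slot_0 slot_commute[of s s'])

lemma stable_Box: "stable (slot_ops d S) slot_act (Box d \<tau> S)"
  using slot_act_Box[of _ S _ d _ \<tau>] by (auto simp: stable_def subspace_Box slot_ops_def slot_act_def)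

lemma stable_put:
  assumes s: "s < d" and N: "stable (slot_ops d S) slot_act N"
  shows "stable (slot_ops d S) slot_act {y \<in> Box d (\<tau>(s := Tr)) S. slot s (put \<xi>) y \<in> N}"
proof (rule stable_vimage[OF clinear_slot stable_Box stable_other_slots[OF N, of s]])
  fix i y assume "i \<in> slot_ops d S" "y \<in> Box d (\<tau>(s := Tr)) S"
  then show "slot s (put \<xi>) (slot_act i y) =
      (case i of (s', a) \<Rightarrow> \<lambda>t. if s' = s then 0 else slot s' (act a) t) (slot s (put \<xi>) y)"
    using slot_put_equivariant[OF _ s, of _ _ S y \<tau> \<xi>] by (cases i) simp
qed

text \<open>Split \<open>t\<close> by the letter in slot \<open>s\<close>. A matrix unit moves the
  letter \<open>i\<close> to the reference letter \<open>c\<close>, where \<open>N\<close> and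
  \<open>N'\<close> agree by hypothesis, and another one moves it back.\<close>

lemma detect_finite_at:
  assumes N: "N \<in> subs (slot_ops d S) slot_act (Box d \<tau> S)"
    and N': "N' \<in> subs (slot_ops d S) slot_act (Box d \<tau> S)"
    and s: "s < d" "\<tau> s = k" "k \<noteq> Tr" and c: "c \<in> S s"
    and eq: "{y \<in> Box d (\<tau>(s := Tr)) S. slot s (put (vec k c)) y \<in> N} =
      {y \<in> Box d (\<tau>(s := Tr)) S. slot s (put (vec k c)) y \<in> N'}"
    and t: "t \<in> N'" "finite_at s k t"
  shows "t \<in> N"
proof -
  have tB: "t \<in> Box d \<tau> S" using N' t by (auto simp: subs_def)
  have sub: "cvs.subspace N" using N by (simp add: subs_def stable_def)
  obtain J where J: "finite J" "J \<subseteq> S s" "t = (\<Sum>i\<in>J. slot s (cmp k (mv k i i)) t)"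
    using finite_at_expand[OF tB s t(2)] by blast
  have "slot s (cmp k (mv k i i)) t \<in> N" if i: "i \<in> J" for i
  proof -
    have iS: "i \<in> S s" using i J by blast
    let ?y = "slot s (pick k i) t"
    have "slot s (put (vec k c)) ?y \<in> N'"
      using slot_cmp_mem[OF N' t(1) s(1), of "mv k i c"] mv_local[OF iS c] s
      by (simp add: slot_put_cmp)
    then have "slot s (put (vec k c)) ?y \<in> N" using eq pick_Box[OF tB s(1)] by blast
    from slot_cmp_mem[OF N this s(1), of "mv k c i"]
    have "slot s (put (vec k i)) ?y \<in> N"
      using mv_local[OF c iS] s by (simp add: slot_cmp_put cmp_mv_vec)
    then show ?thesis using s by (simp add: slot_put_cmp)
  qed
  then have "(\<Sum>i\<in>J. slot s (cmp k (mv k i i)) t) \<in> N" by (rule cvs.subspace_sum[OF sub])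
  then show ?thesis using J(3) by simp
qed

text \<open>Matrix units make a slot of \<open>V\<close> behave like a simple factor: a stable
  subspace is recovered from its multiplicity space at the single letter \<open>v c\<close>, and in
  that space the slot is trivial.\<close>

lemma slot_height_Vc:
  assumes fh: "finite_height (subs (slot_ops d S) slot_act (Box d (\<tau>(s := Tr)) S))"
    and s: "s < d" "\<tau> s = Vc" and c: "c \<in> S s"
  shows "finite_height (subs (slot_ops d S) slot_act (Box d \<tau> S))"
proof (rule finite_height_detect1[OF fh,
      where \<phi> = "\<lambda>N. {y \<in> Box d (\<tau>(s := Tr)) S. slot s (put (vec Vc c)) y \<in> N}"])
  let ?\<phi> = "\<lambda>N. {y \<in> Box d (\<tau>(s := Tr)) S. slot s (put (vec Vc c)) y \<in> N}"
  show "?\<phi> N \<in> subs (slot_ops d S) slot_act (Box d (\<tau>(s := Tr)) S)"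
    if "N \<in> subs (slot_ops d S) slot_act (Box d \<tau> S)" for N
  proof -
    have "stable (slot_ops d S) slot_act N" using that by (simp add: subs_def)
    then have "stable (slot_ops d S) slot_act (?\<phi> N)" by (rule stable_put[OF s(1)])
    then show ?thesis by (simp add: subs_def Collect_mono)
  qed
  show "?\<phi> N \<subseteq> ?\<phi> N'" if "N \<subseteq> N'" for N N' using that by blast
  show "N' \<subseteq> N" if N: "N \<in> subs (slot_ops d S) slot_act (Box d \<tau> S)"
    "N' \<in> subs (slot_ops d S) slot_act (Box d \<tau> S)" "?\<phi> N = ?\<phi> N'" for N N'
  proof
    fix t assume t: "t \<in> N'"
    then have "t \<in> Box d \<tau> S" using N(2) by (auto simp: subs_def)
    then have "finite_at s Vc t" using finite_at_Vc s by blast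
    then show "t \<in> N" by (intro detect_finite_at[OF N(1,2) s _ c N(3) t]) simp_all
  qed
qed

text \<open>Pick vectors \<open>z j\<close> on which \<open>f\<close> is 1 while \<Phi> and the
  first \<open>j\<close> coordinate functionals vanish; they exist because \<open>f\<close> is
  independent of all of these. The operator sending \<open>v j\<close> to the part of
  \<open>z j\<close> over \<open>S\<close> has no entry in row \<open>i\<close> beyond column
  \<open>i\<close>, hence finite rows.\<close>

lemma ex_local_density:
  assumes "finite \<Phi>" "\<And>g. g \<in> insert f \<Phi> \<Longrightarrow> dual_endo (prj S) g = g"
    and "f \<notin> cvs.span (\<Phi> \<union> range eps)"
  shows "\<exists>a\<in>local_ops S. dual_endo a f = mk_dual (\<lambda>j. if j \<in> S then 1 else 0) \<and>
    (\<forall>g\<in>\<Phi>. dual_endo a g = 0)"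
proof -
  have "\<exists>z. dual_apply f z = 1 \<and> (\<forall>g\<in>\<Phi> \<union> eps ` {..<j}. dual_apply g z = 0)" for j
  proof (rule functional_separation)
    show "finite (\<Phi> \<union> eps ` {..<j})" using assms(1) by simp
    have "cvs.span (\<Phi> \<union> eps ` {..<j}) \<subseteq> cvs.span (\<Phi> \<union> range eps)"
      by (intro cvs.span_mono) blast
    then show "f \<notin> cvs.span (\<Phi> \<union> eps ` {..<j})" using assms(3) by blast
  qed
  then obtain z where z: "\<And>j. dual_apply f (z j) = 1" "\<And>j g. g \<in> \<Phi> \<Longrightarrow> dual_apply g (z j) = 0"
    "\<And>j i. i < j \<Longrightarrow> dual_apply (eps i) (z j) = 0"
    by (metis UnI1 UnI2 imageI lessThan_iff)
  let ?a = "mk_endo (\<lambda>j. if j \<in> S then endo_apply (prj S) (z j) else 0)"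
  have ap: "dual_apply g (endo_apply (prj S) x) = dual_apply g x" if "g \<in> insert f \<Phi>" for g x
    using assms(2)[OF that] by (metis dual_endo.rep_eq)
  have "{j. dual_apply (eps i) (endo_apply ?a (v j)) \<noteq> 0} \<subseteq> {..i}" for i
    using z(3) by (auto simp: mk_endo_v eps_prj dual_0 split: if_splits) (meson not_le)
  then have "?a \<in> rowfin" unfolding rowfin_def using finite_subset finite_atMost by blast
  moreover have "prj S \<circ>\<^sub>e ?a \<circ>\<^sub>e prj S = ?a"
  proof (rule endo_v_ext)
    fix j
    have "endo_apply (prj S) (endo_apply (prj S) (z j)) = endo_apply (prj S) (z j)"
      using prj_prj[of S S] by (metis Int_absorb endo_comp.rep_eq)
    then show "endo_apply (prj S \<circ>\<^sub>e ?a \<circ>\<^sub>e prj S) (v j) = endo_apply ?a (v j)"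
      by (simp add: endo_comp.rep_eq relabel_v mk_endo_v endo_0)
  qed
  ultimately have "?a \<in> local_ops S" by (simp add: local_ops_def)
  moreover have "dual_endo ?a f = mk_dual (\<lambda>j. if j \<in> S then 1 else 0)"
    by (rule dual_v_ext) (simp add: dual_endo.rep_eq mk_endo_v mk_dual_v ap z(1) dual_0)
  moreover have "dual_endo ?a g = 0" if "g \<in> \<Phi>" for g
    by (rule dual_v_ext) (simp add: dual_endo.rep_eq mk_endo_v ap that z(2) dual_0 zero_dual.rep_eq)
  ultimately show ?thesis by blast
qed

text \<open>The diagonal matrix with entries f(v j) does it. The functional that is 1 on all
  \<open>v j\<close> over \<open>S\<close> thus generates every functional supported there, which
  makes it the test functional of \<open>slot_height_Dl\<close>.\<close>

lemma ex_local_diagonal: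
  assumes "dual_endo (prj S) f = f"
  shows "\<exists>a\<in>local_ops S. dual_endo a (mk_dual (\<lambda>j. if j \<in> S then 1 else 0)) = f"
proof -
  let ?a = "mk_endo (\<lambda>j. dual_apply f (v j) *\<^sub>C v j)"
  have f: "dual_apply f (v j) = 0" if "j \<notin> S" for j
    using assms that dual_endo.rep_eq[of "prj S" f] by (metis relabel_v dual_0)
  have "{j. dual_apply (eps i) (endo_apply ?a (v j)) \<noteq> 0} \<subseteq> {i}" for i
    by (auto simp: mk_endo_v dual_scale eps_v)
  then have "?a \<in> rowfin" unfolding rowfin_def using finite_subset by blast
  moreover have "prj S \<circ>\<^sub>e ?a \<circ>\<^sub>e prj S = ?a"
    by (rule endo_v_ext) (auto simp: endo_comp.rep_eq relabel_v mk_endo_v endo_0 endo_scaleC f)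
  moreover have "dual_endo ?a (mk_dual (\<lambda>j. if j \<in> S then 1 else 0)) = f"
    by (rule dual_v_ext) (auto simp: dual_endo.rep_eq mk_endo_v mk_dual_v dual_scale f)
  ultimately show ?thesis by (auto simp: local_ops_def)
qed

text \<open>The rows indexed by \<open>J\<close> meet only finitely many columns, collected in
  \<open>?K\<close>, so the transpose of \<open>a\<close> preserves finite support.\<close>

lemma finite_at_act:
  assumes t: "finite_at s Dl t" and a: "a \<in> rowfin"
  shows "finite_at s Dl (slot s (cmp Dl a) t)"
proof -
  obtain J where J: "finite J" "slot s (cprj Dl J) t = t" using t unfolding finite_at_def by blast
  let ?K = "\<Union>i\<in>J. {j. dual_apply (eps i) (endo_apply a (v j)) \<noteq> 0}"
  have K: "finite ?K" using J(1) a by (auto simp: rowfin_def)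
  have "prj J \<circ>\<^sub>e a \<circ>\<^sub>e prj ?K = prj J \<circ>\<^sub>e a"
  proof (rule endo_v_ext)
    fix j
    have "endo_apply (prj J) (endo_apply a (v j)) = 0" if "j \<notin> ?K"
      using that J(1) by (simp add: prj_finite)
    then show "endo_apply (prj J \<circ>\<^sub>e a \<circ>\<^sub>e prj ?K) (v j) = endo_apply (prj J \<circ>\<^sub>e a) (v j)"
      by (simp add: endo_comp.rep_eq relabel_v endo_0)
  qed
  then have "cprj Dl ?K \<circ>\<^sub>e (cmp Dl a \<circ>\<^sub>e cprj Dl J) = cmp Dl a \<circ>\<^sub>e cprj Dl J"
    by (simp add: cprj_def cmp_Dl_Dl endo_comp_assoc[symmetric])
  then have "slot s (cprj Dl ?K) (slot s (cmp Dl a) (slot s (cprj Dl J) t)) = slot s (cmp Dl a) (slot s (cprj Dl J) t)"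
    by (simp only: slot_comp)
  then show ?thesis unfolding finite_at_def J(2) using K by blast
qed

lemma put_Dl_Box:
  assumes "dual_endo (prj (S s)) f = f" "\<tau> s = Dl" "s < d" "y \<in> Box d (\<tau>(s := Tr)) S"
  shows "slot s (put (f, 0, 0)) y \<in> Box d \<tau> S"
proof -
  have "cprj Dl (S s) \<circ>\<^sub>e put (f, 0, 0) = put (f, 0, 0)"
    using assms(1) by (simp add: cprj_def cmp_put cmp_apply)
  then have "slot s (put (f, 0, 0)) y \<in> Box d (\<tau>(s := Tr, s := Dl)) (S(s := S s))"
    by (intro Box_slot_update[OF assms(4,3)]) simp
  then show ?thesis using assms(2) by (simp add: fun_upd_idem)
qed

lemma cmp_Dl_Box:
  assumes "a \<in> local_ops (S s)" "\<tau> s = Dl" "s < d" "t \<in> Box d \<tau> S"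
  shows "slot s (cmp Dl a) t \<in> Box d \<tau> S"
  using slot_act_Box[OF assms(1,3,4)] slot_act_cmp(1)[OF assms(4,3,2), of a]
    cvs.subspace_neg[OF subspace_Box, of "slot s (act a) t" d \<tau> S] by simp

lemma slot_cmp_put_Dl:
  "slot s (cmp Dl a) (slot s (put (f, 0, 0)) y) = slot s (put (dual_endo a f, 0, 0)) y"
  by (simp add: slot_cmp_put cmp_apply)

lemma clinear_put_Dl: "clinear (\<lambda>f::'v dual. slot s (put (f, 0, 0)) y)"
proof -
  have *: "clinear (\<lambda>f::'v dual. (f, 0::'v, 0::complex))" by (simp add: clinear_iff scaleC_prod_def)
  show ?thesis
    by (rule clinear_compose[where f = "\<lambda>b. slot s b y" and g = "\<lambda>f. put (f, 0, 0)",
          OF clinear_slot_left clinear_compose[OF clinear_put *]])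
qed

section \<open>One dual slot: its part over \<open>V_*\<close> and the quotient by that part\<close>

context
  fixes d s :: nat and \<tau> :: "nat \<Rightarrow> kind" and S :: "nat \<Rightarrow> nat set"
  assumes s: "s < d" and k: "\<tau> s = Dl"
begin

abbreviation (input) "Box0 \<equiv> Box d (\<tau>(s := Tr)) S"

definition finite_part :: "'v ext tensor_algebra set" where
  "finite_part = {t \<in> Box d \<tau> S. finite_at s Dl t}"

text \<open>Tensors whose letters in slot \<open>s\<close> lie, modulo the span of the
  \<open>eps i\<close>, in the span of \<Phi>. The induction in \<open>slot_height_Dl\<close> runs
  over the finite set \<Phi>.\<close>

definition gen_part :: "'v dual set \<Rightarrow> 'v ext tensor_algebra set" where
  "gen_part \<Phi> = cvs.span (finite_part \<union> (\<Union>f\<in>\<Phi>. slot s (put (f, 0, 0)) ` Box0))"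

lemma subspace_finite_part: "cvs.subspace finite_part"
  unfolding finite_part_def using subspace_finite_at[of s Dl] subspace_Box[of d \<tau> S]
  by (intro subspace_collect_conj) simp_all

lemma cmp_Dl_finite_part: "a \<in> local_ops (S s) \<Longrightarrow> t \<in> finite_part \<Longrightarrow> slot s (cmp Dl a) t \<in> finite_part"
  using cmp_Dl_Box[of a S s \<tau> d t] finite_at_act[of s t a] s k local_opsD(3)[of a "S s"]
  by (simp add: finite_part_def)

lemma stable_finite_part: "stable (slot_ops d S) slot_act finite_part"
  unfolding stable_def
proof (intro conjI ballI subspace_finite_part)
  fix i t assume i: "i \<in> slot_ops d S" and t: "t \<in> finite_part"
  obtain s' a where sa: "i = (s', a)" "s' < d" "a \<in> local_ops (S s')"
    using i by (auto simp: slot_ops_def)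
  have tB: "t \<in> Box d \<tau> S" "finite_at s Dl t" using t by (auto simp: finite_part_def)
  show "slot_act i t \<in> finite_part"
  proof (cases "s' = s")
    case True
    have "slot s (act a) t = - slot s (cmp Dl a) t" by (rule slot_act_cmp(1)[OF tB(1) s k])
    then show ?thesis
      using cmp_Dl_finite_part[OF _ t, of a] sa True cvs.subspace_neg[OF subspace_finite_part] by (simp add: slot_act_def)
  next
    case False
    then show ?thesis
      using slot_act_Box[where \<tau> = \<tau> and S = S, OF sa(3,2) tB(1)] finite_at_other[OF _ tB(2), of s' "act a"]
      by (simp add: finite_part_def slot_act_def sa(1))
  qed
qed

lemma eps_finite_part: "i \<in> S s \<Longrightarrow> y \<in> Box0 \<Longrightarrow> slot s (put (eps i, 0, 0)) y \<in> finite_part"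
proof -
  assume i: "i \<in> S s" and y: "y \<in> Box0"
  have "dual_endo (prj (S s)) (eps i) = eps i"
    using i by (intro dual_v_ext) (auto simp: dual_endo.rep_eq relabel_v eps_v dual_0)
  then have "slot s (put (eps i, 0, 0)) y \<in> Box d \<tau> S" by (rule put_Dl_Box[OF _ k s y])
  moreover have "slot s (cprj Dl {i}) (slot s (put (eps i, 0, 0)) y) = slot s (put (eps i, 0, 0)) y"
  proof -
    have "dual_endo (prj {i}) (eps i) = eps i"
      by (intro dual_v_ext) (simp add: dual_endo.rep_eq relabel_v eps_v dual_0)
    then show ?thesis by (simp add: cprj_def slot_cmp_put_Dl)
  qed
  ultimately show ?thesis unfolding finite_part_def finite_at_def
    by (intro CollectI conjI exI[of _ "{i}"]) simp_all
qed

lemma gen_part_mono: "\<Phi> \<subseteq> \<Psi> \<Longrightarrow> gen_part \<Phi> \<subseteq> gen_part \<Psi>"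
  unfolding gen_part_def by (intro cvs.span_mono Un_mono UN_mono) simp_all

lemma finite_part_gen_part: "finite_part \<subseteq> gen_part \<Phi>"
  unfolding gen_part_def by (rule order_trans[OF _ cvs.span_superset]) blast

lemma Box_gen_part:
  assumes "t \<in> Box d \<tau> S"
  shows "\<exists>\<Phi>. finite \<Phi> \<and> (\<forall>f\<in>\<Phi>. dual_endo (prj (S s)) f = f) \<and> t \<in> gen_part \<Phi>"
proof -
  let ?P = "\<lambda>t. \<exists>\<Phi>. finite \<Phi> \<and> (\<forall>f\<in>\<Phi>. dual_endo (prj (S s)) f = f) \<and> t \<in> gen_part \<Phi>"
  have id: "clinear (\<lambda>t::'v ext tensor_algebra. t)" by (simp add: clinear_iff)
  have sub: "cvs.subspace (gen_part \<Phi>)" for \<Phi> by (simp add: gen_part_def)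
  have "t \<in> {t. ?P t}"
  proof (rule Box_map[OF id assms])
    show "cvs.subspace {t. ?P t}"
    proof (rule cvs.subspaceI)
      show "0 \<in> {t. ?P t}" using cvs.subspace_0[OF sub] by (intro CollectI exI[of _ "{}"]) simp
    next
      fix x y assume "x \<in> {t. ?P t}" "y \<in> {t. ?P t}"
      then obtain \<Phi> \<Psi> where *: "finite \<Phi>" "\<forall>f\<in>\<Phi>. dual_endo (prj (S s)) f = f" "x \<in> gen_part \<Phi>"
        "finite \<Psi>" "\<forall>f\<in>\<Psi>. dual_endo (prj (S s)) f = f" "y \<in> gen_part \<Psi>" by blast
      have "x + y \<in> gen_part (\<Phi> \<union> \<Psi>)"
        using *(3,6) gen_part_mono[of \<Phi> "\<Phi> \<union> \<Psi>"] gen_part_mono[of \<Psi> "\<Phi> \<union> \<Psi>"]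
        by (intro cvs.subspace_add[OF sub]) auto
      then show "x + y \<in> {t. ?P t}"
        using *(1,2,4,5) by (intro CollectI exI[of _ "\<Phi> \<union> \<Psi>"]) auto
    next
      fix c x assume "x \<in> {t. ?P t}"
      then show "c *\<^sub>C x \<in> {t. ?P t}" using cvs.subspace_scale[OF sub] by blast
    qed
  next
    fix u assume u: "length u = d" "\<forall>s<d. endo_apply (cprj (\<tau> s) (S s)) (u ! s) = u ! s"
    obtain f x z where fxz: "u ! s = (f, x, z)" by (cases "u ! s")
    have f: "u ! s = (f, 0, 0)" "dual_endo (prj (S s)) f = f"
      using u(2)[rule_format, OF s] k fxz by (auto simp: cprj_def cmp_apply)
    let ?u = "u[s := (0, 0, 1)]"
    have "tens ?u \<in> Box0"
      using u s by (intro tens_Box) (auto simp: nth_list_update cprj_def cmp_apply)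
    moreover have "tens u = slot s (put (f, 0, 0)) (tens ?u)"
      using u(1) s f(1) by (simp add: slot_tens put_apply) (metis list_update_id)
    ultimately have "tens u \<in> gen_part {f}" unfolding gen_part_def by (intro cvs.span_base) auto
    then show "tens u \<in> {t. ?P t}" using f(2) by (intro CollectI exI[of _ "{f}"]) simp
  qed
  then show ?thesis by simp
qed

lemma gen_part_insert:
  assumes "t \<in> gen_part (insert f \<Phi>)"
  obtains y r where "y \<in> Box0" "r \<in> gen_part \<Phi>" "t = slot s (put (f, 0, 0)) y + r"
proof -
  have sub: "cvs.span (slot s (put (f, 0, 0)) ` Box0) = slot s (put (f, 0, 0)) ` Box0"
    by (intro span_id subspace_image clinear_slot subspace_Box)
  have "finite_part \<union> (\<Union>g\<in>insert f \<Phi>. slot s (put (g, 0, 0)) ` Box0) =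
      slot s (put (f, 0, 0)) ` Box0 \<union> (finite_part \<union> (\<Union>g\<in>\<Phi>. slot s (put (g, 0, 0)) ` Box0))" by blast
  then have "gen_part (insert f \<Phi>) = {x + y | x y. x \<in> slot s (put (f, 0, 0)) ` Box0 \<and> y \<in> gen_part \<Phi>}"
    unfolding gen_part_def by (simp only: cvs.span_Un[of "slot s (put (f, 0, 0)) ` Box0"] sub)
  then show thesis using assms that by blast
qed

lemma gen_part_dependent:
  assumes f: "f \<in> cvs.span (\<Phi> \<union> range eps)" and \<Phi>: "\<And>g. g \<in> insert f \<Phi> \<Longrightarrow> dual_endo (prj (S s)) g = g"
  shows "gen_part (insert f \<Phi>) \<subseteq> gen_part \<Phi>"
proof -
  have mem: "slot s (put (f, 0, 0)) y \<in> gen_part \<Phi>" if y: "y \<in> Box0" for y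
  proof -
    \<comment> \<open>Applying \<open>prj (S s)\<close> leaves \<open>f\<close> unchanged and kills
      the \<open>eps i\<close> with i outside \<open>S s\<close>, so that only those covered by
      \<open>eps_finite_part\<close> remain.\<close>
    have "slot s (put (dual_endo (prj (S s)) f, 0, 0)) y \<in> gen_part \<Phi>"
      unfolding gen_part_def
    proof (rule span_map[OF clinear_compose[OF clinear_put_Dl clinear_dual_endo] f])
      fix g assume "g \<in> \<Phi> \<union> range eps"
      then have "slot s (put (dual_endo (prj (S s)) g, 0, 0)) y \<in> gen_part \<Phi>"
      proof
        assume g: "g \<in> \<Phi>"
        then have "dual_endo (prj (S s)) g = g" using \<Phi>[of g] by simp
        then show ?thesis unfolding gen_part_def using g y by (intro cvs.span_base) auto
      next
        assume "g \<in> range eps"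
        then obtain i where g: "g = eps i" by blast
        show ?thesis
        proof (cases "i \<in> S s")
          case True
          then have "dual_endo (prj (S s)) g = eps i"
            unfolding g by (intro dual_v_ext) (auto simp: dual_endo.rep_eq relabel_v eps_v dual_0)
          then show ?thesis using eps_finite_part[OF True y] finite_part_gen_part by auto
        next
          case False
          then have "dual_endo (prj (S s)) g = 0" unfolding g
            by (intro dual_v_ext) (auto simp: dual_endo.rep_eq relabel_v eps_v dual_0 zero_dual.rep_eq)
          then show ?thesis by (simp add: gen_part_def clinear_0D[OF clinear_put_Dl] cvs.span_zero)
        qed
      qed
      then show "slot s (put (dual_endo (prj (S s)) g, 0, 0)) y
          \<in> cvs.span (finite_part \<union> (\<Union>f\<in>\<Phi>. slot s (put (f, 0, 0)) ` Box0))" by (simp only: gen_part_def)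
    qed
    then show ?thesis using \<Phi>[of f] by simp
  qed
  show ?thesis
  proof
    fix t assume "t \<in> gen_part (insert f \<Phi>)"
    then obtain y r where "y \<in> Box0" "r \<in> gen_part \<Phi>" "t = slot s (put (f, 0, 0)) y + r" by (rule gen_part_insert)
    then show "t \<in> gen_part \<Phi>" using cvs.span_add[OF mem[unfolded gen_part_def], of y r] by (simp add: gen_part_def)
  qed
qed

lemma gen_part_annihilate:
  assumes "t \<in> gen_part \<Phi>" "a \<in> local_ops (S s)" "\<forall>g\<in>\<Phi>. dual_endo a g = 0"
  shows "slot s (cmp Dl a) t \<in> finite_part"
proof -
  have "slot s (cmp Dl a) t \<in> cvs.span finite_part"
  proof (rule span_map[OF clinear_slot assms(1)[unfolded gen_part_def]])
    fix x assume "x \<in> finite_part \<union> (\<Union>f\<in>\<Phi>. slot s (put (f, 0, 0)) ` Box0)"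
    then show "slot s (cmp Dl a) x \<in> cvs.span finite_part"
    proof
      assume "x \<in> finite_part"
      then show ?thesis by (intro cvs.span_base cmp_Dl_finite_part assms(2))
    next
      assume "x \<in> (\<Union>f\<in>\<Phi>. slot s (put (f, 0, 0)) ` Box0)"
      then obtain f y where "f \<in> \<Phi>" "x = slot s (put (f, 0, 0)) y" by blast
      then show ?thesis
        using assms(3) by (simp add: slot_cmp_put_Dl clinear_0D[OF clinear_put_Dl] cvs.span_zero)
    qed
  qed
  then show ?thesis by (simp add: span_id[OF subspace_finite_part])
qed

text \<open>
  A stable subspace is determined by its part that is finite in the slot \<open>s\<close>, and by its image modulo
  that part. The latter is detected on a single functional of infinite support: modulo \<open>V\<^sub>*\<close>, the
  row-finite operators move linearly independent functionals independently of each other.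
\<close>

lemma slot_height_Dl:
  assumes fh: "finite_height (subs (slot_ops d S) slot_act Box0)" and c: "c \<in> S s"
  shows "finite_height (subs (slot_ops d S) slot_act (Box d \<tau> S))"
proof -
  let ?one = "mk_dual (\<lambda>j. if j \<in> S s then 1 else 0)"
  let ?L = "subs (slot_ops d S) slot_act (Box d \<tau> S)"
  let ?\<phi> = "\<lambda>N. {y \<in> Box0. slot s (put (vec Dl c)) y \<in> N}"
  let ?\<psi> = "\<lambda>N. {y \<in> Box0. slot s (put (?one, 0, 0)) y \<in> cvs.span (N \<union> finite_part)}"
  have lin: "clinear (slot_act i)" for i by (cases i) (simp add: slot_act_def clinear_slot)
  show ?thesis
  proof (rule finite_height_detect[OF fh fh, where \<phi> = ?\<phi> and \<psi> = ?\<psi>])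
    fix N assume N: "N \<in> ?L"
    then have st: "stable (slot_ops d S) slot_act N" by (simp add: subs_def)
    show "?\<phi> N \<in> subs (slot_ops d S) slot_act Box0"
      using stable_put[OF s st] by (simp add: subs_def Collect_mono)
    have "stable (slot_ops d S) slot_act (cvs.span (\<Union>X\<in>{N, finite_part}. X))"
      by (rule stable_span[OF lin]) (use st stable_finite_part in auto)
    then show "?\<psi> N \<in> subs (slot_ops d S) slot_act Box0"
      using stable_put[OF s, of S "cvs.span (N \<union> finite_part)"] by (simp add: subs_def Collect_mono)
  next
    fix N N' :: "'v ext tensor_algebra set" assume le: "N \<subseteq> N'"
    then show "?\<phi> N \<subseteq> ?\<phi> N'" by blast
    have "cvs.span (N \<union> finite_part) \<subseteq> cvs.span (N' \<union> finite_part)" using le by (intro cvs.span_mono) blast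
    then show "?\<psi> N \<subseteq> ?\<psi> N'" by blast
  next
    fix N N' assume N: "N \<in> ?L" "N' \<in> ?L" "N \<subseteq> N'" and 1: "?\<phi> N = ?\<phi> N'" and 2: "?\<psi> N = ?\<psi> N'"
    have sub: "cvs.subspace N" "cvs.subspace N'" using N by (auto simp: subs_def stable_def)
    have spanN: "cvs.span (N \<union> finite_part) = {x + y | x y. x \<in> N \<and> y \<in> finite_part}"
      unfolding cvs.span_Un by (simp only: span_id[OF sub(1)] span_id[OF subspace_finite_part])
    \<comment> \<open>Induction on the functionals needed modulo the finite part; with none left,
      \<open>detect_finite_at\<close> applies.\<close>
    have key: "t \<in> N" if "finite \<Phi>" "\<And>g. g \<in> \<Phi> \<Longrightarrow> dual_endo (prj (S s)) g = g" "t \<in> N'" "t \<in> gen_part \<Phi>" for \<Phi> t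
      using that
    proof (induction \<Phi> arbitrary: t)
      case empty
      have "gen_part {} = finite_part" unfolding gen_part_def by (simp only: UN_empty Un_empty_right span_id[OF subspace_finite_part])
      then have "finite_at s Dl t" using empty by (simp add: finite_part_def)
      then show ?case using detect_finite_at[OF N(1,2) s k _ c 1 empty.prems(2)] by simp
    next
      case (insert f \<Phi>)
      show ?case
      proof (cases "f \<in> cvs.span (\<Phi> \<union> range eps)")
        case True
        have "t \<in> gen_part \<Phi>" using gen_part_dependent[OF True insert.prems(1)] insert.prems(3) by (rule subsetD)
        then show ?thesis using insert.IH insert.prems(1,2) by simp
      next
        case False
        obtain y r where t: "y \<in> Box0" "r \<in> gen_part \<Phi>" "t = slot s (put (f, 0, 0)) y + r"
          using insert.prems(3) by (rule gen_part_insert)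
        \<comment> \<open>\<open>a\<close> turns the letter \<open>f\<close> into the test
          functional and removes all letters in \<Phi>. Up to a finite part, \<open>t\<close>
          becomes a tensor with the test functional in slot \<open>s\<close>, and there
          \<open>N\<close> and \<open>N'\<close> agree modulo the finite part.\<close>
        obtain a where a: "a \<in> local_ops (S s)" "dual_endo a f = ?one" "\<forall>g\<in>\<Phi>. dual_endo a g = 0"
          using ex_local_density[OF insert.hyps(1) insert.prems(1) False] by blast
        have ta: "slot s (cmp Dl a) t \<in> N'"
          using slot_cmp_mem[OF N(2) insert.prems(2) s] k a(1) by simp
        have "slot s (cmp Dl a) t = slot s (put (?one, 0, 0)) y + slot s (cmp Dl a) r"
          by (simp add: t(3) slot_add slot_cmp_put_Dl a(2))
        then have "slot s (put (?one, 0, 0)) y = slot s (cmp Dl a) t - slot s (cmp Dl a) r" by simp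
        also have "\<dots> \<in> cvs.span (N' \<union> finite_part)"
          using ta gen_part_annihilate[OF t(2) a(1,3)] by (intro cvs.span_diff) (auto intro: cvs.span_base)
        finally have "slot s (put (?one, 0, 0)) y \<in> cvs.span (N \<union> finite_part)" using 2 t(1) by blast
        then obtain n u where nu: "n \<in> N" "u \<in> finite_part" "slot s (put (?one, 0, 0)) y = n + u"
          unfolding spanN by blast
        \<comment> \<open>\<open>b\<close> turns the test functional back into \<open>f\<close>.
          Subtracting the resulting element of \<open>N\<close> from \<open>t\<close> leaves a
          tensor generated by \<Phi> alone.\<close>
        obtain b where b: "b \<in> local_ops (S s)" "dual_endo b ?one = f"
          using ex_local_diagonal[of "S s" f] insert.prems(1)[of f] by blast
        have "slot s (put (f, 0, 0)) y = slot s (cmp Dl b) n + slot s (cmp Dl b) u"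
          using b(2) arg_cong[OF nu(3), of "slot s (cmp Dl b)"] by (simp add: slot_add slot_cmp_put_Dl)
        then have eq: "t = slot s (cmp Dl b) n + (slot s (cmp Dl b) u + r)" using t(3) by simp
        have bn: "slot s (cmp Dl b) n \<in> N"
          using slot_cmp_mem[OF N(1) nu(1) s] k b(1) by simp
        have rest: "slot s (cmp Dl b) u + r \<in> gen_part \<Phi>"
          unfolding gen_part_def
          using subsetD[OF finite_part_gen_part cmp_Dl_finite_part[OF b(1) nu(2)]] t(2) by (intro cvs.span_add) (simp_all add: gen_part_def)
        have "slot s (cmp Dl b) u + r \<in> N'"
          using cvs.subspace_diff[OF sub(2) insert.prems(2), of "slot s (cmp Dl b) n"] bn N(3) eq
          by auto
        then have "slot s (cmp Dl b) u + r \<in> N" using insert.IH[OF _ _ rest] insert.prems(1) by simp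
        then show ?thesis using eq cvs.subspace_add[OF sub(1) bn] by simp
      qed
    qed
    show "N' \<subseteq> N"
    proof
      fix t assume t: "t \<in> N'"
      then have "t \<in> Box d \<tau> S" using N(2) by (auto simp: subs_def)
      then obtain \<Phi> where "finite \<Phi>" "\<forall>f\<in>\<Phi>. dual_endo (prj (S s)) f = f" "t \<in> gen_part \<Phi>"
        using Box_gen_part by blast
      then show "t \<in> N" using key[of \<Phi> t] t by blast
    qed
  qed
qed

end

lemma finite_height_subs_line: "finite_height (subs G A (cvs.span {e}))"
proof -
  have "N' \<subseteq> N" if N: "N \<in> subs G A (cvs.span {e})" "N' \<in> subs G A (cvs.span {e})" "\<not> N \<subseteq> {0}" for N N'
  proof -
    have sub: "cvs.subspace N" "N \<subseteq> cvs.span {e}" "N' \<subseteq> cvs.span {e}"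
      using N by (auto simp: subs_def stable_def)
    obtain x where x: "x \<in> N" "x \<noteq> 0" using N(3) by blast
    obtain c where c: "x = c *\<^sub>C e" using x sub(2) cvs.span_singleton by blast
    then have "e = inverse c *\<^sub>C x" using x by auto
    then have "e \<in> N" using cvs.subspace_scale[OF sub(1) x(1)] by simp
    then have "cvs.span {e} \<subseteq> N" using cvs.span_minimal[OF _ sub(1), of "{e}"] by simp
    then show "N' \<subseteq> N" using sub(3) by (rule order_trans[rotated])
  qed
  then have "(if N \<subseteq> {0} then 0 else 1::nat) < (if N' \<subseteq> {0} then 0 else 1)"
    if "N \<in> subs G A (cvs.span {e})" "N' \<in> subs G A (cvs.span {e})" "N \<subset> N'" for N N'
    using that cvs.subspace_0[of N] by (auto simp: subs_def stable_def)
  then show ?thesis unfolding finite_height_def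
    by (intro exI[of _ "\<lambda>N. if N \<subseteq> {0} then 0 else 1"] exI[of _ 1]) simp
qed

lemma Box_Tr_line:
  assumes "\<forall>s<d. \<tau> s = Tr"
  shows "Box d \<tau> S \<subseteq> cvs.span {tens (replicate d (0, 0, 1))}"
proof
  let ?e = "tens (replicate d (0, 0, 1)) :: 'v ext tensor_algebra"
  fix t assume t: "t \<in> Box d \<tau> S"
  have id: "clinear (\<lambda>t::'v ext tensor_algebra. t)" by (simp add: clinear_iff)
  show "t \<in> cvs.span {?e}"
  proof (rule Box_map[OF id t cvs.subspace_span])
    fix u assume u: "length u = d" "\<forall>s<d. endo_apply (cprj (\<tau> s) (S s)) (u ! s) = u ! s"
    have z: "\<exists>z. u ! s = (0, 0, z)" if "s < d" for s
      using u(2)[rule_format, OF that] assms that by (cases "u ! s") (auto simp: cprj_def cmp_apply)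
    have "\<exists>c. tens u = c *\<^sub>C tens (replicate m (0, 0, 1) @ drop m u)" if "m \<le> d" for m
      using that
    proof (induction m)
      case 0
      show ?case by (intro exI[of _ 1]) simp
    next
      case (Suc m)
      then have m: "m < d" by simp
      obtain c where c: "tens u = c *\<^sub>C tens (replicate m (0, 0, 1) @ drop m u)" using Suc by auto
      obtain w where w: "u ! m = (0, 0, w)" using z m by blast
      let ?u = "replicate m (0, 0, 1) @ drop m u"
      have "replicate m (0, 0, 1) @ drop m u = ?u[m := w *\<^sub>C (0, 0, 1)]"
        using m u(1) w by (simp add: list_update_append Cons_nth_drop_Suc[symmetric] scaleC_prod_def scaleC_complex_def)
      then have "tens ?u = w *\<^sub>C tens (?u[m := (0, 0, 1)])"
        using clinear_scaleD[OF clinear_tens_update, of m ?u w "(0, 0, 1)"] m u(1) by simp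
      moreover have "?u[m := (0, 0, 1)] = replicate (Suc m) (0, 0, 1) @ drop (Suc m) u"
        using m u(1) by (simp add: list_update_append Cons_nth_drop_Suc[symmetric] replicate_app_Cons_same)
      ultimately show ?case using c by (intro exI[of _ "c * w"]) simp
    qed
    from this[of d] show "tens u \<in> cvs.span {?e}"
      using u(1) cvs.span_scale[OF cvs.span_base[of ?e "{?e}"]] by auto
  qed
qed

text \<open>The non-trivial slots are made trivial one at a time, at the price of at most doubling
  the rank bound, until a line is left.\<close>

lemma finite_height_slot_ops:
  assumes "\<And>s. s < d \<Longrightarrow> S s \<noteq> {}"
  shows "finite_height (subs (slot_ops d S) slot_act (Box d \<tau> S))"
proof (induction "card {s. s < d \<and> \<tau> s \<noteq> Tr}" arbitrary: \<tau>)
  case 0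
  then have "\<forall>s<d. \<tau> s = Tr" by auto
  then show ?case
    using finite_height_mono[OF finite_height_subs_line subs_mono[OF Box_Tr_line]] by blast
next
  case (Suc n)
  then obtain s where s: "s < d" "\<tau> s \<noteq> Tr"
    by (metis (mono_tags, lifting) card.empty empty_Collect_eq nat.distinct(1))
  obtain c where c: "c \<in> S s" using assms[OF s(1)] by blast
  have "{s'. s' < d \<and> (\<tau>(s := Tr)) s' \<noteq> Tr} = {s. s < d \<and> \<tau> s \<noteq> Tr} - {s}" by auto
  then have "n = card {s'. s' < d \<and> (\<tau>(s := Tr)) s' \<noteq> Tr}" using Suc(2) s by simp
  then have fh: "finite_height (subs (slot_ops d S) slot_act (Box d (\<tau>(s := Tr)) S))" by (rule Suc(1))
  show ?case
  proof (cases "\<tau> s")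
    case Dl
    then show ?thesis by (rule slot_height_Dl[OF s(1) _ fh c])
  next
    case Vc
    then show ?thesis by (rule slot_height_Vc[OF fh s(1) _ c])
  qed (use s in simp)
qed

end

section \<open>Contractions\<close>

context dual_bases
begin

definition der :: "nat \<Rightarrow> 'v endo \<Rightarrow> 'v ext tensor_algebra \<Rightarrow> 'v ext tensor_algebra" where
  "der d a t = (\<Sum>s<d. slot s (act a) t)"

definition contr :: "nat \<Rightarrow> nat \<Rightarrow> 'v ext tensor_algebra \<Rightarrow> 'v ext tensor_algebra" where
  "contr s s' = slot_pair (\<lambda>x y. dual_apply (fst x) (fst (snd y))) s s' (0, 0, 1) (0, 0, 1)"

text \<open>Refills two trivial slots with a fixed dual pair. Composed with \<open>contr\<close> it
  expresses the cross terms computed in \<open>contr_cross\<close>.\<close>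

definition ins :: "nat \<Rightarrow> nat \<Rightarrow> nat \<Rightarrow> 'v ext tensor_algebra \<Rightarrow> 'v ext tensor_algebra" where
  "ins w s s' = slot_pair (\<lambda>x y. snd (snd x) * snd (snd y)) s s' (eps w, 0, 0) (0, v w, 0)"

lemma clinear_der: "clinear (der d a)"
  unfolding der_def by (intro clinear_sum clinear_slot)

lemma der_tpow: "t \<in> tpow d \<Longrightarrow> der d a t \<in> tpow d"
  unfolding der_def by (intro cvs.subspace_sum[OF subspace_tpow] slot_tpow)

lemma contr_bilinear: "clinear (\<lambda>y::'v ext. dual_apply (fst x) (fst (snd y)))"
  "clinear (\<lambda>x::'v ext. dual_apply (fst x) (fst (snd y)))"
  by (simp_all add: clinear_iff scaleC_prod_def dual_add dual_scale plus_dual.rep_eq scaleC_dual.rep_eq)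
    (simp_all add: scaleC_complex_def)

lemma ins_bilinear: "clinear (\<lambda>y::'v ext. snd (snd x) * snd (snd y))"
  "clinear (\<lambda>x::'v ext. snd (snd x) * snd (snd y))"
  by (simp_all add: clinear_iff scaleC_prod_def algebra_simps) (simp_all add: scaleC_complex_def)

lemma clinear_contr: "s \<noteq> s' \<Longrightarrow> clinear (contr s s')"
  unfolding contr_def by (rule clinear_slot_pair[OF contr_bilinear])

lemma contr_tens: "s \<noteq> s' \<Longrightarrow> contr s s' (tens u) = (if s < length u \<and> s' < length u
     then dual_apply (fst (u ! s)) (fst (snd (u ! s'))) *\<^sub>C tens (u[s := (0, 0, 1), s' := (0, 0, 1)]) else 0)"
  unfolding contr_def by (rule slot_pair_tens[OF contr_bilinear])

lemma clinear_ins: "s \<noteq> s' \<Longrightarrow> clinear (ins w s s')"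
  unfolding ins_def by (rule clinear_slot_pair[OF ins_bilinear])

lemma ins_tens: "s \<noteq> s' \<Longrightarrow> ins w s s' (tens u) = (if s < length u \<and> s' < length u
     then (snd (snd (u ! s)) * snd (snd (u ! s'))) *\<^sub>C tens (u[s := (eps w, 0, 0), s' := (0, v w, 0)]) else 0)"
  unfolding ins_def by (rule slot_pair_tens[OF ins_bilinear])

lemma contr_slot_other:
  assumes "s \<noteq> s'" "k \<noteq> s" "k \<noteq> s'"
  shows "contr s s' (slot k b t) = slot k b (contr s s' t)"
proof (rule tens_ext[where f = "\<lambda>t. contr s s' (slot k b t)" and g = "\<lambda>t. slot k b (contr s s' t)"])
  show "clinear (\<lambda>t. contr s s' (slot k b t))" "clinear (\<lambda>t. slot k b (contr s s' t))"
    by (rule clinear_compose[OF clinear_contr[OF assms(1)] clinear_slot]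
        clinear_compose[OF clinear_slot clinear_contr[OF assms(1)]])+
  show "contr s s' (slot k b (tens u)) = slot k b (contr s s' (tens u))" for u
    using assms by (auto simp: slot_tens contr_tens slot_0 slot_scale clinear_0D[OF clinear_contr]
        list_update_swap[of k s] list_update_swap[of k s'])
qed

text \<open>The sign in the coadjoint action makes the two contributions cancel: this is invariance
  of the evaluation pairing.\<close>

lemma contr_invariant:
  assumes "s \<noteq> s'" "t \<in> tpow d" "s < d" "s' < d"
  shows "contr s s' (slot s (act a) t) + contr s s' (slot s' (act a) t) = 0"
proof (rule tpow_ext[where f = "\<lambda>t. contr s s' (slot s (act a) t) + contr s s' (slot s' (act a) t)"
      and g = "\<lambda>_. 0", OF _ _ assms(2)])
  have "clinear (\<lambda>t. contr s s' (slot k (act a) t))" for k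
    by (rule clinear_compose[OF clinear_contr[OF assms(1)] clinear_slot])
  then show "clinear (\<lambda>t. contr s s' (slot s (act a) t) + contr s s' (slot s' (act a) t))"
    by (simp add: clinear_iff cvs.scale_right_distrib)
  show "clinear (\<lambda>_::'v ext tensor_algebra. 0::'v ext tensor_algebra)" by (simp add: clinear_iff)
  fix u :: "'v ext list" assume u: "length u = d"
  obtain f x z f' x' z' where "u ! s = (f, x, z)" "u ! s' = (f', x', z')"
    by (metis prod.collapse)
  then show "contr s s' (slot s (act a) (tens u)) + contr s s' (slot s' (act a) (tens u)) = 0"
    using assms(1,3,4) u
    by (simp add: slot_tens contr_tens act_apply uminus_dual.rep_eq dual_endo.rep_eq list_update_swap[of s' s])
qed

text \<open>After a contraction both slots hold multiples of (0, 0, 1), so only the value of an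
  operator on this letter matters.\<close>

lemma slot_contr:
  assumes "s \<noteq> s'" "t \<in> tpow d" "s < d" "s' < d" "k \<in> {s, s'}"
    and eq: "endo_apply b (0, 0, 1) = endo_apply c (0, 0, 1)"
  shows "slot k b (contr s s' t) = slot k c (contr s s' t)"
proof (rule tpow_ext[where f = "\<lambda>t. slot k b (contr s s' t)" and g = "\<lambda>t. slot k c (contr s s' t)", OF _ _ assms(2)])
  show "clinear (\<lambda>t. slot k b (contr s s' t))" "clinear (\<lambda>t. slot k c (contr s s' t))"
    by (rule clinear_compose[OF clinear_slot clinear_contr[OF assms(1)]])+
  fix u :: "'v ext list" assume u: "length u = d"
  show "slot k b (contr s s' (tens u)) = slot k c (contr s s' (tens u))"
    using assms(1,3,4,5) u eq by (auto simp: contr_tens slot_scale slot_tens nth_list_update)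
qed

lemma act_contr:
  assumes "s \<noteq> s'" "t \<in> tpow d" "s < d" "s' < d" "k \<in> {s, s'}"
  shows "slot k (act a) (contr s s' t) = 0"
  using slot_contr[OF assms, of "act a" 0]
  by (simp add: act_apply dual_endo_0 endo_0 zero_endo.rep_eq zero_prod_def slot_0_left)

lemma contr_der:
  assumes "s \<noteq> s'" "t \<in> tpow d" "s < d" "s' < d"
  shows "contr s s' (der d a t) = der d a (contr s s' t)"
proof -
  let ?f = "\<lambda>k. contr s s' (slot k (act a) t) - slot k (act a) (contr s s' t)"
  have "(\<Sum>k<d. ?f k) = (\<Sum>k\<in>{s, s'}. ?f k)"
    using assms(3,4) contr_slot_other[OF assms(1)] by (intro sum.mono_neutral_right) auto
  also have "\<dots> = 0"
    using contr_invariant[OF assms] act_contr[OF assms] assms(1) by simp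
  finally show ?thesis
    by (simp add: der_def sum_subtractf clinear_sumD[OF clinear_contr[OF assms(1)]])
qed

lemma contr_tpow: "s \<noteq> s' \<Longrightarrow> t \<in> tpow d \<Longrightarrow> contr s s' t \<in> tpow d"
  by (rule tpow_map[OF clinear_contr _ subspace_tpow])
    (auto simp: contr_tens cvs.subspace_0[OF subspace_tpow]
      intro!: tens_tpow cvs.subspace_scale[OF subspace_tpow])

lemma contr_Box:
  assumes "s \<noteq> s'" "s < d" "s' < d" "t \<in> Box d \<tau> S"
  shows "contr s s' t \<in> Box d (\<tau>(s := Tr, s' := Tr)) S"
proof (rule BoxI)
  have t: "t \<in> tpow d" by (rule Box_tpow[OF assms(4)])
  show "contr s s' t \<in> tpow d" by (rule contr_tpow[OF assms(1) t])
  fix k assume k: "k < d"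
  show "slot k (cprj ((\<tau>(s := Tr, s' := Tr)) k) (S k)) (contr s s' t) = contr s s' t"
  proof (cases "k \<in> {s, s'}")
    case True
    \<comment> \<open>On (0, 0, 1) the projection to the trivial component agrees with the identity,
      written here as the sum of the three component projections.\<close>
    have "slot k (cprj Tr (S k)) (contr s s' t) = slot k (cmp Tr 0 + cmp Dl (prj UNIV) + cmp Vc (prj UNIV)) (contr s s' t)"
      by (rule slot_contr[OF assms(1) t assms(2,3) True])
        (simp add: cprj_def cmp_apply plus_endo.rep_eq dual_endo_0 endo_0)
    also have "cmp Tr 0 + cmp Dl (prj UNIV) + cmp Vc (prj UNIV) = (Endo (\<lambda>x. x) :: 'v ext endo)"
    proof (rule ext_endo_eqI)
      have "prj UNIV = Endo (\<lambda>x. x)"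
        by (rule endo_v_ext) (simp add: relabel_v Endo_inverse clinear_iff)
      then have "dual_endo (prj UNIV) f = f" "endo_apply (prj UNIV) x = x" for f x
        by (auto intro!: dual_eqI simp: dual_endo.rep_eq Endo_inverse clinear_iff)
      then show "endo_apply (cmp Tr 0 + cmp Dl (prj UNIV) + cmp Vc (prj UNIV)) (f, x, z) = endo_apply (Endo (\<lambda>x. x)) (f, x, z)"
        for f x z by (simp add: plus_endo.rep_eq cmp_apply Endo_inverse clinear_iff)
    qed
    also have "slot k (Endo (\<lambda>x. x)) (contr s s' t) = contr s s' t"
    proof (rule tpow_ext[where f = "slot k (Endo (\<lambda>x. x))" and g = "\<lambda>t. t", OF clinear_slot _ contr_tpow[OF assms(1) t]])
      show "clinear (\<lambda>t::'v ext tensor_algebra. t)" by (simp add: clinear_iff)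
      show "slot k (Endo (\<lambda>x. x)) (tens u) = tens u" if "length u = d" for u :: "'v ext list"
        using that k by (simp add: slot_tens Endo_inverse clinear_iff)
    qed
    finally show ?thesis using True by auto
  next
    case False
    then show ?thesis
      using contr_slot_other[OF assms(1), of k "cprj (\<tau> k) (S k)" t] Box_slot[OF assms(4) k] by simp
  qed
qed

text \<open>A functional supported on \<open>S s\<close> kills every vector supported on a disjoint
  index set.\<close>

lemma contr_disjoint:
  assumes "s \<noteq> s'" "t \<in> Box d \<tau> S" "s < d" "s' < d" "\<tau> s = Dl" "\<tau> s' = Vc" "S s \<inter> S s' = {}"
  shows "contr s s' t = 0"
proof -
  have "contr s s' t \<in> {0}"
  proof (rule Box_map[OF clinear_contr[OF assms(1)] assms(2) cvs.subspace_single_0])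
    fix u assume u: "length u = d" "\<forall>s<d. endo_apply (cprj (\<tau> s) (S s)) (u ! s) = u ! s"
    obtain f x z f' x' z' where fx: "u ! s = (f, x, z)" "u ! s' = (f', x', z')"
      by (metis prod.collapse)
    have "dual_endo (prj (S s)) f = f" "endo_apply (prj (S s')) x' = x'"
      using u(2)[rule_format, OF assms(3)] u(2)[rule_format, OF assms(4)] assms(5,6) fx
      by (auto simp: cprj_def cmp_apply)
    then have "dual_apply f x' = dual_apply f (endo_apply (prj (S s) \<circ>\<^sub>e prj (S s')) x')"
      by (metis dual_endo.rep_eq endo_comp.rep_eq)
    then have "dual_apply f x' = 0"
      using assms(7) by (simp add: prj_prj relabel_empty zero_endo.rep_eq dual_0)
    then show "contr s s' (tens u) \<in> {0}" using u(1) assms(1,3,4) fx by (simp add: contr_tens)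
  qed
  then show ?thesis by simp
qed

text \<open>On letters f and x the i-th term is minus f(v i) times the i-th coordinate of x, times
  the dual pair at \<open>w\<close>. Since x lies over the first \<open>r\<close> basis vectors,
  these coefficients add up to f(x), even when f has infinite support.\<close>

lemma contr_cross:
  assumes "s \<noteq> s'" "s < d" "s' < d" "t \<in> Box d \<tau> S" "\<tau> s = Dl" "\<tau> s' = Vc" "S s' = {..<r}"
  shows "(\<Sum>i<r. slot s' (act (relabel {i} (\<lambda>_. w))) (slot s (act (relabel {w} (\<lambda>_. i))) t)) =
    - ins w s s' (contr s s' t)"
proof -
  let ?f = "\<lambda>t. \<Sum>i<r. slot s' (act (relabel {i} (\<lambda>_. w))) (slot s (act (relabel {w} (\<lambda>_. i))) t)"
  let ?g = "\<lambda>t. ins w s s' (contr s s' t)"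
  have lin: "clinear (\<lambda>t. ?f t + ?g t)"
  proof -
    have 1: "clinear ?f" by (rule clinear_sum) (rule clinear_compose[OF clinear_slot clinear_slot])
    have 2: "clinear ?g" by (rule clinear_compose[OF clinear_ins[OF assms(1)] clinear_contr[OF assms(1)]])
    show ?thesis using 1 2 by (simp add: clinear_iff cvs.scale_right_distrib)
  qed
  have "?f t + ?g t \<in> {0}"
  proof (rule Box_map[OF lin assms(4) cvs.subspace_single_0])
    fix u assume u: "length u = d" "\<forall>s<d. endo_apply (cprj (\<tau> s) (S s)) (u ! s) = u ! s"
    obtain f x z f' x' z' where fx: "u ! s = (f, x, z)" "u ! s' = (f', x', z')"
      by (metis prod.collapse)
    have us: "u ! s = (f, 0, 0)" "u ! s' = (0, x', 0)" and x': "endo_apply (prj {..<r}) x' = x'"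
      using u(2)[rule_format, OF assms(2)] u(2)[rule_format, OF assms(3)] assms(5-7) fx
      by (auto simp: cprj_def cmp_apply)
    let ?e = "(eps w, 0, 0) :: 'v ext" and ?x = "(0, v w, 0) :: 'v ext"
    let ?T = "tens (u[s := ?e, s' := ?x])"
    have tm: "slot s' (act (relabel {i} (\<lambda>_. w))) (slot s (act (relabel {w} (\<lambda>_. i))) (tens u))
        = (- (dual_apply f (v i) * dual_apply (eps i) x')) *\<^sub>C ?T" for i
    proof -
      have 1: "endo_apply (act (relabel {w} (\<lambda>_. i))) (u ! s) = (- dual_apply f (v i)) *\<^sub>C ?e"
        by (simp add: us act_apply dual_endo_relabel_single endo_0 scaleC_prod_def)
      have 2: "endo_apply (act (relabel {i} (\<lambda>_. w))) (u ! s') = dual_apply (eps i) x' *\<^sub>C ?x"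
        by (simp add: us act_apply relabel_single dual_endo_0 scaleC_prod_def)
      have "slot s' (act (relabel {i} (\<lambda>_. w))) (slot s (act (relabel {w} (\<lambda>_. i))) (tens u))
        = tens (u[s := (- dual_apply f (v i)) *\<^sub>C ?e, s' := dual_apply (eps i) x' *\<^sub>C ?x])"
        using u(1) assms(1-3) by (simp add: slot_tens 1 2 del: cvs.scale_minus_left)
      also have "\<dots> = dual_apply (eps i) x' *\<^sub>C tens (u[s := (- dual_apply f (v i)) *\<^sub>C ?e, s' := ?x])"
        using u(1) assms(3) by (intro clinear_scaleD[OF clinear_tens_update]) simp
      also have "u[s := (- dual_apply f (v i)) *\<^sub>C ?e, s' := ?x] = u[s' := ?x, s := (- dual_apply f (v i)) *\<^sub>C ?e]"
        by (rule list_update_swap[OF assms(1)])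
      also have "tens \<dots> = (- dual_apply f (v i)) *\<^sub>C tens (u[s' := ?x, s := ?e])"
        using u(1) assms(2) by (intro clinear_scaleD[OF clinear_tens_update]) simp
      also have "u[s' := ?x, s := ?e] = u[s := ?e, s' := ?x]"
        by (rule list_update_swap[OF assms(1)[symmetric]])
      finally show ?thesis by (simp add: mult.commute)
    qed
    have "dual_apply f x' = dual_apply f (\<Sum>i<r. dual_apply (eps i) x' *\<^sub>C v i)"
      using x' by (simp add: prj_finite)
    then have fx': "dual_apply f x' = (\<Sum>i<r. dual_apply f (v i) * dual_apply (eps i) x')"
      by (simp add: clinear_sumD[OF clinear_dual_apply] dual_scale mult.commute)
    have "?f (tens u) = (- dual_apply f x') *\<^sub>C ?T"
      by (simp only: tm fx' cvs.scale_sum_left[symmetric] sum_negf)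
    moreover have "?g (tens u) = dual_apply f x' *\<^sub>C ?T"
      using u(1) assms(1-3) us
      by (simp add: contr_tens clinear_scaleD[OF clinear_ins] ins_tens list_update_swap[of s' s])
    ultimately show "?f (tens u) + ?g (tens u) \<in> {0}" by simp
  qed
  then show ?thesis by (simp add: eq_neg_iff_add_eq_0)
qed

end

section \<open>Detecting submodules on multilinear weight spaces\<close>

context dual_bases
begin

text \<open>
  The basis vectors below \<open>r\<close> form the block labelled \<open>Suc d\<close>; the others are distributed over
  \<open>Suc d\<close> infinite blocks, one more than there are slots.
\<close>

definition block :: "nat \<Rightarrow> nat \<Rightarrow> nat \<Rightarrow> nat set" where
  "block d r l = {i. (if i < r then Suc d else i mod Suc d) = l}"

definition nt :: "nat \<Rightarrow> (nat \<Rightarrow> kind) \<Rightarrow> nat set" where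
  "nt d \<tau> = {s. s < d \<and> \<tau> s \<noteq> Tr}"

text \<open>The derivation action does not distinguish slots of the same kind; it sees how often
  each block occurs among the letters of each kind. Hence a multiset, with the trivial slots left
  out.\<close>

definition profile :: "nat \<Rightarrow> (nat \<Rightarrow> kind) \<Rightarrow> (nat \<Rightarrow> nat) \<Rightarrow> (kind \<times> nat) multiset" where
  "profile d \<tau> \<mu> = image_mset (\<lambda>s. (\<tau> s, \<mu> s)) (mset_set (nt d \<tau>))"

definition profile_space :: "nat \<Rightarrow> nat \<Rightarrow> (nat \<Rightarrow> kind) \<Rightarrow> (kind \<times> nat) multiset \<Rightarrow> 'v ext tensor_algebra set" where
  "profile_space d r \<tau> Q = cvs.span (\<Union>\<mu>\<in>{\<mu>. profile d \<tau> \<mu> = Q}. Box d \<tau> (\<lambda>s. block d r (\<mu> s)))"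

lemma block_disjoint: "l \<noteq> l' \<Longrightarrow> block d r l \<inter> block d r l' = {}"
  by (auto simp: block_def)

lemma block_fin: "block d r (Suc d) = {..<r}"
proof -
  have "i mod Suc d \<noteq> Suc d" for i using mod_less_divisor[of "Suc d" i] by linarith
  then show ?thesis by (auto simp: block_def)
qed

lemma infinite_block:
  assumes "l \<le> d" shows "infinite (block d r l)"
proof
  assume fin: "finite (block d r l)"
  \<comment> \<open>The shift by \<open>r\<close> lifts these members of the residue class above the
    finite block.\<close>
  have "range (\<lambda>k. Suc d * (k + r) + l) \<subseteq> block d r l"
  proof
    fix i assume "i \<in> range (\<lambda>k. Suc d * (k + r) + l)"
    then obtain k where i: "i = Suc d * (k + r) + l" by blast
    have "r \<le> i" unfolding i by (simp add: trans_le_add1)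
    moreover have "(l + Suc d * (k + r)) mod Suc d = l mod Suc d" by (rule mod_mult_self2)
    then have "i mod Suc d = l" unfolding i add.commute[of _ l] using assms by simp
    ultimately show "i \<in> block d r l" by (simp add: block_def)
  qed
  moreover have "inj (\<lambda>k. Suc d * (k + r) + l)"
  proof (rule injI)
    fix x y assume "Suc d * (x + r) + l = Suc d * (y + r) + l"
    then have "Suc d * (x + r) = Suc d * (y + r)" by simp
    then show "x = y" by (metis Suc_mult_cancel1 add_right_cancel)
  qed
  ultimately show False using fin finite_subset finite_imageD infinite_UNIV_nat by blast
qed

lemma finite_nt: "finite (nt d \<tau>)"
  by (simp add: nt_def)

lemma set_profile: "set_mset (profile d \<tau> \<mu>) = (\<lambda>s. (\<tau> s, \<mu> s)) ` nt d \<tau>"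
  by (simp add: profile_def finite_nt)

lemma count_profile: "count (profile d \<tau> \<mu>) x = card {s \<in> nt d \<tau>. (\<tau> s, \<mu> s) = x}"
proof -
  have "(\<lambda>s. (\<tau> s, \<mu> s)) -` {x} \<inter> nt d \<tau> = {s \<in> nt d \<tau>. (\<tau> s, \<mu> s) = x}" by auto
  then show ?thesis by (simp add: profile_def count_image_mset finite_nt)
qed

lemma profile_update:
  assumes "s \<in> nt d \<tau>"
  shows "profile d \<tau> (\<mu>(s := b)) = add_mset (\<tau> s, b) (profile d \<tau> \<mu> - {#(\<tau> s, \<mu> s)#})"
proof -
  have "mset_set (nt d \<tau>) = add_mset s (mset_set (nt d \<tau> - {s}))"
    by (rule mset_set.remove[OF finite_nt assms])
  moreover have "image_mset (\<lambda>s'. (\<tau> s', (\<mu>(s := b)) s')) (mset_set (nt d \<tau> - {s})) =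
      image_mset (\<lambda>s. (\<tau> s, \<mu> s)) (mset_set (nt d \<tau> - {s}))"
    by (rule image_mset_cong) (use finite_nt in auto)
  ultimately show ?thesis by (simp add: profile_def)
qed

text \<open>On vectors a relabelling reads the indices in its domain \<open>A\<close>; on
  functionals, where it acts through its transpose, it reads the indices in its range.\<close>

lemma relabel_slot_zero:
  assumes "t \<in> Box d \<tau> S" "s < d"
    and "\<tau> s = Dl \<Longrightarrow> m ` A \<inter> S s = {}" "\<tau> s = Vc \<Longrightarrow> A \<inter> S s = {}"
  shows "slot s (act (relabel A m)) t = 0"
proof (rule slot_zero_on_Box[OF assms(1,2)])
  show "act (relabel A m) \<circ>\<^sub>e cprj (\<tau> s) (S s) = 0"
  proof (cases "\<tau> s")
    case Dl
    have "{j \<in> A. m j \<in> S s} = {}" using assms(3)[OF Dl] by auto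
    then show ?thesis using Dl cmp_0[of Dl] by (simp only: cprj_def act_cmp_Dl relabel_comp relabel_empty) simp
  next
    case Vc
    have "{j \<in> S s. j \<in> A} = {}" using assms(4)[OF Vc] by auto
    then show ?thesis using Vc cmp_0[of Vc] by (simp only: cprj_def act_cmp_Vc relabel_comp relabel_empty) simp
  qed (simp add: cprj_def act_cmp_Tr)
qed

lemma relabel_slot_Box:
  assumes t: "t \<in> Box d \<tau> (\<lambda>s. block d r (\<mu> s))" and s: "s < d" "\<tau> s \<noteq> Tr"
    and "\<tau> s = Dl \<Longrightarrow> A \<subseteq> block d r b" "\<tau> s = Vc \<Longrightarrow> m ` A \<subseteq> block d r b"
  shows "slot s (act (relabel A m)) t \<in> Box d \<tau> (\<lambda>s'. block d r ((\<mu>(s := b)) s'))"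
proof -
  have "cprj (\<tau> s) (block d r b) \<circ>\<^sub>e act (relabel A m) \<circ>\<^sub>e cprj (\<tau> s) (block d r (\<mu> s)) =
      act (relabel A m) \<circ>\<^sub>e cprj (\<tau> s) (block d r (\<mu> s))"
  proof (cases "\<tau> s")
    case Dl
    have "{j \<in> block d r b. j \<in> A} = A" using assms(4)[OF Dl] by auto
    then have "relabel A m \<circ>\<^sub>e prj (block d r b) = relabel A m"
      unfolding relabel_comp by (intro relabel_cong) auto
    then show ?thesis using Dl
      by (simp add: cprj_def act_cmp_Dl cmp_act_Dl endo_comp_neg cmp_Dl_Dl endo_comp_assoc)
  next
    case Vc
    have "prj (block d r b) \<circ>\<^sub>e relabel A m = relabel A m"
      unfolding relabel_comp using assms(5)[OF Vc] by (intro relabel_cong) auto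
    then show ?thesis using Vc
      by (simp add: cprj_def act_cmp_Vc cmp_act_Vc cmp_Vc_Vc endo_comp_assoc[symmetric])
  qed (use s in simp)
  from Box_slot_update[OF t s(1) this]
  have "slot s (act (relabel A m)) t \<in> Box d (\<tau>(s := \<tau> s)) ((\<lambda>s. block d r (\<mu> s))(s := block d r b))" .
  moreover have "(\<lambda>s. block d r (\<mu> s))(s := block d r b) = (\<lambda>s'. block d r ((\<mu>(s := b)) s'))"
    by (rule ext) simp
  ultimately show ?thesis by (simp only: fun_upd_triv)
qed

lemma profile_space_base: "t \<in> Box d \<tau> (\<lambda>s. block d r (\<mu> s)) \<Longrightarrow> profile d \<tau> \<mu> = Q \<Longrightarrow> t \<in> profile_space d r \<tau> Q"
  unfolding profile_space_def by (rule cvs.span_base) blast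

lemma profile_space_map:
  assumes "clinear f" "t \<in> profile_space d r \<tau> Q" "cvs.subspace N"
    "\<And>\<mu> t. profile d \<tau> \<mu> = Q \<Longrightarrow> t \<in> Box d \<tau> (\<lambda>s. block d r (\<mu> s)) \<Longrightarrow> f t \<in> N"
  shows "f t \<in> N"
  using span_map[OF assms(1) assms(2)[unfolded profile_space_def], of N] assms(4) span_id[OF assms(3)] by auto

lemma profile_space_eq:
  assumes "clinear f" "clinear g" "t \<in> profile_space d r \<tau> Q"
    "\<And>\<mu> t. profile d \<tau> \<mu> = Q \<Longrightarrow> t \<in> Box d \<tau> (\<lambda>s. block d r (\<mu> s)) \<Longrightarrow> f t = g t"
  shows "f t = g t"
  by (rule span_eq_on[OF assms(1,2) assms(3)[unfolded profile_space_def]]) (use assms(4) in auto)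

lemma der_profile_space:
  assumes t: "t \<in> profile_space d r \<tau> Q"
    and *: "\<And>\<mu> t s. profile d \<tau> \<mu> = Q \<Longrightarrow> t \<in> Box d \<tau> (\<lambda>s. block d r (\<mu> s)) \<Longrightarrow> s < d \<Longrightarrow>
      slot s (act x) t = 0 \<or> (\<tau> s = q \<and> \<mu> s = a \<and> slot s (act x) t \<in> Box d \<tau> (\<lambda>s'. block d r ((\<mu>(s := b)) s')))"
    and q: "q \<noteq> Tr"
  shows "der d x t \<in> profile_space d r \<tau> (add_mset (q, b) (Q - {#(q, a)#}))"
proof (rule profile_space_map[OF clinear_der t])
  show sub: "cvs.subspace (profile_space d r \<tau> (add_mset (q, b) (Q - {#(q, a)#})))" by (simp add: profile_space_def)
  fix \<mu> t assume \<mu>: "profile d \<tau> \<mu> = Q" and t: "t \<in> Box d \<tau> (\<lambda>s. block d r (\<mu> s))"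
  show "der d x t \<in> profile_space d r \<tau> (add_mset (q, b) (Q - {#(q, a)#}))"
    unfolding der_def
  proof (rule cvs.subspace_sum[OF sub])
    fix s assume "s \<in> {..<d}"
    then have s: "s < d" by simp
    from *[OF \<mu> t s] show "slot s (act x) t \<in> profile_space d r \<tau> (add_mset (q, b) (Q - {#(q, a)#}))"
    proof
      assume "slot s (act x) t = 0"
      then show ?thesis using cvs.subspace_0[OF sub] by simp
    next
      assume h: "\<tau> s = q \<and> \<mu> s = a \<and> slot s (act x) t \<in> Box d \<tau> (\<lambda>s'. block d r ((\<mu>(s := b)) s'))"
      then have "s \<in> nt d \<tau>" using s q by (simp add: nt_def)
      from profile_update[OF this, of \<mu> b] show ?thesis using h \<mu> by (intro profile_space_base) auto
    qed
  qed
qed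

lemma sum_const_scale: "(\<Sum>s\<in>A. t) = of_nat (card A) *\<^sub>C t" for t :: "'a::complex_vector"
  using cvs.scale_sum_left[of "\<lambda>_. 1" A t] by simp

lemma move_block:
  assumes t: "t \<in> profile_space d r \<tau> Q" and a: "(q, a) \<in># Q" "\<And>k. (k, a) \<in># Q \<Longrightarrow> k = q" and q: "q \<noteq> Tr"
    and b: "b \<le> d" "b \<notin> snd ` set_mset Q"
  shows "\<exists>x\<in>rowfin. \<exists>y\<in>rowfin. der d x t \<in> profile_space d r \<tau> (add_mset (q, b) (Q - {#(q, a)#})) \<and>
    der d y (der d x t) = of_nat (count Q (q, a)) *\<^sub>C t"
proof -
  let ?a = "block d r a" and ?b = "block d r b"
  \<comment> \<open>Any injection into the infinite block \<open>b\<close> will do; its restriction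
    to block \<open>a\<close> and the inverse of that restriction are the two movements.\<close>
  obtain m :: "nat \<Rightarrow> nat" where m: "inj m" "range m \<subseteq> ?b"
    using infinite_countable_subset[OF infinite_block[OF b(1)]] by blast
  have ab: "a \<noteq> b" using a b by (metis image_eqI snd_conv)
  have ma: "m ` ?a \<subseteq> ?b" using m by blast
  let ?f = "relabel ?a m" and ?g = "relabel (m ` ?a) (inv m)"
  have gm: "inv m ` m ` ?a = ?a" using m(1) by (simp add: image_image)
  have gf: "?g \<circ>\<^sub>e ?f = prj ?a"
    unfolding relabel_comp using m(1) by (intro relabel_cong) auto
  have "m ` ?a \<subseteq> range m" by (rule image_mono) simp
  then have rf: "?f \<in> rowfin" "?g \<in> rowfin"
    by (intro relabel_rowfin inj_on_subset[OF m(1) subset_UNIV] inj_on_inv_into; assumption)+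
  have lab: "\<mu> s \<noteq> b" "\<mu> s = a \<Longrightarrow> \<tau> s = q" if "profile d \<tau> \<mu> = Q" "s < d" "\<tau> s \<noteq> Tr" for \<mu> s
  proof -
    have Q: "(\<tau> s, \<mu> s) \<in># Q" using that set_profile[of d \<tau> \<mu>] by (auto simp: nt_def)
    show "\<mu> s \<noteq> b" using b(2) imageI[OF Q, of snd] by auto
    show "\<tau> s = q" if "\<mu> s = a" using a(2)[of "\<tau> s"] Q that by simp
  qed
  have zero: "slot s (act ?f) t = 0" "slot s (act ?g) t = 0"
    if "t \<in> Box d \<tau> (\<lambda>s. block d r (\<mu> s))" "s < d" "\<tau> s \<noteq> Tr \<Longrightarrow> \<mu> s \<noteq> a \<and> \<mu> s \<noteq> b" for \<mu> s t
  proof -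
    have "\<tau> s \<noteq> Tr \<Longrightarrow> ?a \<inter> block d r (\<mu> s) = {} \<and> ?b \<inter> block d r (\<mu> s) = {}"
      using block_disjoint that(3) by metis
    then have *: "?a \<inter> block d r (\<mu> s) = {}" "m ` ?a \<inter> block d r (\<mu> s) = {}" if "\<tau> s \<noteq> Tr"
      using that ma by auto
    show "slot s (act ?f) t = 0"
      by (rule relabel_slot_zero[OF that(1,2)]) (use * in auto)
    show "slot s (act ?g) t = 0"
      by (rule relabel_slot_zero[OF that(1,2)]) (use * gm in auto)
  qed
  \<comment> \<open>Functionals are moved by transposes, so the two maps exchange their roles for
    dual letters.\<close>
  define x y where "x = (if q = Vc then ?f else ?g)" and "y = (if q = Vc then ?g else ?f)"
  have xy: "x \<in> rowfin" "y \<in> rowfin" using rf by (auto simp: x_def y_def)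
  have zero_xy: "slot s (act x) t = 0" "slot s (act y) t = 0"
    if "t \<in> Box d \<tau> (\<lambda>s. block d r (\<mu> s))" "s < d" "\<tau> s \<noteq> Tr \<Longrightarrow> \<mu> s \<noteq> a \<and> \<mu> s \<noteq> b" for \<mu> s t
    using zero[OF that] by (auto simp: x_def y_def)
  have dis: "m ` ?a \<inter> ?a = {}" using block_disjoint[OF ab, of d r] ma by auto
  have y_a: "slot s (act y) t = 0"
    if "t \<in> Box d \<tau> (\<lambda>s. block d r (\<mu> s))" "s < d" "\<tau> s = q" "\<mu> s = a" for \<mu> s t
  proof (cases "q = Vc")
    case True
    have "slot s (act ?g) t = 0"
      by (rule relabel_slot_zero[OF that(1,2)]) (use True that(3,4) dis in auto)
    then show ?thesis using True by (simp add: y_def)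
  next
    case False
    have "slot s (act ?f) t = 0"
      by (rule relabel_slot_zero[OF that(1,2)]) (use False that(3,4) dis in auto)
    then show ?thesis using False by (simp add: y_def)
  qed
  have x_a: "slot s (act x) t \<in> Box d \<tau> (\<lambda>s'. block d r ((\<mu>(s := b)) s'))"
    if "t \<in> Box d \<tau> (\<lambda>s. block d r (\<mu> s))" "s < d" "\<tau> s = q" "\<mu> s = a" for \<mu> s t
  proof (cases "q = Vc")
    case True
    have "slot s (act ?f) t \<in> Box d \<tau> (\<lambda>s'. block d r ((\<mu>(s := b)) s'))"
      by (rule relabel_slot_Box[OF that(1,2)]) (use True that(3) q ma in auto)
    then show ?thesis using True by (simp add: x_def)
  next
    case False
    have "slot s (act ?g) t \<in> Box d \<tau> (\<lambda>s'. block d r ((\<mu>(s := b)) s'))"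
      by (rule relabel_slot_Box[OF that(1,2)]) (use False that(3) q ma in auto)
    then show ?thesis using False by (simp add: x_def)
  qed
  have yx: "slot s (act y) (slot s (act x) t) = t"
    if t: "t \<in> Box d \<tau> (\<lambda>s. block d r (\<mu> s))" "s < d" "\<tau> s = q" "\<mu> s = a" for \<mu> s t
  proof -
    have "act y \<circ>\<^sub>e act x \<circ>\<^sub>e cprj q ?a = cprj q ?a"
    proof (cases q)
      case Dl
      then show ?thesis
        by (simp add: x_def y_def cprj_def endo_comp_assoc act_cmp_Dl endo_comp_neg gf prj_prj)
    next
      case Vc
      have "?g \<circ>\<^sub>e (?f \<circ>\<^sub>e prj ?a) = prj ?a"
        by (simp add: endo_comp_assoc[symmetric] gf prj_prj)
      then show ?thesis using Vc by (simp add: x_def y_def cprj_def endo_comp_assoc act_cmp_Vc)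
    qed (use q in simp)
    then have "slot s (act y \<circ>\<^sub>e act x) (slot s (cprj q ?a) t) = slot s (cprj q ?a) t"
      by (simp only: slot_comp)
    moreover have "slot s (cprj q ?a) t = t" using Box_slot[OF t(1,2)] t(3,4) by simp
    ultimately show ?thesis by (simp only: slot_comp)
  qed
  have "der d x t \<in> profile_space d r \<tau> (add_mset (q, b) (Q - {#(q, a)#}))"
  proof (rule der_profile_space[OF t _ q])
    fix \<mu> t s assume h: "profile d \<tau> \<mu> = Q" "t \<in> Box d \<tau> (\<lambda>s. block d r (\<mu> s))" "s < d"
    show "slot s (act x) t = 0 \<or> (\<tau> s = q \<and> \<mu> s = a \<and> slot s (act x) t \<in> Box d \<tau> (\<lambda>s'. block d r ((\<mu>(s := b)) s')))"
    proof (cases "\<tau> s \<noteq> Tr \<and> \<mu> s = a")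
      case True
      then show ?thesis using x_a[OF h(2,3)] lab(2)[OF h(1,3)] by simp
    next
      case False
      then show ?thesis using zero_xy(1)[OF h(2,3)] lab(1)[OF h(1,3)] by auto
    qed
  qed
  moreover have "der d y (der d x t) = of_nat (count Q (q, a)) *\<^sub>C t"
  proof (rule profile_space_eq[OF clinear_compose[OF clinear_der clinear_der] _ t])
    show "clinear (\<lambda>t::'v ext tensor_algebra. of_nat (count Q (q, a)) *\<^sub>C t)"
      by (rule clinear_scale) (simp add: clinear_iff)
    fix \<mu> t assume \<mu>: "profile d \<tau> \<mu> = Q" and t: "t \<in> Box d \<tau> (\<lambda>s. block d r (\<mu> s))"
    let ?A = "{s \<in> nt d \<tau>. (\<tau> s, \<mu> s) = (q, a)}"
    have one: "der d y (slot s (act x) t) = t" if s: "s \<in> ?A" for s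
    proof -
      have s': "s < d" "\<tau> s = q" "\<mu> s = a" using s by (auto simp: nt_def)
      have "slot s' (act y) (slot s (act x) t) = 0" if s'': "s' < d" "s' \<noteq> s" for s'
      proof -
        have "slot s' (act y) t = 0"
        proof (cases "\<tau> s' \<noteq> Tr \<and> \<mu> s' = a")
          case True
          then show ?thesis using y_a[OF t s''(1)] lab(2)[OF \<mu> s''(1)] by simp
        next
          case False
          then show ?thesis using zero_xy(2)[OF t s''(1)] lab(1)[OF \<mu> s''(1)] by auto
        qed
        then show ?thesis by (simp add: slot_commute[OF s''(2)] slot_0)
      qed
      then have "der d y (slot s (act x) t) = (\<Sum>s'<d. if s' = s then t else 0)"
        unfolding der_def using yx[OF t s'] by (intro sum.cong) auto
      then show ?thesis using s'(1) by simp
    qed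
    have "slot s (act x) t = 0" if "s < d" "s \<notin> ?A" for s
      using zero_xy(1)[OF t that(1)] lab[OF \<mu> that(1)] that by (auto simp: nt_def)
    then have "der d x t = (\<Sum>s\<in>?A. slot s (act x) t)"
      unfolding der_def by (intro sum.mono_neutral_right) (auto simp: nt_def)
    then have "der d y (der d x t) = (\<Sum>s\<in>?A. der d y (slot s (act x) t))"
      by (simp only: clinear_sumD[OF clinear_der])
    also have "\<dots> = (\<Sum>s\<in>?A. t)" by (rule sum.cong[OF refl one])
    also have "\<dots> = of_nat (count Q (q, a)) *\<^sub>C t"
      unfolding sum_const_scale \<mu>[symmetric] count_profile ..
    finally show "der d y (der d x t) = of_nat (count Q (q, a)) *\<^sub>C t" .
  qed
  ultimately show ?thesis using xy by blast
qed

text \<open>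
  The Casimir-type sum below acts on a letter of \<open>V\<^sup>*\<close> in the finite block as the identity; its cross
  terms with the letters of \<open>V\<close> are contractions followed by an insertion.
\<close>

lemma move_finite_block:
  assumes t: "t \<in> profile_space d r \<tau> Q"
    and inv: "\<And>l. l \<noteq> Suc d \<Longrightarrow> \<not> ((Dl, l) \<in># Q \<and> (Vc, l) \<in># Q)"
    and b: "b \<le> d" "b \<notin> snd ` set_mset Q"
    and traceless: "\<And>s s'. s < d \<Longrightarrow> s' < d \<Longrightarrow> \<tau> s = Dl \<Longrightarrow> \<tau> s' = Vc \<Longrightarrow> contr s s' t = 0"
  shows "\<exists>x y. (\<forall>i. x i \<in> rowfin \<and> y i \<in> rowfin) \<and>
    (\<forall>i<r. der d (x i) t \<in> profile_space d r \<tau> (add_mset (Dl, b) (Q - {#(Dl, Suc d)#}))) \<and>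
    (\<Sum>i<r. der d (y i) (der d (x i) t)) = of_nat (count Q (Dl, Suc d)) *\<^sub>C t"
proof -
  let ?b = "block d r b"
  obtain w where w: "w \<in> ?b" using infinite_block[OF b(1), of r] by (metis finite.emptyI ex_in_conv)
  have lab: "\<mu> s \<noteq> b" if "profile d \<tau> \<mu> = Q" "s < d" "\<tau> s \<noteq> Tr" for \<mu> s
  proof -
    have "(\<tau> s, \<mu> s) \<in># Q" using that set_profile[of d \<tau> \<mu>] by (auto simp: nt_def)
    then show "\<mu> s \<noteq> b" using b(2) by force
  qed
  have w_lab: "w \<notin> block d r (\<mu> s)" if "profile d \<tau> \<mu> = Q" "s < d" "\<tau> s \<noteq> Tr" for \<mu> s
    using block_disjoint[OF lab[OF that], of d r] w by blast
  have i_lab: "i \<notin> block d r l" if "i < r" "l \<noteq> Suc d" for i l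
    using that by (simp add: block_def)
  let ?x = "\<lambda>i. relabel {w} (\<lambda>_. i)" and ?y = "\<lambda>i. relabel {i} (\<lambda>_. w)"
  have rf: "?x i \<in> rowfin" "?y i \<in> rowfin" for i by (auto intro: relabel_rowfin)
  let ?D = "{s. s < d \<and> \<tau> s = Dl}" and ?V = "{s. s < d \<and> \<tau> s = Vc}"
  \<comment> \<open>The remainder is summed over all pairs of slots, independently of the labels.
    This makes the identity below linear in the tensor, so that tracelessness of the whole tensor
    can be used although its components in the boxes need not be traceless.\<close>
  let ?R = "\<lambda>t. \<Sum>s\<in>?D. \<Sum>s'\<in>?V. ins w s s' (contr s s' t)"
  have x_zero: "slot s (act (?x i)) t = 0"
    if "profile d \<tau> \<mu> = Q" "t \<in> Box d \<tau> (\<lambda>s. block d r (\<mu> s))" "s < d" "\<not> (\<tau> s = Dl \<and> \<mu> s = Suc d)" "i < r" for \<mu> s t i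
    by (rule relabel_slot_zero[OF that(2,3)]) (use that w_lab i_lab in auto)
  have y_zero: "slot s (act (?y i)) t = 0"
    if "profile d \<tau> \<mu> = Q" "t \<in> Box d \<tau> (\<lambda>s. block d r (\<mu> s))" "s < d" "\<not> (\<tau> s = Vc \<and> \<mu> s = Suc d)" "i < r" for \<mu> s t i
    by (rule relabel_slot_zero[OF that(2,3)]) (use that w_lab i_lab in auto)
  have "der d (?x i) t \<in> profile_space d r \<tau> (add_mset (Dl, b) (Q - {#(Dl, Suc d)#}))" if i: "i < r" for i
  proof (rule der_profile_space[OF t])
    fix \<mu> t s assume h: "profile d \<tau> \<mu> = Q" "t \<in> Box d \<tau> (\<lambda>s. block d r (\<mu> s))" "s < d"
    have "slot s (act (?x i)) t \<in> Box d \<tau> (\<lambda>s'. block d r ((\<mu>(s := b)) s'))" if "\<tau> s = Dl"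
      by (rule relabel_slot_Box[OF h(2,3)]) (use that w in auto)
    then show "slot s (act (?x i)) t = 0 \<or> (\<tau> s = Dl \<and> \<mu> s = Suc d \<and>
        slot s (act (?x i)) t \<in> Box d \<tau> (\<lambda>s'. block d r ((\<mu>(s := b)) s')))"
      using x_zero[OF h _ i] by blast
  qed simp
  moreover have "(\<Sum>i<r. der d (?y i) (der d (?x i) t)) = of_nat (count Q (Dl, Suc d)) *\<^sub>C t"
  proof -
    have ne: "s \<noteq> s'" if "s \<in> ?D" "s' \<in> ?V" for s s' using that by auto
    have "(\<Sum>i<r. der d (?y i) (der d (?x i) t)) = of_nat (count Q (Dl, Suc d)) *\<^sub>C t - ?R t"
    proof (rule profile_space_eq[where f = "\<lambda>t. \<Sum>i<r. der d (?y i) (der d (?x i) t)" and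
          g = "\<lambda>t. of_nat (count Q (Dl, Suc d)) *\<^sub>C t - ?R t", OF _ _ t])
      show "clinear (\<lambda>t. \<Sum>i<r. der d (?y i) (der d (?x i) t))"
        by (rule clinear_sum) (rule clinear_compose[OF clinear_der clinear_der])
      have "clinear ?R"
        by (rule clinear_sum, rule clinear_sum)
          (rule clinear_compose[OF clinear_ins[OF ne] clinear_contr[OF ne]])
      moreover have "clinear (\<lambda>t::'v ext tensor_algebra. of_nat (count Q (Dl, Suc d)) *\<^sub>C t)"
        by (rule clinear_scale) (simp add: clinear_iff)
      ultimately show "clinear (\<lambda>t. of_nat (count Q (Dl, Suc d)) *\<^sub>C t - ?R t)"
        by (rule clinear_diff[rotated])
      fix \<mu> t assume \<mu>: "profile d \<tau> \<mu> = Q" and t: "t \<in> Box d \<tau> (\<lambda>s. block d r (\<mu> s))"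
      let ?A = "{s \<in> nt d \<tau>. (\<tau> s, \<mu> s) = (Dl, Suc d)}"
      have A: "?A \<subseteq> ?D" "?A \<subseteq> {..<d}" by (auto simp: nt_def)
      have fin_lab: "block d r (Suc d) = {..<r}" by (rule block_fin)
      \<comment> \<open>Within one slot the matrix units compose to the coordinate projections,
        whose sum over the finite block is the identity there.\<close>
      have same: "(\<Sum>i<r. slot s (act (?y i)) (slot s (act (?x i)) t)) = t" if s: "s \<in> ?A" for s
      proof -
        have s': "s < d" "\<tau> s = Dl" "\<mu> s = Suc d" using s by (auto simp: nt_def)
        have "act (?y i) \<circ>\<^sub>e act (?x i) \<circ>\<^sub>e cprj Dl {..<r} = cmp Dl (prj {i})" if "i < r" for i
        proof -
          have "prj {..<r} \<circ>\<^sub>e ?x i \<circ>\<^sub>e ?y i = prj {i}"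
            unfolding relabel_comp using that by (intro relabel_cong) auto
          then show ?thesis by (simp add: cprj_def endo_comp_assoc act_cmp_Dl endo_comp_neg)
        qed
        then have "slot s (act (?y i)) (slot s (act (?x i)) (slot s (cprj Dl {..<r}) t)) = slot s (cmp Dl (prj {i})) t"
          if "i < r" for i using that by (simp only: slot_comp endo_comp_assoc)
        moreover have c: "slot s (cprj Dl {..<r}) t = t" using Box_slot[OF t s'(1)] s' fin_lab by simp
        ultimately have "(\<Sum>i<r. slot s (act (?y i)) (slot s (act (?x i)) t)) = (\<Sum>i<r. slot s (cmp Dl (prj {i})) t)"
          by (intro sum.cong) auto
        also have "\<dots> = slot s (cmp Dl (\<Sum>i<r. prj {i})) t"
          by (simp add: slot_sum_left clinear_sumD[OF clinear_cmp])
        also have "\<dots> = t" using c prj_sum[of "{..<r}"] by (simp add: cprj_def)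
        finally show ?thesis .
      qed
      have cross: "(\<Sum>i<r. slot s' (act (?y i)) (slot s (act (?x i)) t)) =
          (if s' \<in> ?V then - ins w s s' (contr s s' t) else 0)" if s: "s \<in> ?A" and s': "s' < d" "s' \<noteq> s" for s s'
      proof -
        have s0: "s < d" "\<tau> s = Dl" "\<mu> s = Suc d" using s by (auto simp: nt_def)
        show ?thesis
        proof (cases "\<tau> s' = Vc \<and> \<mu> s' = Suc d")
          case True
          then show ?thesis using contr_cross[OF s'(2)[symmetric] s0(1) s'(1) t s0(2), of r w] s' fin_lab by simp
        next
          case False
          have "slot s' (act (?y i)) (slot s (act (?x i)) t) = 0" if "i < r" for i
            using y_zero[OF \<mu> t s'(1) False that] by (simp add: slot_commute[OF s'(2)] slot_0)
          moreover have "ins w s s' (contr s s' t) = 0" if "s' \<in> ?V"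
          proof -
            have "block d r (\<mu> s) \<inter> block d r (\<mu> s') = {}"
              using False that s0 by (intro block_disjoint) auto
            then show ?thesis
              using contr_disjoint[OF s'(2)[symmetric] t s0(1) s'(1) s0(2)] that
                clinear_0D[OF clinear_ins[OF s'(2)[symmetric]]] by simp
          qed
          ultimately show ?thesis by simp
        qed
      qed
      \<comment> \<open>A functional outside the finite block contracts to 0 with every vector,
        because by \<open>inv\<close> no vector shares its label. Such pairs may be added to
        complete the remainder to \<open>?R\<close>.\<close>
      have rest: "ins w s s' (contr s s' t) = 0" if s: "s \<in> ?D - ?A" and s': "s' \<in> ?V" for s s'
      proof -
        have h: "s < d" "s' < d" "\<tau> s = Dl" "\<tau> s' = Vc" "\<mu> s \<noteq> Suc d" using s s' by (auto simp: nt_def)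
        have "(Dl, \<mu> s) \<in># Q" "(Vc, \<mu> s') \<in># Q"
          using h unfolding \<mu>[symmetric] set_profile nt_def by force+
        then have "\<mu> s \<noteq> \<mu> s'" using inv[OF h(5)] by auto
        then have dis: "block d r (\<mu> s) \<inter> block d r (\<mu> s') = {}" by (rule block_disjoint)
        have "s \<noteq> s'" using h by auto
        moreover have "contr s s' t = 0"
          by (rule contr_disjoint[where \<tau> = \<tau> and S = "\<lambda>s. block d r (\<mu> s)"]) (use h t dis in auto)
        ultimately show ?thesis using clinear_0D[OF clinear_ins] by simp
      qed
      have "(\<Sum>i<r. der d (?y i) (der d (?x i) t)) = (\<Sum>i<r. \<Sum>s\<in>?A. \<Sum>s'<d. slot s' (act (?y i)) (slot s (act (?x i)) t))"
      proof (rule sum.cong[OF refl])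
        fix i assume "i \<in> {..<r}"
        then have i: "i < r" by simp
        have "slot s (act (?x i)) t = 0" if "s \<in> {..<d} - ?A" for s
          using that by (intro x_zero[OF \<mu> t _ _ i]) (auto simp: nt_def)
        then have "der d (?x i) t = (\<Sum>s\<in>?A. slot s (act (?x i)) t)"
          unfolding der_def using A(2) by (intro sum.mono_neutral_right) auto
        then have "der d (?y i) (der d (?x i) t) = (\<Sum>s\<in>?A. der d (?y i) (slot s (act (?x i)) t))"
          by (simp only: clinear_sumD[OF clinear_der])
        then show "der d (?y i) (der d (?x i) t) = (\<Sum>s\<in>?A. \<Sum>s'<d. slot s' (act (?y i)) (slot s (act (?x i)) t))"
          by (simp only: der_def)
      qed
      also have "\<dots> = (\<Sum>s\<in>?A. \<Sum>i<r. \<Sum>s'<d. slot s' (act (?y i)) (slot s (act (?x i)) t))"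
        by (rule sum.swap)
      also have "\<dots> = (\<Sum>s\<in>?A. t - (\<Sum>s'\<in>?V. ins w s s' (contr s s' t)))"
      proof (rule sum.cong[OF refl])
        fix s assume s: "s \<in> ?A"
        then have sd: "s < d" "s \<notin> ?V" by (auto simp: nt_def)
        have "(\<Sum>i<r. \<Sum>s'<d. slot s' (act (?y i)) (slot s (act (?x i)) t)) =
            (\<Sum>s'<d. \<Sum>i<r. slot s' (act (?y i)) (slot s (act (?x i)) t))" by (rule sum.swap)
        also have "\<dots> = (\<Sum>s'\<in>{..<d} - {s}. \<Sum>i<r. slot s' (act (?y i)) (slot s (act (?x i)) t)) + t"
          using same[OF s] sd by (subst sum.remove[of _ s]) (auto simp: add.commute)
        also have "(\<Sum>s'\<in>{..<d} - {s}. \<Sum>i<r. slot s' (act (?y i)) (slot s (act (?x i)) t)) =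
            (\<Sum>s'\<in>{..<d} - {s}. if s' \<in> ?V then - ins w s s' (contr s s' t) else 0)"
          by (rule sum.cong[OF refl], rule cross[OF s]) auto
        also have "\<dots> = (\<Sum>s'\<in>?V. - ins w s s' (contr s s' t))"
          using sd by (intro sum.mono_neutral_cong_right) auto
        finally show "(\<Sum>i<r. \<Sum>s'<d. slot s' (act (?y i)) (slot s (act (?x i)) t)) =
            t - (\<Sum>s'\<in>?V. ins w s s' (contr s s' t))" by (simp add: sum_negf)
      qed
      also have "\<dots> = of_nat (card ?A) *\<^sub>C t - (\<Sum>s\<in>?A. \<Sum>s'\<in>?V. ins w s s' (contr s s' t))"
        by (simp only: sum_subtractf sum_const_scale)
      also have "(\<Sum>s\<in>?A. \<Sum>s'\<in>?V. ins w s s' (contr s s' t)) = ?R t"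
        using A(1) rest by (intro sum.mono_neutral_left) auto
      also have "of_nat (card ?A) *\<^sub>C t = of_nat (count Q (Dl, Suc d)) *\<^sub>C t"
        unfolding \<mu>[symmetric] count_profile ..
      finally show "(\<Sum>i<r. der d (?y i) (der d (?x i) t)) = of_nat (count Q (Dl, Suc d)) *\<^sub>C t - ?R t" .
    qed
    moreover have "?R t = 0"
    proof (intro sum.neutral ballI)
      fix s s' assume s: "s \<in> ?D" "s' \<in> ?V"
      then have "contr s s' t = 0" using traceless by auto
      then show "ins w s s' (contr s s' t) = 0" using clinear_0D[OF clinear_ins[OF ne[OF s]]] by simp
    qed
    ultimately show ?thesis by simp
  qed
  ultimately show ?thesis using rf
    by (intro exI[of _ ?x] exI[of _ ?y] conjI allI impI) auto
qed

section \<open>Traceless tensors and their multilinear parts\<close>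

definition traceless :: "nat \<Rightarrow> (nat \<Rightarrow> kind) \<Rightarrow> 'v ext tensor_algebra set" where
  "traceless d \<tau> = {t \<in> Box d \<tau> (\<lambda>_. UNIV).
     \<forall>s s'. s < d \<longrightarrow> s' < d \<longrightarrow> \<tau> s = Dl \<longrightarrow> \<tau> s' = Vc \<longrightarrow> contr s s' t = 0}"

text \<open>Extensional functions, so that there are only finitely many. The labels run through the
  infinite blocks.\<close>

definition labellings :: "nat \<Rightarrow> (nat \<Rightarrow> kind) \<Rightarrow> (nat \<Rightarrow> nat) set" where
  "labellings d \<tau> = {\<kappa> \<in> {..<d} \<rightarrow>\<^sub>E {..d}. inj_on \<kappa> (nt d \<tau>)}"

text \<open>Residue classes instead of blocks: the bound \<open>r\<close> depends on the tensor,
  whereas these boxes have to be fixed before any submodule is considered.\<close>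

definition labelled_box :: "nat \<Rightarrow> (nat \<Rightarrow> kind) \<Rightarrow> (nat \<Rightarrow> nat) \<Rightarrow> 'v ext tensor_algebra set" where
  "labelled_box d \<tau> \<kappa> = Box d \<tau> (\<lambda>s. {i. i mod Suc d = \<kappa> s})"

definition multilin :: "nat \<Rightarrow> (nat \<Rightarrow> kind) \<Rightarrow> 'v ext tensor_algebra set" where
  "multilin d \<tau> = cvs.span (\<Union>\<kappa>\<in>labellings d \<tau>. labelled_box d \<tau> \<kappa>)"

lemma profile_space_multilin:
  assumes "t \<in> profile_space d r \<tau> Q" "\<And>x. x \<in># Q \<Longrightarrow> snd x \<le> d" "\<And>x. count Q x \<le> 1"
    and "\<And>k k' l. (k, l) \<in># Q \<Longrightarrow> (k', l) \<in># Q \<Longrightarrow> k = k'"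
  shows "t \<in> multilin d \<tau>"
proof -
  have id: "clinear (\<lambda>t::'v ext tensor_algebra. t)" by (simp add: clinear_iff)
  show ?thesis
  proof (rule profile_space_map[OF id assms(1)])
    show "cvs.subspace (multilin d \<tau>)" by (simp add: multilin_def)
    fix \<mu> t assume \<mu>: "profile d \<tau> \<mu> = Q" and t: "t \<in> Box d \<tau> (\<lambda>s. block d r (\<mu> s))"
    \<comment> \<open>The label of a trivial slot is a dummy; 0 keeps the labelling within the range
      required by \<open>labellings\<close>.\<close>
    let ?\<kappa> = "restrict (\<lambda>s. if s \<in> nt d \<tau> then \<mu> s else 0) {..<d}"
    have Q: "(\<tau> s, \<mu> s) \<in># Q" if "s \<in> nt d \<tau>" for s
      using that unfolding \<mu>[symmetric] set_profile by blast
    have le: "\<mu> s \<le> d" if "s \<in> nt d \<tau>" for s using assms(2)[OF Q[OF that]] by simp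
    have "inj_on \<mu> (nt d \<tau>)"
    proof (rule inj_onI)
      fix s s' assume s: "s \<in> nt d \<tau>" "s' \<in> nt d \<tau>" "\<mu> s = \<mu> s'"
      then have "\<tau> s = \<tau> s'" using assms(4) Q[OF s(1)] Q[OF s(2)] by metis
      then have sub: "{s, s'} \<subseteq> {s'' \<in> nt d \<tau>. (\<tau> s'', \<mu> s'') = (\<tau> s, \<mu> s)}" using s by auto
      have "card {s, s'} \<le> count Q (\<tau> s, \<mu> s)"
        unfolding \<mu>[symmetric] count_profile by (rule card_mono[OF _ sub]) (simp add: finite_nt)
      then show "s = s'" using assms(3)[of "(\<tau> s, \<mu> s)"] by (cases "s = s'") auto
    qed
    moreover have "?\<kappa> s = \<mu> s" if "s \<in> nt d \<tau>" for s using that by (auto simp: nt_def)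
    ultimately have "inj_on ?\<kappa> (nt d \<tau>)" by (metis (no_types, lifting) inj_on_cong)
    then have "?\<kappa> \<in> labellings d \<tau>" using le by (auto simp: labellings_def)
    moreover have "Box d \<tau> (\<lambda>s. block d r (\<mu> s)) \<subseteq> labelled_box d \<tau> ?\<kappa>"
      unfolding labelled_box_def
    proof (rule Box_mono)
      fix s assume s: "s < d" "\<tau> s \<noteq> Tr"
      then have "s \<in> nt d \<tau>" by (simp add: nt_def)
      then show "block d r (\<mu> s) \<subseteq> {i. i mod Suc d = ?\<kappa> s}"
        using le[of s] s by (auto simp: block_def split: if_splits)
    qed
    ultimately show "t \<in> multilin d \<tau>"
      unfolding multilin_def using t by (intro cvs.span_base) blast
  qed
qed

lemma detect_profile_space:
  assumes N: "N \<in> subs rowfin (der d) (traceless d \<tau>)" and N': "N' \<in> subs rowfin (der d) (traceless d \<tau>)"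
    and F: "N' \<inter> multilin d \<tau> \<subseteq> N"
    and "fst ` set_mset Q \<subseteq> {Dl, Vc}" "size Q \<le> d" "snd ` set_mset Q \<subseteq> {..Suc d}"
      "\<And>l. l \<noteq> Suc d \<Longrightarrow> \<not> ((Dl, l) \<in># Q \<and> (Vc, l) \<in># Q)"
    and "t \<in> N'" "t \<in> profile_space d r \<tau> Q"
  shows "t \<in> N"
  using assms(4-)
proof (induction "Suc d - card (snd ` set_mset Q \<inter> {..d})" arbitrary: Q t rule: less_induct)
  case less
  note kinds = less.prems(1) and size = less.prems(2) and labs = less.prems(3) and inv = less.prems(4)
    and tN' = less.prems(5) and tZ = less.prems(6)
  have sub: "cvs.subspace N" using N by (simp add: subs_def stable_def)
  have st: "der d a y \<in> N" if "a \<in> rowfin" "y \<in> N" for a y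
    using N that by (auto simp: subs_def stable_def)
  have st': "der d a y \<in> N'" if "a \<in> rowfin" "y \<in> N'" for a y
    using N' that by (auto simp: subs_def stable_def)
  have "card (set_mset Q) = (\<Sum>x\<in>set_mset Q. 1)" by simp
  also have "\<dots> \<le> (\<Sum>x\<in>set_mset Q. count Q x)" by (rule sum_mono) (simp add: Suc_le_eq)
  also have "\<dots> = size Q" by (simp add: size_multiset_overloaded_eq)
  finally have "card (snd ` set_mset Q) \<le> size Q"
    using card_image_le[OF finite_set_mset, of snd Q] by (rule order_trans[rotated])
  then have "card (snd ` set_mset Q) < card {..d}" using size by simp
  then have "\<not> {..d} \<subseteq> snd ` set_mset Q" by (meson card_mono finite_imageI finite_set_mset not_le)
  then obtain b where b: "b \<le> d" "b \<notin> snd ` set_mset Q" by blast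
  \<comment> \<open>The second alternative for \<open>a\<close> says that block \<open>a\<close>
    keeps a letter of kind \<open>q\<close>. In both cases the infinite blocks in use lose nothing
    and gain \<open>b\<close>, so the measure drops.\<close>
  have step: "y \<in> N"
    if y: "y \<in> N'" "y \<in> profile_space d r \<tau> (add_mset (q, b) (Q - {#(q, a)#}))"
      and qa: "(q, a) \<in># Q" "a = Suc d \<or> (q, a) \<in># Q - {#(q, a)#}" for y q a
  proof -
    let ?Q = "add_mset (q, b) (Q - {#(q, a)#})"
    have set_le: "set_mset ?Q \<subseteq> insert (q, b) (set_mset Q)" by (auto dest: in_diffD)
    have new: "insert b (snd ` set_mset Q \<inter> {..d}) \<subseteq> snd ` set_mset ?Q \<inter> {..d}"
    proof
      fix l assume "l \<in> insert b (snd ` set_mset Q \<inter> {..d})"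
      then consider "l = b" | k where "(k, l) \<in># Q" "l \<le> d" by auto
      then show "l \<in> snd ` set_mset ?Q \<inter> {..d}"
      proof cases
        case 1
        then show ?thesis using b by simp
      next
        case 2
        have "(k, l) \<in># Q - {#(q, a)#}"
        proof (cases "(k, l) = (q, a)")
          case True
          then show ?thesis using 2(2) qa(2) by auto
        next
          case False
          then show ?thesis using 2(1) by (auto simp: in_diff_count)
        qed
        then show ?thesis using 2(2) by force
      qed
    qed
    have "card (snd ` set_mset Q \<inter> {..d}) < card (insert b (snd ` set_mset Q \<inter> {..d}))"
      using b by simp
    also have "\<dots> \<le> card (snd ` set_mset ?Q \<inter> {..d})" by (rule card_mono[OF _ new]) simp
    finally have lt: "card (snd ` set_mset Q \<inter> {..d}) < card (snd ` set_mset ?Q \<inter> {..d})" .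
    have "card (snd ` set_mset ?Q \<inter> {..d}) \<le> card {..d}" by (rule card_mono) auto
    then have meas: "Suc d - card (snd ` set_mset ?Q \<inter> {..d}) < Suc d - card (snd ` set_mset Q \<inter> {..d})"
      using lt by simp
    have k: "fst ` set_mset ?Q \<subseteq> {Dl, Vc}" using kinds qa(1) set_le by force
    have sz: "size ?Q \<le> d" using size size_Suc_Diff1[OF qa(1)] by (simp only: size_add_mset)
    have lb: "snd ` set_mset ?Q \<subseteq> {..Suc d}" using labs b(1) set_le by force
    have iv: "\<not> ((Dl, l) \<in># ?Q \<and> (Vc, l) \<in># ?Q)" if l: "l \<noteq> Suc d" for l
    proof
      assume h: "(Dl, l) \<in># ?Q \<and> (Vc, l) \<in># ?Q"
      show False
      proof (cases "l = b")
        case True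
        have "(k, b) \<notin># Q" for k using b(2) by force
        then have "(k, b) \<notin># Q - {#(q, a)#}" for k using in_diffD by metis
        then have "Dl = q" "q = Vc" using h True by auto
        then have "Dl = Vc" by (rule trans)
        then show False by simp
      next
        case False
        then have "(Dl, l) \<in># Q" "(Vc, l) \<in># Q" using h set_le by auto
        then show False using inv[OF l] by blast
      qed
    qed
    show "y \<in> N" by (rule less.hyps[OF meas k sz lb iv y])
  qed
  have block: "t \<in> N" if qa: "(q, a) \<in># Q" "\<And>k. (k, a) \<in># Q \<Longrightarrow> k = q" "a = Suc d \<or> (q, a) \<in># Q - {#(q, a)#}" for q a
  proof -
    have q: "q \<noteq> Tr" using kinds qa(1) by force
    obtain x y where xy: "x \<in> rowfin" "y \<in> rowfin" "der d x t \<in> profile_space d r \<tau> (add_mset (q, b) (Q - {#(q, a)#}))"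
      "der d y (der d x t) = of_nat (count Q (q, a)) *\<^sub>C t"
      using move_block[OF tZ qa(1,2) q b] by blast
    have "der d x t \<in> N" by (rule step[OF st'[OF xy(1) tN'] xy(3) qa(1,3)])
    from st[OF xy(2) this] have "inverse (of_nat (count Q (q, a))) *\<^sub>C of_nat (count Q (q, a)) *\<^sub>C t \<in> N"
      unfolding xy(4) by (rule cvs.subspace_scale[OF sub])
    moreover have "count Q (q, a) \<noteq> 0" using qa(1) by simp
    ultimately show "t \<in> N" by simp
  qed
  consider "(Dl, Suc d) \<in># Q" | "(Dl, Suc d) \<notin># Q" "(Vc, Suc d) \<in># Q"
    | "\<And>k. (k, Suc d) \<notin># Q"
    using kinds by force
  then show "t \<in> N"
  proof cases
    case 1
    have "contr s s' t = 0" if "s < d" "s' < d" "\<tau> s = Dl" "\<tau> s' = Vc" for s s'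
      using N' tN' that by (auto simp: subs_def traceless_def)
    then obtain x y where xy: "\<forall>i. x i \<in> rowfin \<and> y i \<in> rowfin"
      "\<forall>i<r. der d (x i) t \<in> profile_space d r \<tau> (add_mset (Dl, b) (Q - {#(Dl, Suc d)#}))"
      "(\<Sum>i<r. der d (y i) (der d (x i) t)) = of_nat (count Q (Dl, Suc d)) *\<^sub>C t"
      using move_finite_block[OF tZ inv b] by blast
    have "der d (y i) (der d (x i) t) \<in> N" if "i < r" for i
      using xy(1,2) that by (intro st step[OF st'[OF _ tN'] _ 1]) auto
    then have "(\<Sum>i<r. der d (y i) (der d (x i) t)) \<in> N" by (intro cvs.subspace_sum[OF sub]) simp
    then have "inverse (of_nat (count Q (Dl, Suc d))) *\<^sub>C of_nat (count Q (Dl, Suc d)) *\<^sub>C t \<in> N"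
      unfolding xy(3) by (rule cvs.subspace_scale[OF sub])
    moreover have "count Q (Dl, Suc d) \<noteq> 0" using 1 by simp
    ultimately show ?thesis by simp
  next
    case 2
    have "k = Vc" if "(k, Suc d) \<in># Q" for k using kinds that 2(1) by force
    then show ?thesis using block[OF 2(2)] by blast
  next
    case 3
    have uniq: "k = k'" if "(k, l) \<in># Q" "(k', l) \<in># Q" for k k' l
    proof -
      have "l \<noteq> Suc d" using 3 that by blast
      moreover have "k \<in> {Dl, Vc}" "k' \<in> {Dl, Vc}" using kinds that by force+
      ultimately show ?thesis using inv[of l] that by auto
    qed
    show ?thesis
    proof (cases "\<forall>x. count Q x \<le> 1")
      case True
      have le: "snd x \<le> d" if x: "x \<in># Q" for x
      proof -
        have "snd x \<in> {..Suc d}" using labs imageI[OF x, of snd] by (rule subsetD)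
        moreover have "snd x \<noteq> Suc d" using 3[of "fst x"] x by (metis prod.collapse)
        ultimately show ?thesis by simp
      qed
      have "t \<in> multilin d \<tau>"
      proof (rule profile_space_multilin[OF tZ])
        show "snd x \<le> d" if "x \<in># Q" for x by (rule le[OF that])
        show "count Q x \<le> 1" for x using True by blast
        show "k = k'" if "(k, l) \<in># Q" "(k', l) \<in># Q" for k k' l by (rule uniq[OF that])
      qed
      then show ?thesis using F tN' by blast
    next
      case False
      then obtain q a where qa: "\<not> count Q (q, a) \<le> 1" by (metis surj_pair)
      then have "(q, a) \<in># Q" by (metis not_in_iff zero_le)
      moreover have "(q, a) \<in># Q - {#(q, a)#}"
        using qa by (simp add: in_diff_count)
      ultimately show ?thesis using block[of q a] uniq by blast
    qed
  qed
qed

lemma cprj_Tr: "cprj Tr S = cprj Tr S'"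
  by (rule ext_endo_eqI) (simp add: cprj_def cmp_apply)

lemma Vc_bounded:
  assumes t: "t \<in> Box d \<tau> S"
  shows "\<exists>r. \<forall>s<d. \<tau> s = Vc \<longrightarrow> slot s (cprj Vc {..<r}) t = t"
proof -
  have "\<forall>s. \<exists>J. s < d \<longrightarrow> \<tau> s = Vc \<longrightarrow> finite J \<and> slot s (cprj Vc J) t = t"
    using finite_at_Vc[OF t] unfolding finite_at_def by blast
  then obtain J where J: "\<And>s. s < d \<Longrightarrow> \<tau> s = Vc \<Longrightarrow> finite (J s) \<and> slot s (cprj Vc (J s)) t = t"
    by metis
  let ?J = "\<Union>s\<in>{s. s < d \<and> \<tau> s = Vc}. J s"
  have "finite ?J" using J by (intro finite_UN_I) auto
  then obtain r where r: "?J \<subseteq> {..<r}" by (metis finite_nat_iff_bounded)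
  have "slot s (cprj Vc {..<r}) t = t" if s: "s < d" "\<tau> s = Vc" for s
  proof -
    have "{..<r} \<inter> J s = J s" using r s by blast
    then have "slot s (cprj Vc {..<r}) (slot s (cprj Vc (J s)) t) = slot s (cprj Vc (J s)) t"
      by (simp only: slot_comp cprj_cprj)
    then show ?thesis using J[OF s] by simp
  qed
  then show ?thesis by blast
qed

text \<open>The eigenvalue of the block projection with label \<open>l\<close>: vectors count
  positively, functionals negatively.\<close>

definition weight :: "(kind \<times> nat) multiset \<Rightarrow> nat \<Rightarrow> complex" where
  "weight Q l = of_nat (count Q (Vc, l)) - of_nat (count Q (Dl, l))"

lemma weight_profile_space:
  assumes "t \<in> profile_space d r \<tau> Q"
  shows "der d (prj (block d r l)) t = weight Q l *\<^sub>C t"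
proof (rule profile_space_eq[OF clinear_der _ assms])
  show "clinear (\<lambda>t::'v ext tensor_algebra. weight Q l *\<^sub>C t)"
    by (rule clinear_scale) (simp add: clinear_iff)
  fix \<mu> t assume \<mu>: "profile d \<tau> \<mu> = Q" and t: "t \<in> Box d \<tau> (\<lambda>s. block d r (\<mu> s))"
  let ?A = "\<lambda>k. {s \<in> nt d \<tau>. (\<tau> s, \<mu> s) = (k, l)}"
  have term_eq: "slot s (act (prj (block d r l))) t =
      (if s \<in> ?A Vc then t else 0) - (if s \<in> ?A Dl then t else 0)" if s: "s < d" for s
  proof (cases "s \<in> nt d \<tau> \<and> \<mu> s = l")
    case True
    then have T: "\<tau> s \<noteq> Tr" and l: "\<mu> s = l" and nt: "s \<in> nt d \<tau>" by (simp_all add: nt_def)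
    have c: "slot s (cmp (\<tau> s) (prj (block d r l))) t = t"
      using Box_slot[OF t s] unfolding cprj_def l .
    show ?thesis
    proof (cases "\<tau> s")
      case Dl
      then show ?thesis using slot_act_cmp(1)[OF t s Dl, of "prj (block d r l)"] c l nt by simp
    next
      case Vc
      then show ?thesis using slot_act_cmp(2)[OF t s Vc, of "prj (block d r l)"] c l nt by simp
    qed (use T in simp)
  next
    case False
    have "slot s (act (prj (block d r l))) t = 0"
    proof (rule relabel_slot_zero[OF t s])
      have "block d r l \<inter> block d r (\<mu> s) = {}" if "\<tau> s \<noteq> Tr"
        using False that s by (intro block_disjoint) (auto simp: nt_def)
      then show "(\<lambda>j. j) ` block d r l \<inter> block d r (\<mu> s) = {}" if "\<tau> s = Dl" using that by simp
      show "block d r l \<inter> block d r (\<mu> s) = {}" if "\<tau> s = Vc"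
        using False that s by (intro block_disjoint) (auto simp: nt_def)
    qed
    then show ?thesis using False by auto
  qed
  have sumA: "(\<Sum>s<d. if s \<in> ?A k then t else 0) = of_nat (count Q (k, l)) *\<^sub>C t" for k
  proof -
    have "(\<Sum>s<d. if s \<in> ?A k then t else 0) = (\<Sum>s\<in>?A k. t)"
      by (rule sum.mono_neutral_cong_right) (auto simp: nt_def)
    then show ?thesis unfolding sum_const_scale \<mu>[symmetric] count_profile .
  qed
  have "der d (prj (block d r l)) t = (\<Sum>s<d. (if s \<in> ?A Vc then t else 0) - (if s \<in> ?A Dl then t else 0))"
    unfolding der_def using term_eq by (intro sum.cong) auto
  then show "der d (prj (block d r l)) t = weight Q l *\<^sub>C t"
    by (simp only: weight_def sum_subtractf sumA cvs.scale_left_diff_distrib)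
qed

text \<open>Choose \<open>r\<close> so large that all letters of \<open>V\<close> lie in the finite
  block. The components of \<open>t\<close> by profile are then joint eigenvectors of the block
  projections with different weights, so they belong to \<open>N'\<close> as well and can be treated
  separately.\<close>

lemma detect_traceless:
  assumes N: "N \<in> subs rowfin (der d) (traceless d \<tau>)" and N': "N' \<in> subs rowfin (der d) (traceless d \<tau>)"
    and F: "N' \<inter> multilin d \<tau> \<subseteq> N"
  shows "N' \<subseteq> N"
proof
  fix t assume t: "t \<in> N'"
  then have tB: "t \<in> Box d \<tau> (\<lambda>_. UNIV)" using N' by (auto simp: subs_def traceless_def)
  obtain r where r: "\<And>s. s < d \<Longrightarrow> \<tau> s = Vc \<Longrightarrow> slot s (cprj Vc {..<r}) t = t"
    using Vc_bounded[OF tB] by blast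
  \<comment> \<open>A functional is spread over all blocks, while the vectors sit in the finite one;
    the single label of a trivial slot is a dummy.\<close>
  let ?L = "\<lambda>s. if \<tau> s = Dl then {..Suc d} else {Suc d}"
  let ?M = "Pi\<^sub>E {..<d} ?L"
  let ?QQ = "profile d \<tau> ` ?M"
  have fin: "finite ?QQ" by (intro finite_imageI finite_PiE) auto
  have all: "prj UNIV = (\<Sum>l\<le>Suc d. prj (block d r l))"
  proof (rule endo_v_ext)
    fix j
    let ?l = "if j < r then Suc d else j mod Suc d"
    have "?l \<le> Suc d" using mod_less_divisor[of "Suc d" j] by (simp add: less_imp_le)
    have "endo_apply (\<Sum>l\<le>Suc d. prj (block d r l)) (v j) = (\<Sum>l\<le>Suc d. if l = ?l then v j else 0)"
      unfolding clinear_sumD[OF clinear_endo_apply_left]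
      by (rule sum.cong) (auto simp: relabel_v block_def)
    also have "\<dots> = v j" using \<open>?l \<le> Suc d\<close> by (subst sum.delta) auto
    finally show "endo_apply (prj UNIV) (v j) = endo_apply (\<Sum>l\<le>Suc d. prj (block d r l)) (v j)"
      by (simp add: relabel_v)
  qed
  have "t \<in> cvs.span (\<Union>\<mu>\<in>?M. {t \<in> tpow d. \<forall>s<d. slot s (cprj (\<tau> s) (block d r (\<mu> s))) t = t})"
  proof (rule tpow_decompose[OF Box_tpow[OF tB]])
    show "cprj (\<tau> s) (block d r l) \<circ>\<^sub>e cprj (\<tau> s) (block d r l) = cprj (\<tau> s) (block d r l)" for s l
      by (simp add: cprj_cprj)
    fix s assume s: "s < d"
    show "(\<Sum>l\<in>?L s. slot s (cprj (\<tau> s) (block d r l)) t) = t"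
    proof (cases "\<tau> s")
      case Dl
      have "cmp Dl (\<Sum>l\<le>Suc d. prj (block d r l)) = (\<Sum>l\<le>Suc d. cprj Dl (block d r l))"
        unfolding cprj_def by (rule clinear_sumD[OF clinear_cmp]) simp
      then have "(\<Sum>l\<le>Suc d. slot s (cprj Dl (block d r l)) t) = slot s (cmp Dl (\<Sum>l\<le>Suc d. prj (block d r l))) t"
        by (simp only: slot_sum_left)
      also have "\<dots> = t" using Box_slot[OF tB s] Dl by (simp only: all[symmetric] cprj_def)
      finally show ?thesis using Dl by simp
    next
      case Vc
      then show ?thesis using r[OF s Vc] by (simp add: block_fin)
    next
      case Tr
      then show ?thesis using Box_slot[OF tB s] cprj_Tr[of "block d r (Suc d)" UNIV] by simp
    qed
  qed
  moreover have "(\<Union>\<mu>\<in>?M. {t \<in> tpow d. \<forall>s<d. slot s (cprj (\<tau> s) (block d r (\<mu> s))) t = t}) \<subseteq> (\<Union>Q\<in>?QQ. profile_space d r \<tau> Q)"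
  proof
    fix x assume "x \<in> (\<Union>\<mu>\<in>?M. {t \<in> tpow d. \<forall>s<d. slot s (cprj (\<tau> s) (block d r (\<mu> s))) t = t})"
    then obtain \<mu> where \<mu>: "\<mu> \<in> ?M" "x \<in> Box d \<tau> (\<lambda>s. block d r (\<mu> s))" by (auto simp: Box_def)
    have "x \<in> profile_space d r \<tau> (profile d \<tau> \<mu>)" by (rule profile_space_base[OF \<mu>(2) refl])
    then show "x \<in> (\<Union>Q\<in>?QQ. profile_space d r \<tau> Q)" using \<mu>(1) by blast
  qed
  ultimately have "t \<in> cvs.span (\<Union>Q\<in>?QQ. profile_space d r \<tau> Q)" using cvs.span_mono by blast
  then obtain x where x: "\<And>Q. Q \<in> ?QQ \<Longrightarrow> x Q \<in> profile_space d r \<tau> Q" "t = (\<Sum>Q\<in>?QQ. x Q)"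
    using span_Union_sum[OF fin, of t "profile_space d r \<tau>"] by (auto simp: profile_space_def)
  have cnt_V: "count Q (Vc, l) = (if l = Suc d then card {s. s < d \<and> \<tau> s = Vc} else 0)"
    and cnt_T: "count Q (Tr, l) = 0" and cnt_D: "l > Suc d \<Longrightarrow> count Q (Dl, l) = 0"
    and cnt_size: "size Q \<le> d" if Q: "Q \<in> ?QQ" for Q l
  proof -
    obtain \<mu> where \<mu>: "\<mu> \<in> ?M" "Q = profile d \<tau> \<mu>" using Q by blast
    have mV: "\<mu> s = Suc d" if "s < d" "\<tau> s = Vc" for s
      using PiE_mem[OF \<mu>(1), of s] that by simp
    have mD: "\<mu> s \<le> Suc d" if "s < d" "\<tau> s = Dl" for s
      using PiE_mem[OF \<mu>(1), of s] that by simp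
    have "{s \<in> nt d \<tau>. (\<tau> s, \<mu> s) = (Vc, l)} = (if l = Suc d then {s. s < d \<and> \<tau> s = Vc} else {})"
      using mV by (auto simp: nt_def)
    then show "count Q (Vc, l) = (if l = Suc d then card {s. s < d \<and> \<tau> s = Vc} else 0)"
      unfolding \<mu>(2) count_profile by simp
    have "{s \<in> nt d \<tau>. (\<tau> s, \<mu> s) = (Tr, l)} = {}" by (auto simp: nt_def)
    then show "count Q (Tr, l) = 0" unfolding \<mu>(2) count_profile by (simp only: card.empty)
    have "{s \<in> nt d \<tau>. (\<tau> s, \<mu> s) = (Dl, l)} = {}" if "l > Suc d"
      using mD that by (fastforce simp: nt_def)
    then show "l > Suc d \<Longrightarrow> count Q (Dl, l) = 0" unfolding \<mu>(2) count_profile by (simp only: card.empty)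
    have "card (nt d \<tau>) \<le> card {..<d}" by (rule card_mono) (auto simp: nt_def)
    then show "size Q \<le> d" unfolding \<mu>(2) profile_def by simp
  qed
  have sub: "cvs.subspace N" "cvs.subspace N'" using N N' by (auto simp: subs_def stable_def)
  have "x Q \<in> N" if Q: "Q \<in> ?QQ" for Q
  proof (rule detect_profile_space[OF N N' F _ cnt_size[OF Q] _ _ _ x(1)[OF Q]])
    show "fst ` set_mset Q \<subseteq> {Dl, Vc}"
    proof
      fix k assume "k \<in> fst ` set_mset Q"
      then obtain l where "(k, l) \<in># Q" by auto
      then have "k \<noteq> Tr" using cnt_T[OF Q, of l] unfolding count_eq_zero_iff by auto
      then show "k \<in> {Dl, Vc}" by (cases k) auto
    qed
    show "snd ` set_mset Q \<subseteq> {..Suc d}"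
    proof
      fix l assume "l \<in> snd ` set_mset Q"
      then obtain k where k: "(k, l) \<in># Q" by auto
      show "l \<in> {..Suc d}"
      proof (rule ccontr)
        assume "l \<notin> {..Suc d}"
        then have "count Q (k, l) = 0"
          using cnt_V[OF Q, of l] cnt_T[OF Q, of l] cnt_D[OF Q, of l] by (cases k) auto
        then show False using k unfolding count_eq_zero_iff by blast
      qed
    qed
    show "\<not> ((Dl, l) \<in># Q \<and> (Vc, l) \<in># Q)" if "l \<noteq> Suc d" for l
    proof -
      have "count Q (Vc, l) = 0" using cnt_V[OF Q, of l] that by simp
      then show ?thesis unfolding count_eq_zero_iff by blast
    qed
    show "x Q \<in> N'"
    proof (rule eigenvector_component_mem[where K = "{..Suc d}" and A = "\<lambda>l. der d (prj (block d r l))"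
          and J = "?QQ - {Q}" and y = x and w = "weight Q" and v = "\<lambda>l R. weight R l"])
      show "cvs.subspace N'" by (rule sub(2))
      show "clinear (der d (prj (block d r l)))" for l by (rule clinear_der)
      have "prj (block d r l) \<in> rowfin" for l by (rule relabel_rowfin) simp
      then show "der d (prj (block d r l)) y \<in> N'" if "y \<in> N'" for l y
        using N' that by (auto simp: subs_def stable_def)
      show "finite (?QQ - {Q})" using fin by blast
      show "der d (prj (block d r l)) (x Q) = weight Q l *\<^sub>C x Q" for l
        by (rule weight_profile_space[OF x(1)[OF Q]])
      show "der d (prj (block d r l)) (x R) = weight R l *\<^sub>C x R"
        if "R \<in> ?QQ - {Q}" for l R by (rule weight_profile_space[OF x(1)[OF DiffD1[OF that]]])
      \<comment> \<open>All profiles place the same number of vectors in the finite block and none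
        elsewhere, so equal weights force equal numbers of functionals in each block.\<close>
      show "\<exists>l\<in>{..Suc d}. weight R l \<noteq> weight Q l" if R: "R \<in> ?QQ - {Q}" for R
      proof (rule ccontr)
        assume neg: "\<not> (\<exists>l\<in>{..Suc d}. weight R l \<noteq> weight Q l)"
        have eq: "weight R l = weight Q l" if "l \<le> Suc d" for l
        proof (rule ccontr)
          assume "weight R l \<noteq> weight Q l"
          then have "\<exists>l\<in>{..Suc d}. weight R l \<noteq> weight Q l" using that by (intro bexI[of _ l]) auto
          then show False using neg by (rule notE[rotated])
        qed
        have R': "R \<in> ?QQ" using R by blast
        have "count R (k, l) = count Q (k, l)" for k l
        proof (cases k)
          case Dl
          show ?thesis
          proof (cases "l \<le> Suc d")
            case True
            then show ?thesis using eq[OF True] cnt_V[OF R', of l] cnt_V[OF Q, of l] Dl by (simp add: weight_def)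
          next
            case False
            then show ?thesis using cnt_D[OF R', of l] cnt_D[OF Q, of l] Dl by simp
          qed
        qed (use cnt_V[OF R', of l] cnt_V[OF Q, of l] cnt_T[OF R', of l] cnt_T[OF Q, of l] in simp_all)
        then have "R = Q" by (intro multiset_eqI) auto
        then show False using R by blast
      qed
      show "x Q + (\<Sum>R\<in>?QQ - {Q}. x R) \<in> N'"
        using t x(2) sum.remove[OF fin Q, of x] by simp
    qed
  qed
  then show "t \<in> N" unfolding x(2) by (rule cvs.subspace_sum[OF sub(1)])
qed

definition block_ops :: "nat \<Rightarrow> 'v endo set" where
  "block_ops d = (\<Union>c\<le>d. local_ops {i. i mod Suc d = c})"

lemma local_slot_zero:
  assumes "a \<in> local_ops C" "t \<in> Box d \<tau> S" "s < d" "\<tau> s \<noteq> Tr \<Longrightarrow> C \<inter> S s = {}"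
  shows "slot s (act a) t = 0"
proof (rule slot_zero_on_Box[OF assms(2,3)])
  have a: "a = prj C \<circ>\<^sub>e a" "a = a \<circ>\<^sub>e prj C" using local_opsD[OF assms(1)] by simp_all
  show "act a \<circ>\<^sub>e cprj (\<tau> s) (S s) = 0"
  proof (cases "\<tau> s")
    case Dl
    then have "S s \<inter> C = {}" using assms(4) by auto
    then have "prj (S s) \<circ>\<^sub>e (prj C \<circ>\<^sub>e a) = 0"
      by (simp only: endo_comp_assoc[symmetric] prj_prj relabel_empty endo_comp_0)
    then have "prj (S s) \<circ>\<^sub>e a = 0" using a(1) by simp
    then show ?thesis using Dl cmp_0[of Dl] by (simp add: cprj_def act_cmp_Dl)
  next
    case Vc
    then have "C \<inter> S s = {}" using assms(4) by auto
    then have "(a \<circ>\<^sub>e prj C) \<circ>\<^sub>e prj (S s) = 0"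
      by (simp only: endo_comp_assoc prj_prj relabel_empty endo_comp_0)
    then have "a \<circ>\<^sub>e prj (S s) = 0" using a(2) by simp
    then show ?thesis using Vc cmp_0[of Vc] by (simp add: cprj_def act_cmp_Vc)
  qed (simp add: cprj_def act_cmp_Tr)
qed

lemma stable_labelled_box:
  "stable (block_ops d) (der d) (labelled_box d \<tau> \<kappa>)"
  unfolding stable_def
proof (intro conjI ballI)
  show sub: "cvs.subspace (labelled_box d \<tau> \<kappa>)" unfolding labelled_box_def by (rule subspace_Box)
  fix a t assume "a \<in> block_ops d" and t: "t \<in> labelled_box d \<tau> \<kappa>"
  then obtain c where c: "a \<in> local_ops {i. i mod Suc d = c}" by (auto simp: block_ops_def)
  have tB: "t \<in> Box d \<tau> (\<lambda>s. {i. i mod Suc d = \<kappa> s})" using t by (simp add: labelled_box_def)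
  show "der d a t \<in> labelled_box d \<tau> \<kappa>"
    unfolding der_def
  proof (rule cvs.subspace_sum[OF sub])
    fix s assume "s \<in> {..<d}"
    then have s: "s < d" by simp
    show "slot s (act a) t \<in> labelled_box d \<tau> \<kappa>"
    proof (cases "\<kappa> s = c")
      case True
      then show ?thesis
        unfolding labelled_box_def using slot_act_Box[OF _ s tB, of a] c by simp
    next
      case False
      then have "slot s (act a) t = 0" by (intro local_slot_zero[OF c tB s]) auto
      then show ?thesis using cvs.subspace_0[OF sub] by simp
    qed
  qed
qed

text \<open>The labels of the non-trivial slots are distinct, so an operator supported on the
  residue class of slot \<open>s\<close> acts on that slot only, and its derivation equals its slot
  action. Stability under \<open>block_ops\<close> thus gives stability under independent actions on
  the slots.\<close>

lemma finite_height_labelled_box: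
  assumes "\<kappa> \<in> labellings d \<tau>"
  shows "finite_height (subs (block_ops d) (der d) (labelled_box d \<tau> \<kappa>))"
proof -
  let ?S = "\<lambda>s. {i. i mod Suc d = \<kappa> s}"
  have \<kappa>: "\<kappa> s \<le> d" if "s < d" for s
    using assms that by (auto simp: labellings_def)
  have inj: "inj_on \<kappa> (nt d \<tau>)" using assms by (simp add: labellings_def)
  have ne: "?S s \<noteq> {}" if "s < d" for s
  proof -
    have "\<kappa> s mod Suc d = \<kappa> s" using \<kappa>[OF that] by simp
    then show ?thesis by blast
  qed
  have "subs (block_ops d) (der d) (labelled_box d \<tau> \<kappa>) \<subseteq> subs (slot_ops d ?S) slot_act (Box d \<tau> ?S)"
  proof
    fix N assume "N \<in> subs (block_ops d) (der d) (labelled_box d \<tau> \<kappa>)"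
    then have N: "N \<subseteq> Box d \<tau> ?S" "stable (block_ops d) (der d) N" by (auto simp: subs_def labelled_box_def)
    have "slot s (act a) t \<in> N" if s: "s < d" and a: "a \<in> local_ops (?S s)" and t: "t \<in> N" for s a t
    proof (cases "\<tau> s = Tr")
      case True
      then have "slot s (act a) t = 0" using t N(1) by (intro local_slot_zero[OF a _ s]) auto
      then show ?thesis using cvs.subspace_0[OF stable_subspace[OF N(2)]] by simp
    next
      case False
      have "slot s' (act a) t = 0" if s': "s' < d" "s' \<noteq> s" for s'
      proof (rule local_slot_zero[OF a _ s'(1)])
        show "t \<in> Box d \<tau> ?S" using t N(1) by blast
        assume "\<tau> s' \<noteq> Tr"
        then have "\<kappa> s' \<noteq> \<kappa> s"
          using inj s' s False unfolding inj_on_def nt_def by blast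
        then show "?S s \<inter> ?S s' = {}" by auto
      qed
      then have "der d a t = (\<Sum>s'<d. if s' = s then slot s (act a) t else 0)"
        unfolding der_def by (intro sum.cong) auto
      then have "slot s (act a) t = der d a t" using s by simp
      moreover have "a \<in> block_ops d" using a \<kappa>[OF s] by (auto simp: block_ops_def)
      ultimately show ?thesis using stable_op[OF N(2) _ t, of a] by simp
    qed
    then have "stable (slot_ops d ?S) slot_act N"
      unfolding stable_def slot_ops_def slot_act_def using stable_subspace[OF N(2)] by auto
    then show "N \<in> subs (slot_ops d ?S) slot_act (Box d \<tau> ?S)" using N(1) by (simp add: subs_def)
  qed
  with finite_height_slot_ops[where S = ?S, OF ne] show ?thesis by (rule finite_height_mono)
qed

text \<open>The multilinear part is viewed as a module over the smaller family
  \<open>block_ops\<close>. Intersections with it are stable there, and by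
  \<open>detect_traceless\<close> they determine the submodule.\<close>

lemma finite_height_traceless: "finite_height (subs rowfin (der d) (traceless d \<tau>))"
proof -
  have fin: "finite (labellings d \<tau>)"
    by (rule finite_subset[of _ "{..<d} \<rightarrow>\<^sub>E {..d}"]) (auto simp: labellings_def intro: finite_PiE)
  have st: "stable (block_ops d) (der d) (multilin d \<tau>)"
    unfolding multilin_def by (rule stable_span[OF clinear_der stable_labelled_box])
  have fh: "finite_height (subs (block_ops d) (der d) (multilin d \<tau>))"
    unfolding multilin_def
    by (rule finite_height_subs_Union[OF fin clinear_der stable_labelled_box finite_height_labelled_box])
  have ops: "block_ops d \<subseteq> rowfin" by (auto simp: block_ops_def local_ops_def)
  show ?thesis
  proof (rule finite_height_detect1[OF fh, where \<phi> = "\<lambda>N. N \<inter> multilin d \<tau>"])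
    show "N \<inter> multilin d \<tau> \<in> subs (block_ops d) (der d) (multilin d \<tau>)"
      if "N \<in> subs rowfin (der d) (traceless d \<tau>)" for N
      using stable_Int[OF stable_mono[OF _ ops] st, of N] that by (simp add: subs_def)
    show "N \<inter> multilin d \<tau> \<subseteq> N' \<inter> multilin d \<tau>" if "N \<subseteq> N'" for N N' using that by blast
    show "N' \<subseteq> N" if N: "N \<in> subs rowfin (der d) (traceless d \<tau>)"
      "N' \<in> subs rowfin (der d) (traceless d \<tau>)" "N \<inter> multilin d \<tau> = N' \<inter> multilin d \<tau>" for N N'
      by (rule detect_traceless[OF N(1,2)]) (simp add: N(3)[symmetric])
  qed
qed

text \<open>The common kernel of all contractions is the traceless part, and the images lie in boxes
  with two non-trivial slots fewer, to which the induction hypothesis applies.\<close>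

lemma finite_height_Box: "finite_height (subs rowfin (der d) (Box d \<tau> (\<lambda>_. UNIV)))"
proof (induction "card (nt d \<tau>)" arbitrary: \<tau> rule: less_induct)
  case less
  let ?I = "{(s, s'). s < d \<and> s' < d \<and> \<tau> s = Dl \<and> \<tau> s' = Vc}"
  let ?B = "\<lambda>(s, s'). Box d (\<tau>(s := Tr, s' := Tr)) (\<lambda>_. UNIV)"
  let ?c = "\<lambda>(s, s'). contr s s'"
  show ?case
  proof (rule finite_height_subs_kernels[where I = ?I and \<phi> = ?c and R = ?B and B = "der d"])
    show "finite ?I" by (rule finite_subset[of _ "{..<d} \<times> {..<d}"]) auto
    have "{x \<in> Box d \<tau> (\<lambda>_. UNIV). \<forall>j\<in>?I. ?c j x = 0} = traceless d \<tau>"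
      by (auto simp: traceless_def)
    then show "finite_height (subs rowfin (der d) {x \<in> Box d \<tau> (\<lambda>_. UNIV). \<forall>j\<in>?I. ?c j x = 0})"
      using finite_height_traceless by simp
  next
    fix j assume "j \<in> ?I"
    then obtain s s' where j: "j = (s, s')" "s < d" "s' < d" "\<tau> s = Dl" "\<tau> s' = Vc" by blast
    then have ne: "s \<noteq> s'" by auto
    show "clinear (?c j)" using clinear_contr[OF ne] by (simp add: j(1))
    have "nt d (\<tau>(s := Tr, s' := Tr)) \<subset> nt d \<tau>"
    proof (rule psubsetI)
      show "nt d (\<tau>(s := Tr, s' := Tr)) \<subseteq> nt d \<tau>" by (auto simp: nt_def)
      have "s \<in> nt d \<tau>" "s \<notin> nt d (\<tau>(s := Tr, s' := Tr))" using j by (simp_all add: nt_def)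
      then show "nt d (\<tau>(s := Tr, s' := Tr)) \<noteq> nt d \<tau>" by metis
    qed
    then have "card (nt d (\<tau>(s := Tr, s' := Tr))) < card (nt d \<tau>)"
      by (rule psubset_card_mono[OF finite_nt])
    from less[OF this] show "finite_height (subs rowfin (der d) (?B j))" by (simp only: j(1) case_prod_conv)
    show "?c j ` Box d \<tau> (\<lambda>_. UNIV) \<subseteq> ?B j"
      unfolding j(1) case_prod_conv by (rule image_subsetI) (rule contr_Box[OF ne j(2,3)])
    show "?c j (der d i x) = der d i (?c j x)" if "x \<in> Box d \<tau> (\<lambda>_. UNIV)" for i x
      using contr_der[OF ne Box_tpow[OF that] j(2,3)] by (simp add: j(1))
  next
    show "der d i 0 = 0" for i by (rule clinear_0D[OF clinear_der])
  qed
qed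

section \<open>From boxes back to tensor powers of the original letters\<close>

lemma prj_UNIV: "endo_apply (prj UNIV) x = x"
  by (rule clinear_v_ext[OF clinear_endo_apply]) (simp add: clinear_iff, simp add: relabel_v)

lemma stable_Box_UNIV: "stable G (der d) (Box d \<tau> (\<lambda>_. UNIV))"
  unfolding stable_def der_def
proof (intro conjI ballI subspace_Box cvs.subspace_sum)
  fix a t s assume t: "t \<in> Box d \<tau> (\<lambda>_. UNIV)" and "s \<in> {..<d}"
  then have s: "s < d" by simp
  have id: "prj UNIV \<circ>\<^sub>e a = a" "a \<circ>\<^sub>e prj UNIV = a"
    by (rule endo_eqI; simp add: endo_comp.rep_eq prj_UNIV)+
  have "cprj (\<tau> s) UNIV \<circ>\<^sub>e act a \<circ>\<^sub>e cprj (\<tau> s) UNIV = act a \<circ>\<^sub>e cprj (\<tau> s) UNIV"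
    by (cases "\<tau> s") (simp_all add: cprj_def act_cmp_Dl act_cmp_Vc act_cmp_Tr cmp_act_Dl cmp_act_Vc
        cmp_act_Tr endo_comp_neg endo_comp_0 cmp_Dl_Dl cmp_Vc_Vc id)
  moreover have "(\<lambda>_::nat. UNIV :: nat set)(s := UNIV) = (\<lambda>_. UNIV)" by (rule ext) simp
  ultimately show "slot s (act a) t \<in> Box d \<tau> (\<lambda>_. UNIV)"
    using Box_slot_update[OF t s, of "\<tau> s" UNIV "act a"] by (simp only: fun_upd_triv)
qed

lemma tpow_kinds: "tpow d \<subseteq> cvs.span (\<Union>\<tau>\<in>{..<d} \<rightarrow>\<^sub>E {Dl, Vc, Tr}. Box d \<tau> (\<lambda>_. UNIV))"
proof
  fix t :: "'v ext tensor_algebra" assume t: "t \<in> tpow d"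
  have "dual_endo (prj UNIV) f = f" for f by (rule dual_eqI) (simp add: dual_endo.rep_eq prj_UNIV)
  then have one: "endo_apply (cprj Dl UNIV + cprj Vc UNIV + cprj Tr UNIV) \<xi> = \<xi>" for \<xi>
    by (cases \<xi>) (simp add: cprj_def cmp_apply plus_endo.rep_eq prj_UNIV)
  have "t \<in> cvs.span (\<Union>\<tau>\<in>{..<d} \<rightarrow>\<^sub>E {Dl, Vc, Tr}. {t \<in> tpow d. \<forall>s<d. slot s (cprj (\<tau> s) UNIV) t = t})"
  proof (rule tpow_decompose[OF t])
    show "cprj l UNIV \<circ>\<^sub>e cprj l UNIV = cprj l UNIV" for l by (simp add: cprj_cprj)
    fix s assume s: "s < d"
    have id: "clinear (\<lambda>t::'v ext tensor_algebra. t)" by (simp add: clinear_iff)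
    have "slot s (cprj Dl UNIV + cprj Vc UNIV + cprj Tr UNIV) t = t"
      by (rule tpow_ext[OF clinear_slot id t]) (use s one in \<open>simp add: slot_tens\<close>)
    then show "(\<Sum>l\<in>{Dl, Vc, Tr}. slot s (cprj l UNIV) t) = t"
      by (simp add: slot_add_left add.assoc)
  qed
  then show "t \<in> cvs.span (\<Union>\<tau>\<in>{..<d} \<rightarrow>\<^sub>E {Dl, Vc, Tr}. Box d \<tau> (\<lambda>_. UNIV))"
    by (simp only: Box_def)
qed

lemma finite_height_tpow: "finite_height (subs rowfin (der d) (tpow d))"
proof (rule finite_height_mono)
  show "finite_height (subs rowfin (der d) (cvs.span (\<Union>\<tau>\<in>{..<d} \<rightarrow>\<^sub>E {Dl, Vc, Tr}. Box d \<tau> (\<lambda>_. UNIV))))"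
    by (rule finite_height_subs_Union[OF finite_PiE clinear_der stable_Box_UNIV finite_height_Box]) auto
qed (rule subs_mono[OF tpow_kinds])

text \<open>Discards the auxiliary trivial component. It maps each tensor power of extended letters
  onto the original one, and finite height passes to images.\<close>

definition forget :: "'v ext tensor_algebra \<Rightarrow> ('v dual \<times> 'v) tensor_algebra" where
  "forget = tensor_lift (\<lambda>u. tens (map (\<lambda>\<xi>. (fst \<xi>, fst (snd \<xi>))) u))"

lemma multilinear_forget: "multilinear (\<lambda>u::'v ext list. tens (map (\<lambda>\<xi>. (fst \<xi>, fst (snd \<xi>))) u))"
  unfolding multilinear_def
proof (intro allI impI)
  fix u :: "'v ext list" and i assume "i < length u"
  then have "i < length (map (\<lambda>\<xi>. (fst \<xi>, fst (snd \<xi>))) u)" by simp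
  from clinear_tens_update[OF this]
  have "clinear (\<lambda>\<xi>::'v ext. tens ((map (\<lambda>\<xi>. (fst \<xi>, fst (snd \<xi>))) u)[i := (fst \<xi>, fst (snd \<xi>))]))"
    by (rule clinear_compose) (simp add: clinear_iff scaleC_prod_def)
  then show "clinear (\<lambda>\<xi>. tens (map (\<lambda>\<xi>. (fst \<xi>, fst (snd \<xi>))) (u[i := \<xi>])))"
    by (simp add: map_update)
qed

lemma clinear_forget: "clinear forget"
  unfolding forget_def by (rule clinear_tensor_lift[OF multilinear_forget])

lemma forget_tens: "forget (tens u) = tens (map (\<lambda>\<xi>. (fst \<xi>, fst (snd \<xi>))) u)"
  unfolding forget_def by (rule tensor_lift_tens[OF multilinear_forget])

lemma forget_der:
  assumes "t \<in> tpow d"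
  shows "forget (der d a t) = endo_apply (tensor_rep a) (forget t)"
proof (rule tpow_ext[OF clinear_compose[OF clinear_forget clinear_der]
      clinear_compose[OF clinear_endo_apply clinear_forget] assms])
  fix u :: "'v ext list" assume u: "length u = d"
  have "fst (endo_apply (act a) \<xi>) = endo_apply (coadjoint a) (fst \<xi>)"
    "fst (snd (endo_apply (act a) \<xi>)) = endo_apply a (fst (snd \<xi>))" for \<xi>
    by (cases \<xi>; simp add: act_apply coadjoint_apply)+
  then have "forget (slot s (act a) (tens u)) =
      slot s (prod_endo (coadjoint a) a) (forget (tens u))" if "s < d" for s
    using that u by (simp add: slot_tens forget_tens map_update prod_endo.rep_eq)
  then show "forget (der d a (tens u)) = endo_apply (tensor_rep a) (forget (tens u))"
    using u by (simp add: der_def tensor_rep_def clinear_sumD[OF clinear_forget] forget_tens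
        tensor_derivation_tens)
qed

lemma tpow_forget: "tpow d \<subseteq> forget ` tpow d"
proof -
  have "{tens u | u. length u = d} \<subseteq> forget ` (tpow d :: 'v ext tensor_algebra set)"
  proof
    fix t :: "('v dual \<times> 'v) tensor_algebra" assume "t \<in> {tens u | u. length u = d}"
    then obtain u where u: "t = tens u" "length u = d" by blast
    let ?t = "tens (map (\<lambda>(f, x). (f, x, 0)) u) :: 'v ext tensor_algebra"
    have "forget ?t = t" by (simp add: u(1) forget_tens comp_def split_def)
    moreover have "?t \<in> tpow d" using u(2) by (intro tens_tpow) simp
    ultimately show "t \<in> forget ` tpow d" by (rule image_eqI[OF sym])
  qed
  then show ?thesis
    unfolding tpow_def[of d, where ?'x = "'v dual \<times> 'v"]
    by (intro cvs.span_minimal subspace_image clinear_forget subspace_tpow)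
qed

lemma finite_height_tensor_power:
  "finite_height (subs rowfin (\<lambda>a. endo_apply (tensor_rep a)) (tpow d))"
proof (rule finite_height_subs_image[OF finite_height_tpow clinear_forget])
  show "stable rowfin (der d) (tpow d)" by (simp add: stable_def subspace_tpow der_tpow)
qed (simp_all add: forget_der tpow_forget)

end

section \<open>Dual bases of a non-degenerate pairing\<close>

definition biorthonormal :: "('w \<Rightarrow> 'v \<Rightarrow> complex) \<Rightarrow> ('v \<times> 'w) set \<Rightarrow> bool" where
  "biorthonormal P S \<longleftrightarrow> (\<forall>p\<in>S. \<forall>q\<in>S. P (snd p) (fst q) = (if p = q then 1 else 0))"

lemma nondegenerate_pairing_swap: "nondegenerate_pairing P \<Longrightarrow> nondegenerate_pairing (\<lambda>x y. P y x)"
  by (simp add: nondegenerate_pairing_def)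

text \<open>One Gram-Schmidt step. The part \<open>?c\<close> of \<open>b\<close> that the given
  system annihilates is either 0 or, by non-degeneracy, pairs non-trivially with some
  \<open>w0\<close>; this one is normalised and corrected so that it annihilates the old first
  components.\<close>

lemma biorthonormal_extend:
  fixes P :: "'w::complex_vector \<Rightarrow> 'v::complex_vector \<Rightarrow> complex"
  assumes P: "nondegenerate_pairing P" and S: "finite S" "biorthonormal P S"
  shows "\<exists>S'. finite S' \<and> S \<subseteq> S' \<and> biorthonormal P S' \<and> b \<in> cvs.span (fst ` S')"
proof -
  have lin: "clinear (P w)" "clinear (\<lambda>w. P w x)" for w x
    using P by (simp_all add: nondegenerate_pairing_def)
  let ?c = "b - (\<Sum>q\<in>S. P (snd q) b *\<^sub>C fst q)"
  have mem: "(\<Sum>q\<in>S. P (snd q) b *\<^sub>C fst q) \<in> cvs.span (fst ` S)"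
    by (intro cvs.span_sum cvs.span_scale cvs.span_base imageI)
  have orth: "P (snd p) (fst q) = (if p = q then 1 else 0)" if "p \<in> S" "q \<in> S" for p q
    using S(2) that by (simp add: biorthonormal_def)
  have c: "P (snd p) ?c = 0" if p: "p \<in> S" for p
  proof -
    have "(\<Sum>q\<in>S. P (snd p) (P (snd q) b *\<^sub>C fst q)) = (\<Sum>q\<in>S. if q = p then P (snd p) b else 0)"
      by (rule sum.cong) (auto simp: clinear_scaleD[OF lin(1)] scaleC_complex_def orth p)
    then show ?thesis using p S(1) by (simp add: clinear_diffD[OF lin(1)] clinear_sumD[OF lin(1)])
  qed
  show ?thesis
  proof (cases "?c = 0")
    case True
    then have "b = (\<Sum>q\<in>S. P (snd q) b *\<^sub>C fst q)" by simp
    then have "b \<in> cvs.span (fst ` S)" using mem by metis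
    then show ?thesis using S by blast
  next
    case False
    then obtain w0 where w0: "P w0 ?c \<noteq> 0" using P unfolding nondegenerate_pairing_def by metis
    let ?w1 = "inverse (P w0 ?c) *\<^sub>C w0"
    have w1: "P ?w1 ?c = 1" using w0 by (simp add: clinear_scaleD[OF lin(2)] scaleC_complex_def)
    let ?w = "?w1 - (\<Sum>q\<in>S. P ?w1 (fst q) *\<^sub>C snd q)"
    have w: "P ?w x = P ?w1 x - (\<Sum>q\<in>S. P ?w1 (fst q) * P (snd q) x)" for x
      by (simp only: clinear_diffD[OF lin(2)] clinear_sumD[OF lin(2)] clinear_scaleD[OF lin(2)] scaleC_complex_def)
    have wc: "P ?w ?c = 1" unfolding w w1 using c by simp
    have wx: "P ?w (fst p) = 0" if p: "p \<in> S" for p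
    proof -
      have "(\<Sum>q\<in>S. P ?w1 (fst q) * P (snd q) (fst p)) = (\<Sum>q\<in>S. if q = p then P ?w1 (fst p) else 0)"
        by (rule sum.cong) (auto simp: orth p)
      then show ?thesis unfolding w using p S(1) by simp
    qed
    let ?S = "insert (?c, ?w) S"
    have notin: "(?c, ?w) \<notin> S" using wx wc by force
    have "biorthonormal P ?S"
      unfolding biorthonormal_def
    proof (intro ballI)
      fix p q assume pq: "p \<in> ?S" "q \<in> ?S"
      consider "p = (?c, ?w)" "q = (?c, ?w)" | "p = (?c, ?w)" "q \<in> S" | "p \<in> S" "q = (?c, ?w)" | "p \<in> S" "q \<in> S"
        using pq by blast
      then show "P (snd p) (fst q) = (if p = q then 1 else 0)"
      proof cases
        case 1
        then show ?thesis using wc by simp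
      next
        case 2
        then have "p \<noteq> q" using notin by metis
        then show ?thesis using wx[OF 2(2)] 2(1) by simp
      next
        case 3
        then have "p \<noteq> q" using notin by metis
        then show ?thesis using c[OF 3(1)] 3(2) by simp
      next
        case 4
        then show ?thesis by (rule orth)
      qed
    qed
    moreover have "b \<in> cvs.span (fst ` ?S)"
    proof -
      have "?c \<in> cvs.span (fst ` ?S)" by (intro cvs.span_base) simp
      moreover have "cvs.span (fst ` S) \<subseteq> cvs.span (fst ` ?S)" by (intro cvs.span_mono image_mono) blast
      ultimately have "?c + (\<Sum>q\<in>S. P (snd q) b *\<^sub>C fst q) \<in> cvs.span (fst ` ?S)"
        using mem by (intro cvs.span_add) auto
      then show ?thesis by simp
    qed
    ultimately show ?thesis
      by (intro exI[of _ ?S] conjI finite.insertI S(1) subset_insertI)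
  qed
qed

text \<open>Non-degeneracy is symmetric in the two spaces, so the step for \<open>b\<close> is
  repeated for \<open>c\<close> with the roles exchanged; enlarging the system keeps
  \<open>b\<close> in the span.\<close>

lemma biorthonormal_extend2:
  fixes P :: "'w::complex_vector \<Rightarrow> 'v::complex_vector \<Rightarrow> complex"
  assumes P: "nondegenerate_pairing P" and S: "finite S" "biorthonormal P S"
  shows "\<exists>S'. finite S' \<and> S \<subseteq> S' \<and> biorthonormal P S' \<and> b \<in> cvs.span (fst ` S') \<and> c \<in> cvs.span (snd ` S')"
proof -
  have swap: "biorthonormal Q (prod.swap ` R)" if "biorthonormal (\<lambda>x y. Q y x) R"
    for Q :: "'a \<Rightarrow> 'b \<Rightarrow> complex" and R
    using that unfolding biorthonormal_def by (auto simp: prod.swap_def)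
  obtain R where R: "finite R" "S \<subseteq> R" "biorthonormal P R" "b \<in> cvs.span (fst ` R)"
    using biorthonormal_extend[OF P S] by blast
  have "biorthonormal (\<lambda>x y. P y x) (prod.swap ` R)" using R(3) by (intro swap) simp
  then obtain T where T: "finite T" "prod.swap ` R \<subseteq> T" "biorthonormal (\<lambda>x y. P y x) T" "c \<in> cvs.span (fst ` T)"
    using biorthonormal_extend[OF nondegenerate_pairing_swap[OF P], of "prod.swap ` R"] R(1) by blast
  let ?S = "prod.swap ` T"
  have "prod.swap ` prod.swap ` R \<subseteq> ?S" using T(2) by (rule image_mono)
  then have RS: "R \<subseteq> ?S" by (simp add: image_image)
  have "cvs.span (fst ` R) \<subseteq> cvs.span (fst ` ?S)" by (intro cvs.span_mono image_mono RS)
  moreover have "snd ` ?S = fst ` T" by (simp add: image_image)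
  ultimately show ?thesis
    using T R swap[OF T(3)] RS by (intro exI[of _ ?S]) auto
qed

text \<open>Back and forth: enumerate countable spanning sets of both spaces and let the n-th step
  absorb the n-th vector of each. The union of the resulting chain of finite systems then spans on
  both sides.\<close>

lemma ex_dual_bases:
  fixes P :: "'w::complex_vector \<Rightarrow> 'v::complex_vector \<Rightarrow> complex"
  assumes V: "countably_infinite_dimensional TYPE('v)" and W: "countably_infinite_dimensional TYPE('w)"
    and P: "nondegenerate_pairing P"
  shows "\<exists>(v :: nat \<Rightarrow> 'v) (w :: nat \<Rightarrow> 'w). (\<forall>i j. P (w i) (v j) = (if i = j then 1 else 0)) \<and>
    cvs.span (range v) = UNIV \<and> cvs.span (range w) = UNIV"
proof -
  obtain B :: "'v set" where B: "cvs.independent B" "cvs.span B = UNIV" "countable B" "infinite B"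
    using V unfolding countably_infinite_dimensional_def by blast
  obtain C :: "'w set" where C: "cvs.span C = UNIV" "countable C" "infinite C"
    using W unfolding countably_infinite_dimensional_def by blast
  let ?b = "from_nat_into B" and ?c = "from_nat_into C"
  have "\<exists>S. \<forall>n. (finite (S n) \<and> biorthonormal P (S n)) \<and> (S n \<subseteq> S (Suc n) \<and>
      ?b n \<in> cvs.span (fst ` S (Suc n)) \<and> ?c n \<in> cvs.span (snd ` S (Suc n)))"
  proof (rule dependent_nat_choice)
    show "\<exists>S. finite S \<and> biorthonormal P S" by (intro exI[of _ "{}"]) (simp add: biorthonormal_def)
    show "\<exists>S'. (finite S' \<and> biorthonormal P S') \<and> (S \<subseteq> S' \<and> ?b n \<in> cvs.span (fst ` S') \<and> ?c n \<in> cvs.span (snd ` S'))"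
      if "finite S \<and> biorthonormal P S" for S n
      using biorthonormal_extend2[OF P, of S "?b n" "?c n"] that by blast
  qed
  then obtain S where S: "\<And>n. finite (S n)" "\<And>n. biorthonormal P (S n)" "\<And>n. S n \<subseteq> S (Suc n)"
    "\<And>n. ?b n \<in> cvs.span (fst ` S (Suc n))" "\<And>n. ?c n \<in> cvs.span (snd ` S (Suc n))" by metis
  let ?T = "\<Union>n. S n"
  have mono: "S m \<subseteq> S n" if "m \<le> n" for m n using lift_Suc_mono_le[of S, OF S(3) that] .
  have orth: "P (snd p) (fst q) = (if p = q then 1 else 0)" if "p \<in> ?T" "q \<in> ?T" for p q
  proof -
    obtain m n where "p \<in> S m" "q \<in> S n" using \<open>p \<in> ?T\<close> \<open>q \<in> ?T\<close> by blast
    then have "p \<in> S (max m n)" "q \<in> S (max m n)" using mono[of m "max m n"] mono[of n "max m n"] by auto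
    then show ?thesis using S(2)[of "max m n"] by (simp add: biorthonormal_def)
  qed
  have "cvs.span (fst ` S (Suc n)) \<subseteq> cvs.span (fst ` ?T)" "cvs.span (snd ` S (Suc n)) \<subseteq> cvs.span (snd ` ?T)" for n
    by (intro cvs.span_mono image_mono UN_upper UNIV_I)+
  then have bc: "?b n \<in> cvs.span (fst ` ?T)" "?c n \<in> cvs.span (snd ` ?T)" for n
    using S(4,5)[of n] by auto
  have BT: "B \<subseteq> cvs.span (fst ` ?T)"
    using bc(1) range_from_nat_into[of B] B(3,4) by (metis finite.emptyI image_subsetI)
  have CT: "C \<subseteq> cvs.span (snd ` ?T)"
    using bc(2) range_from_nat_into[of C] C(2,3) by (metis finite.emptyI image_subsetI)
  have spans: "cvs.span (fst ` ?T) = UNIV" "cvs.span (snd ` ?T) = UNIV"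
    using cvs.span_minimal[OF BT cvs.subspace_span] cvs.span_minimal[OF CT cvs.subspace_span] B(2) C(1) by auto
  have "infinite ?T"
  proof
    assume "finite ?T"
    then have "finite (fst ` ?T)" by (rule finite_imageI)
    from cvs.independent_span_bound[OF this B(1) BT] show False using B(4) by blast
  qed
  moreover have "countable ?T" by (intro countable_UN) (auto intro: countable_finite S(1))
  ultimately have e: "bij_betw (from_nat_into ?T) UNIV ?T" by (intro bij_betw_from_nat_into)
  let ?e = "from_nat_into ?T"
  have rng: "range ?e = ?T" using e by (simp add: bij_betw_def)
  have inj: "?e i = ?e j \<longleftrightarrow> i = j" for i j using e by (auto simp: bij_betw_def inj_on_def)
  have mem: "?e i \<in> ?T" for i using rangeI[of ?e i] unfolding rng .
  have ranges: "range (\<lambda>i. fst (?e i)) = fst ` range ?e" "range (\<lambda>i. snd (?e i)) = snd ` range ?e"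
    by (simp_all only: image_image)
  have "cvs.span (range (\<lambda>i. fst (?e i))) = UNIV" "cvs.span (range (\<lambda>i. snd (?e i))) = UNIV"
    unfolding ranges rng by (rule spans)+
  moreover have "P (snd (?e i)) (fst (?e j)) = (if i = j then 1 else 0)" for i j
    using orth[OF mem[of i] mem[of j]] unfolding inj .
  then have "\<forall>i j. P (snd (?e i)) (fst (?e j)) = (if i = j then 1 else 0)" by (intro allI)
  ultimately show ?thesis by (intro exI conjI)
qed

text \<open>For a row-finite \<open>a\<close>, the functional of \<open>w i\<close> composed with
  \<open>a\<close> is a finite combination of the functionals of the \<open>w j\<close>, with row
  entries as coefficients. Linearity extends this to the span of the \<open>w i\<close>.\<close>

lemma rowfin_mackey_algebra:
  fixes P :: "'w::complex_vector \<Rightarrow> 'v::complex_vector \<Rightarrow> complex"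
  assumes P: "nondegenerate_pairing P" and w: "cvs.span (range w) = UNIV"
    and "dual_bases v (\<lambda>i. Dual (P (w i)))"
  shows "dual_bases.rowfin v (\<lambda>i. Dual (P (w i))) \<subseteq> mackey_algebra P"
proof
  interpret dual_bases v "\<lambda>i. Dual (P (w i))" by fact
  have lin: "clinear (P y)" "clinear (\<lambda>y. P y x)" for y x
    using P by (simp_all add: nondegenerate_pairing_def)
  have dual: "dual_apply (Dual (P y)) = P y" for y using lin by (simp add: Dual_inverse)
  have Pwv: "P (w i) (v j) = (if i = j then 1 else 0)" for i j using eps_v[of i j] by (simp add: dual)
  fix a assume a: "a \<in> rowfin"
  let ?G = "{y. \<exists>y'. \<forall>x. P y (endo_apply a x) = P y' x}"
  have "cvs.subspace ?G"
  proof (rule cvs.subspaceI)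
    show "0 \<in> ?G" using clinear_0D[OF lin(2)] by (intro CollectI exI[of _ 0]) simp
  next
    fix x y assume "x \<in> ?G" "y \<in> ?G"
    then obtain x' y' where "\<forall>z. P x (endo_apply a z) = P x' z" "\<forall>z. P y (endo_apply a z) = P y' z" by blast
    then show "x + y \<in> ?G"
      by (intro CollectI exI[of _ "x' + y'"]) (simp add: clinear_addD[OF lin(2)])
  next
    fix c x assume "x \<in> ?G"
    then obtain x' where "\<forall>z. P x (endo_apply a z) = P x' z" by blast
    then show "c *\<^sub>C x \<in> ?G"
      by (intro CollectI exI[of _ "c *\<^sub>C x'"]) (simp add: clinear_scaleD[OF lin(2)])
  qed
  moreover have "w i \<in> ?G" for i
  proof -
    let ?J = "{j. P (w i) (endo_apply a (v j)) \<noteq> 0}"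
    have J: "finite ?J" using a by (simp add: rowfin_def dual)
    let ?y = "\<Sum>j\<in>?J. P (w i) (endo_apply a (v j)) *\<^sub>C w j"
    have "P (w i) (endo_apply a x) = P ?y x" for x
    proof (rule clinear_v_ext[OF clinear_compose[OF lin(1) clinear_endo_apply] lin(1)])
      fix k
      have "P ?y (v k) = (\<Sum>j\<in>?J. if j = k then P (w i) (endo_apply a (v k)) else 0)"
        unfolding clinear_sumD[OF lin(2)]
        by (rule sum.cong) (auto simp: clinear_scaleD[OF lin(2)] scaleC_complex_def Pwv)
      then show "P (w i) (endo_apply a (v k)) = P ?y (v k)" using J by simp
    qed
    then show ?thesis by blast
  qed
  ultimately have "cvs.span (range w) \<subseteq> ?G" by (intro cvs.span_minimal) auto
  then have G: "\<exists>y'. \<forall>x. P y (endo_apply a x) = P y' x" for y unfolding w by blast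
  show "a \<in> mackey_algebra P"
    unfolding mackey_algebra_def
  proof (intro CollectI image_subsetI)
    fix f assume "f \<in> pairing_image P"
    then obtain y where y: "dual_apply f = P y" by (auto simp: pairing_image_def)
    obtain y' where "\<forall>x. P y (endo_apply a x) = P y' x" using G by blast
    then have "dual_apply (dual_endo a f) = P y'" by (simp add: fun_eq_iff dual_endo.rep_eq y)
    then show "dual_endo a f \<in> pairing_image P" by (auto simp: pairing_image_def)
  qed
qed

section \<open>Direct sums of copies of the tensor algebra\<close>

definition emb :: "nat \<Rightarrow> 'a::complex_vector \<Rightarrow> nat \<Rightarrow> 'a" where
  "emb i t = (\<lambda>j. if j = i then t else 0)"

lemma clinear_emb: "clinear (emb i)"
  by (auto simp: clinear_iff emb_def fun_eq_iff scaleC_fun_def)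

text \<open>A finite sum of tensor powers, which is what gives it finite height.\<close>

definition bounded_degree :: "nat \<Rightarrow> nat \<Rightarrow> (nat \<Rightarrow> 'x::complex_vector tensor_algebra) set" where
  "bounded_degree n k = cvs.span (\<Union>(i, d)\<in>{..<n} \<times> {..k}. emb i ` tpow d)"

lemma bounded_degree_mono: "k \<le> l \<Longrightarrow> bounded_degree n k \<subseteq> bounded_degree n l"
  unfolding bounded_degree_def by (intro cvs.span_mono UN_mono Sigma_mono) auto

lemma ex_bounded_degree:
  fixes s :: "nat \<Rightarrow> 'x::complex_vector tensor_algebra"
  assumes "\<And>i. n \<le> i \<Longrightarrow> s i = 0"
  shows "\<exists>k. s \<in> bounded_degree n k"
proof -
  have comp: "\<exists>k. emb i t \<in> bounded_degree n k" if i: "i < n" for i and t :: "'x tensor_algebra"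
  proof -
    let ?G = "{t :: 'x tensor_algebra. \<exists>k. emb i t \<in> bounded_degree n k}"
    have sub: "cvs.subspace (bounded_degree n k)" for k by (simp add: bounded_degree_def)
    have "cvs.subspace ?G"
    proof (rule cvs.subspaceI)
      show "0 \<in> ?G"
        using cvs.subspace_0[OF sub] by (intro CollectI exI[of _ 0]) (simp add: clinear_0D[OF clinear_emb])
    next
      fix x y assume "x \<in> ?G" "y \<in> ?G"
      then obtain k l where "emb i x \<in> bounded_degree n k" "emb i y \<in> bounded_degree n l" by blast
      then have "emb i x \<in> bounded_degree n (max k l)" "emb i y \<in> bounded_degree n (max k l)"
        using bounded_degree_mono[of k "max k l"] bounded_degree_mono[of l "max k l"] by auto
      then have "emb i (x + y) \<in> bounded_degree n (max k l)"
        using cvs.subspace_add[OF sub] by (simp add: clinear_addD[OF clinear_emb])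
      then show "x + y \<in> ?G" by blast
    next
      fix c x assume "x \<in> ?G"
      then obtain k where "emb i x \<in> bounded_degree n k" by blast
      then have "emb i (c *\<^sub>C x) \<in> bounded_degree n k"
        using cvs.subspace_scale[OF sub] by (simp add: clinear_scaleD[OF clinear_emb])
      then show "c *\<^sub>C x \<in> ?G" by blast
    qed
    moreover have "tens u \<in> ?G" for u :: "'x list"
    proof -
      have "emb i (tens u) \<in> bounded_degree n (length u)"
        unfolding bounded_degree_def using i
        by (intro cvs.span_base UN_I[of "(i, length u)"]) (auto intro: tens_tpow)
      then show ?thesis by blast
    qed
    ultimately have "cvs.span (range tens) \<subseteq> ?G" by (intro cvs.span_minimal) auto
    then show ?thesis unfolding span_tens by blast
  qed
  then have "\<forall>i. \<exists>k. i < n \<longrightarrow> emb i (s i) \<in> bounded_degree n k" by blast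
  then obtain k where k: "\<And>i. i < n \<Longrightarrow> emb i (s i) \<in> bounded_degree n (k i)" by metis
  let ?k = "\<Sum>i<n. k i"
  have "emb i (s i) \<in> bounded_degree n ?k" if "i < n" for i
  proof -
    have "k i \<le> ?k" using that by (intro member_le_sum) auto
    then show ?thesis using k[OF that] bounded_degree_mono by blast
  qed
  then have "(\<Sum>i<n. emb i (s i)) \<in> bounded_degree n ?k"
    unfolding bounded_degree_def by (intro cvs.span_sum) auto
  moreover have "s = (\<Sum>i<n. emb i (s i))"
  proof
    fix j
    have "clinear (\<lambda>s::nat \<Rightarrow> 'x tensor_algebra. s j)" by (simp add: clinear_iff scaleC_fun_def)
    then have "(\<Sum>i<n. emb i (s i)) j = (\<Sum>i<n. emb i (s i) j)" by (rule clinear_sumD)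
    also have "\<dots> = (\<Sum>i<n. if i = j then s j else 0)" by (rule sum.cong) (auto simp: emb_def)
    also have "\<dots> = s j" using assms[of j] by auto
    finally show "s j = (\<Sum>i<n. emb i (s i)) j" by simp
  qed
  ultimately show ?thesis by (intro exI[of _ ?k]) simp
qed

lemma stable_tpow: "stable G (\<lambda>a. endo_apply (tensor_rep a)) (tpow d)"
  by (auto simp: stable_def subspace_tpow tensor_rep_def tensor_derivation_tpow
      intro!: cvs.subspace_sum[OF subspace_tpow] slot_tpow)

lemma seq_emb: "emb i (endo_apply (tensor_rep a) t) = endo_apply (seq_endo (tensor_rep a)) (emb i t)"
  by (auto simp: emb_def seq_endo.rep_eq endo_0)

lemma stable_emb:
  fixes G :: "'v::complex_vector endo set"
  shows "stable G (\<lambda>a. endo_apply (seq_endo (tensor_rep a))) (emb i ` tpow d)"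
  unfolding stable_def
proof (intro conjI ballI)
  show "cvs.subspace (emb i ` tpow d)" by (rule subspace_image[OF clinear_emb subspace_tpow])
  fix a and x :: "nat \<Rightarrow> ('v dual \<times> 'v) tensor_algebra"
  assume a: "a \<in> G" and "x \<in> emb i ` tpow d"
  then obtain t where t: "t \<in> tpow d" "x = emb i t" by blast
  show "endo_apply (seq_endo (tensor_rep a)) x \<in> emb i ` tpow d"
    unfolding t(2) seq_emb[symmetric] using stable_op[OF stable_tpow a t(1)] by (rule imageI)
qed

lemma stable_bounded_degree:
  "stable G (\<lambda>a. endo_apply (seq_endo (tensor_rep a))) (bounded_degree n k)"
  unfolding bounded_degree_def by (rule stable_span[OF clinear_endo_apply]) (auto intro: stable_emb)

lemma (in dual_bases) finite_height_bounded_degree: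
  "finite_height (subs rowfin (\<lambda>a. endo_apply (seq_endo (tensor_rep a))) (bounded_degree n k))"
  unfolding bounded_degree_def
proof (rule finite_height_subs_Union)
  show "finite_height (subs rowfin (\<lambda>a. endo_apply (seq_endo (tensor_rep a))) (case j of (i, d) \<Rightarrow> emb i ` tpow d))" for j
  proof (cases j)
    case (Pair i d)
    have "finite_height (subs rowfin (\<lambda>a. endo_apply (seq_endo (tensor_rep a))) (emb i ` tpow d))"
      by (rule finite_height_subs_image[where \<phi> = "emb i" and S = "tpow d" and A = "\<lambda>a. endo_apply (tensor_rep a)",
            OF finite_height_tensor_power clinear_emb stable_tpow seq_emb order_refl])
    then show ?thesis using Pair by simp
  qed
qed (auto intro: clinear_endo_apply stable_emb)

section \<open>Restriction to the Mackey Lie algebra\<close>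

theorem theorem2p1:
  fixes P :: "'w::complex_vector \<Rightarrow> 'v::complex_vector \<Rightarrow> complex"
    and \<sigma> :: "'v endo \<Rightarrow> 'm::complex_vector endo"
  assumes "countably_infinite_dimensional TYPE('v)"
    and "countably_infinite_dimensional TYPE('w)"
    and "nondegenerate_pairing P"
    and "tensor_module \<sigma>"
  shows "finite_length (mackey_algebra P) \<sigma>"
proof -
  obtain v :: "nat \<Rightarrow> 'v" and w :: "nat \<Rightarrow> 'w" where vw:
    "\<And>i j. P (w i) (v j) = (if i = j then 1 else 0)" "cvs.span (range v) = UNIV" "cvs.span (range w) = UNIV"
    using ex_dual_bases[OF assms(1-3)] by blast
  let ?eps = "\<lambda>i. Dual (P (w i))"
  have "dual_apply (?eps i) = P (w i)" for i
    using assms(3) by (intro Dual_inverse) (simp add: nondegenerate_pairing_def)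
  then have db: "dual_bases v ?eps" by unfold_locales (simp_all add: vw)
  interpret dual_bases v ?eps by (rule db)
  have rf: "rowfin \<subseteq> mackey_algebra P" by (rule rowfin_mackey_algebra[OF assms(3) vw(3) db])
  let ?A = "\<lambda>a. endo_apply (seq_endo (tensor_rep a)) :: (nat \<Rightarrow> ('v dual \<times> 'v) tensor_algebra) \<Rightarrow> _"
  obtain n W U where WU: "submodule UNIV (\<lambda>a. seq_endo (tensor_rep a)) W" "W \<subseteq> {s. \<forall>i\<ge>n. s i = 0}"
    "iso_to_quotient \<sigma> (\<lambda>a. seq_endo (tensor_rep a)) W U" and len: "finite_length UNIV \<sigma>"
    using assms(4) unfolding tensor_module_def by blast
  obtain \<phi> where \<phi>: "bij_betw \<phi> ((\<lambda>w. w +o U) ` W) UNIV"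
    "\<And>x y. x \<in> W \<Longrightarrow> y \<in> W \<Longrightarrow> \<phi> ((x + y) +o U) = \<phi> (x +o U) + \<phi> (y +o U)"
    "\<And>c x. x \<in> W \<Longrightarrow> \<phi> ((c *\<^sub>C x) +o U) = c *\<^sub>C \<phi> (x +o U)"
    "\<And>a x. x \<in> W \<Longrightarrow> \<phi> (?A a x +o U) = endo_apply (\<sigma> a) (\<phi> (x +o U))"
    using WU(3) unfolding iso_to_quotient_def by blast
  \<comment> \<open>The projection of \<open>W\<close> onto the module. It is known to be linear on
    \<open>W\<close> only, so the lemmas on images under linear maps are replaced by direct
    arguments below.\<close>
  define \<psi> where "\<psi> x = \<phi> (x +o U)" for x
  have add: "\<psi> (x + y) = \<psi> x + \<psi> y" if "x \<in> W" "y \<in> W" for x y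
    unfolding \<psi>_def by (rule \<phi>(2)[OF that])
  have scale: "\<psi> (c *\<^sub>C x) = c *\<^sub>C \<psi> x" if "x \<in> W" for c x
    unfolding \<psi>_def by (rule \<phi>(3)[OF that])
  have equiv: "\<psi> (?A a x) = endo_apply (\<sigma> a) (\<psi> x)" if "x \<in> W" for a x
    unfolding \<psi>_def by (rule \<phi>(4)[OF that])
  have surj: "\<psi> ` W = UNIV"
  proof -
    have "\<psi> ` W = \<phi> ` ((\<lambda>w. w +o U) ` W)" unfolding image_image \<psi>_def ..
    then show ?thesis using \<phi>(1) unfolding bij_betw_def by (elim conjE) (rule trans)
  qed
  have stW: "stable UNIV ?A W" using WU(1) by (simp add: submodule_def stable_def)
  have W0: "0 \<in> W" by (rule cvs.subspace_0[OF stable_subspace[OF stW]])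
  have \<psi>0: "\<psi> 0 = 0" using scale[OF W0, of 0] by simp
  let ?Y = "\<lambda>k. W \<inter> bounded_degree n k"
  have stY: "stable G ?A (?Y k)" for G k
    by (intro stable_Int stable_bounded_degree stable_mono[OF stW]) simp
  \<comment> \<open>Images of the parts of bounded degree: an increasing chain of submodules over
    all endomorphisms that covers the module.\<close>
  define M where "M k = \<psi> ` ?Y k" for k
  have M_mono: "M k \<subseteq> M l" if "k \<le> l" for k l
    unfolding M_def using bounded_degree_mono[OF that] by (intro image_mono) blast
  have M_cover: "\<exists>k. x \<in> M k" for x
  proof -
    obtain s where s: "s \<in> W" "x = \<psi> s" using surj by (metis UNIV_I imageE)
    then obtain k where "s \<in> bounded_degree n k" using ex_bounded_degree[of n s] WU(2) by blast
    then show ?thesis unfolding M_def using s by blast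
  qed
  have M_sub: "submodule UNIV \<sigma> (M k)" for k
    unfolding submodule_def
  proof (intro conjI ballI cvs.subspaceI)
    have Y: "cvs.subspace (?Y k)" by (rule stable_subspace[OF stY])
    show "0 \<in> M k" unfolding M_def using cvs.subspace_0[OF Y] \<psi>0 by (metis image_eqI)
    show "x + y \<in> M k" if "x \<in> M k" "y \<in> M k" for x y
    proof -
      obtain s t where st: "s \<in> ?Y k" "x = \<psi> s" "t \<in> ?Y k" "y = \<psi> t"
        using \<open>x \<in> M k\<close> \<open>y \<in> M k\<close> unfolding M_def by (elim imageE)
      have "\<psi> (s + t) = x + y" using add st by simp
      then show ?thesis unfolding M_def using cvs.subspace_add[OF Y st(1,3)] by (metis image_eqI)
    qed
    show "c *\<^sub>C x \<in> M k" if "x \<in> M k" for c x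
    proof -
      obtain s where st: "s \<in> ?Y k" "x = \<psi> s" using \<open>x \<in> M k\<close> unfolding M_def by (elim imageE)
      have "\<psi> (c *\<^sub>C s) = c *\<^sub>C x" using scale st by simp
      then show ?thesis unfolding M_def using cvs.subspace_scale[OF Y st(1), of c] by (metis image_eqI)
    qed
    show "endo_apply (\<sigma> a) x \<in> M k" if "x \<in> M k" for a x
    proof -
      obtain s where st: "s \<in> ?Y k" "x = \<psi> s" using \<open>x \<in> M k\<close> unfolding M_def by (elim imageE)
      have "\<psi> (?A a s) = endo_apply (\<sigma> a) x" using equiv st by simp
      then show ?thesis unfolding M_def using stable_op[OF stY UNIV_I st(1), of a] by (metis image_eqI)
    qed
  qed
  \<comment> \<open>Finite length over \<open>UNIV\<close> enters here: the chain swallows one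
    composition factor after the other. Once a member contains \<open>F i\<close> and an element of
    \<open>F (Suc i)\<close> outside \<open>F i\<close>, simplicity of the factor gives all of
    \<open>F (Suc i)\<close>.\<close>
  obtain k where k: "M k = UNIV"
  proof -
    obtain m :: nat and F where F: "F 0 = {0}" "F m = UNIV" "\<And>i. i \<le> m \<Longrightarrow> submodule UNIV \<sigma> (F i)"
      "\<And>i. i < m \<Longrightarrow> F i \<subset> F (Suc i)"
      "\<And>i L. i < m \<Longrightarrow> submodule UNIV \<sigma> L \<Longrightarrow> F i \<subset> L \<Longrightarrow> \<not> L \<subset> F (Suc i)"
      using len unfolding finite_length_def by metis
    have "\<exists>k. F i \<subseteq> M k" if "i \<le> m" for i
      using that
    proof (induction i)
      case 0
      have "0 \<in> M 0" using M_sub[of 0] cvs.subspace_0 unfolding submodule_def by blast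
      then show ?case by (intro exI[of _ 0]) (simp add: F(1))
    next
      case (Suc i)
      then obtain l where l: "F i \<subseteq> M l" by auto
      have i: "i < m" using Suc.prems by simp
      obtain x where x: "x \<in> F (Suc i)" "x \<notin> F i" using F(4)[OF i] by blast
      obtain l' where l': "x \<in> M l'" using M_cover by blast
      let ?l = "max l l'"
      let ?L = "M ?l \<inter> F (Suc i)"
      have "submodule UNIV \<sigma> ?L"
        using M_sub[of ?l] F(3)[OF Suc.prems] by (auto simp: submodule_def cvs.subspace_inter)
      moreover have "F i \<subset> ?L"
        using l x l' M_mono[of l ?l] M_mono[of l' ?l] F(4)[OF i] by auto
      ultimately have "\<not> ?L \<subset> F (Suc i)" by (rule F(5)[OF i])
      then have "F (Suc i) \<subseteq> M ?l" by blast
      then show ?case by blast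
    qed
    from this[of m] show thesis using that F(2) by blast
  qed
  have "finite_height (subs rowfin (\<lambda>a. endo_apply (\<sigma> a)) UNIV)"
  proof (rule finite_height_detect1[OF finite_height_bounded_degree[of n k],
        where \<phi> = "\<lambda>N. {s \<in> ?Y k. \<psi> s \<in> N}"])
    show "{s \<in> ?Y k. \<psi> s \<in> N} \<in> subs rowfin ?A (bounded_degree n k)"
      if "N \<in> subs rowfin (\<lambda>a. endo_apply (\<sigma> a)) UNIV" for N
    proof -
      have N: "stable rowfin (\<lambda>a. endo_apply (\<sigma> a)) N" using that by (simp add: subs_def)
      have Y: "cvs.subspace (?Y k)" by (rule stable_subspace[OF stY])
      have "stable rowfin ?A {s \<in> ?Y k. \<psi> s \<in> N}"
        unfolding stable_def
      proof (intro conjI ballI cvs.subspaceI)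
        show "0 \<in> {s \<in> ?Y k. \<psi> s \<in> N}"
          using cvs.subspace_0[OF Y] cvs.subspace_0[OF stable_subspace[OF N]] by (simp add: \<psi>0)
        show "x + y \<in> {s \<in> ?Y k. \<psi> s \<in> N}"
          if "x \<in> {s \<in> ?Y k. \<psi> s \<in> N}" "y \<in> {s \<in> ?Y k. \<psi> s \<in> N}" for x y
          using that cvs.subspace_add[OF Y, of x y] cvs.subspace_add[OF stable_subspace[OF N], of "\<psi> x" "\<psi> y"] add[of x y]
          by simp
        show "c *\<^sub>C x \<in> {s \<in> ?Y k. \<psi> s \<in> N}" if "x \<in> {s \<in> ?Y k. \<psi> s \<in> N}" for c x
          using that cvs.subspace_scale[OF Y, of x c] cvs.subspace_scale[OF stable_subspace[OF N], of "\<psi> x" c] scale[of x c]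
          by simp
        show "?A a x \<in> {s \<in> ?Y k. \<psi> s \<in> N}" if "a \<in> rowfin" "x \<in> {s \<in> ?Y k. \<psi> s \<in> N}" for a x
          using that stable_op[OF stY UNIV_I, of x k a] stable_op[OF N, of a "\<psi> x"] equiv[of x a]
          by simp
      qed
      then show ?thesis by (auto simp: subs_def)
    qed
    show "{s \<in> ?Y k. \<psi> s \<in> N} \<subseteq> {s \<in> ?Y k. \<psi> s \<in> N'}" if "N \<subseteq> N'" for N N' using that by blast
    show "N' \<subseteq> N" if eq: "{s \<in> ?Y k. \<psi> s \<in> N} = {s \<in> ?Y k. \<psi> s \<in> N'}" for N N'
    proof
      fix x assume x: "x \<in> N'"
      have "x \<in> M k" unfolding k by simp
      then obtain s where s: "s \<in> ?Y k" "x = \<psi> s" unfolding M_def by blast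
      then have "s \<in> {s \<in> ?Y k. \<psi> s \<in> N'}" using x by simp
      then show "x \<in> N" unfolding eq[symmetric] using s(2) by simp
    qed
  qed
  moreover have "subs (mackey_algebra P) (\<lambda>a. endo_apply (\<sigma> a)) UNIV \<subseteq> subs rowfin (\<lambda>a. endo_apply (\<sigma> a)) UNIV"
    using stable_mono[OF _ rf] by (auto simp: subs_def)
  ultimately have "finite_height (subs (mackey_algebra P) (\<lambda>a. endo_apply (\<sigma> a)) UNIV)"
    by (rule finite_height_mono)
  then show ?thesis by (rule finite_height_imp_finite_length)
qed

end
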